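(* Let $\alpha$ be a continuous rotationally symmetric norm on $L^\infty(\mathbb T)$, let $\phi:\mathbb D\to\mathbb C$ be analytic and let $\psi:\mathbb T\to\mathbb C$ be measurable. Then: (1) $\psi L^\alpha(\mathbb T)\subset L^\alpha(\mathbb T)$ if and only if $\psi\in L^\infty(\mathbb T)$. Moreover, in this case $\|\psi\|_\infty=\|M_\psi\|$. (2) $\phi H^\alpha(\mathbb D)\subset H^\alpha(\mathbb D)$ if and only if $\phi\in H^\infty(\mathbb D)$. Moreover, in this case $\|\phi\|_\infty=\|M_\phi\|$.
   Context: $\mathbb D$ is the open unit disk, $\mathbb T$ the unit circle, $m$ normalized arc length on $\mathbb T$; functions on $\mathbb T$ equal a.e. are identified. For $w\in\mathbb T$, $f_w(z)=f(\overline wz)$. A continuous rotationally symmetric norm is a norm $\alpha$ on $L^\infty(\mathbb T)$ with $\alpha(1)=1$, $\alpha(|f|)=\alpha(f)$, $\alpha(f_w)=\alpha(f)$ for all $f\in L^\infty(\mathbb T)$, $w\in\mathbb T$, and $\lim_{m(E)\to0^+}\alpha(\chi_E)=0$. For any measurable $f:\mathbb T\to\mathbb C$ put $\alpha(f)=\sup\{\alpha(s):s\text{ a simple function},\ |s|\le|f|\}$. $\mathcal L^\alpha(\mathbb T)$ is the set of measurable $f$ with $\alpha(f)<\infty$, and $L^\alpha(\mathbb T)$ is the $\alpha$-closure of $L^\infty(\mathbb T)$ in $\mathcal L^\alpha(\mathbb T)$. $H^\alpha(\mathbb T)$ is the $\alpha$-closed linear span of $\{1,z,z^2,\ldots\}$;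 it is contained in $H^1(\mathbb T)$. $H^\alpha(\mathbb D)$ is the set of $f\in H^1(\mathbb D)$ whose boundary function $F$ lies in $H^\alpha(\mathbb T)$, with norm $\alpha(F)$. $M_\psi f=\psi f$ denotes the multiplication operator on the space in question ($L^\alpha(\mathbb T)$ in (1), $H^\alpha(\mathbb D)$ in (2)) and $\|M_\psi\|$ its operator norm. *)

theory Defs
  imports
    "HOL-Complex_Analysis.Complex_Analysis"
    "HOL-Probability.Probability"
begin

text \<open>
  Functions on the unit circle are represented by functions on \<^typ>\<open>complex\<close> whose values off
  \<^term>\<open>sphere 0 1 :: complex set\<close> are irrelevant, functions on the disk likewise off
  \<^term>\<open>ball 0 1 :: complex set\<close>.  Identification almost everywhere is not done by a quotient:
  all the sets of functions on the circle below are closed under almost-everywhere equality.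
  Norms, suprema and operator norms that may be infinite take values in \<^typ>\<open>ennreal\<close>.
\<close>

text \<open>The completion makes Lebesgue (not just Borel) measurable functions measurable.\<close>

definition circle_measure :: "complex measure" where
  "circle_measure =
     completion (distr (uniform_measure lborel {0..<1::real}) (restrict_space borel (sphere 0 1))
       (\<lambda>t. cis (2 * pi * t)))"

lemma space_circle_measure: "space circle_measure = sphere 0 1"
  by (simp add: circle_measure_def space_restrict_space)

lemma prob_space_circle_measure: "prob_space circle_measure"
proof -
  have "prob_space (uniform_measure lborel {0..<1::real})"
    by (rule prob_space_uniform_measure) auto
  moreover have "(\<lambda>t. cis (2 * pi * t))
      \<in> uniform_measure lborel {0..<1::real} \<rightarrow>\<^sub>M restrict_space borel (sphere 0 1)"
  proof (rule measurable_restrict_space2)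
    have "(\<lambda>t. cis (2 * pi * t)) \<in> borel_measurable borel"
      by (intro borel_measurable_continuous_onI continuous_intros)
    then show "(\<lambda>t. cis (2 * pi * t)) \<in> borel_measurable (uniform_measure lborel {0..<1::real})"
      by (simp add: measurable_def)
  qed auto
  ultimately show ?thesis
    unfolding circle_measure_def
    by (intro prob_space.prob_space_completion prob_space.prob_space_distr)
qed

definition Linf_norm :: "(complex \<Rightarrow> complex) \<Rightarrow> ennreal" where
  "Linf_norm f = esssup circle_measure (\<lambda>z. ennreal (norm (f z)))"

definition Linf_circle :: "(complex \<Rightarrow> complex) set" where
  "Linf_circle = {f \<in> borel_measurable circle_measure. Linf_norm f < \<infinity>}"

text \<open>
  A norm on almost-everywhere classes is a seminorm on representatives that vanishes exactly on
  functions that are zero almost everywhere; with the triangle inequality this makes it well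
  defined on classes.
\<close>

locale continuous_rotationally_symmetric_norm =
  fixes \<alpha> :: "(complex \<Rightarrow> complex) \<Rightarrow> real"
  assumes nonneg: "f \<in> Linf_circle \<Longrightarrow> 0 \<le> \<alpha> f"
    and eq_0_iff: "f \<in> Linf_circle \<Longrightarrow> \<alpha> f = 0 \<longleftrightarrow> (AE z in circle_measure. f z = 0)"
    and scale: "f \<in> Linf_circle \<Longrightarrow> \<alpha> (\<lambda>z. c * f z) = norm c * \<alpha> f"
    and triangle: "f \<in> Linf_circle \<Longrightarrow> g \<in> Linf_circle \<Longrightarrow> \<alpha> (\<lambda>z. f z + g z) \<le> \<alpha> f + \<alpha> g"
    and one: "\<alpha> (\<lambda>z. 1) = 1"
    and abs: "f \<in> Linf_circle \<Longrightarrow> \<alpha> (\<lambda>z. of_real (norm (f z))) = \<alpha> f"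
    and rotation: "f \<in> Linf_circle \<Longrightarrow> w \<in> sphere 0 1 \<Longrightarrow> \<alpha> (\<lambda>z. f (cnj w * z)) = \<alpha> f"
    and continuity: "0 < e \<Longrightarrow> \<exists>d>0. \<forall>E\<in>sets circle_measure.
      0 < measure circle_measure E \<and> measure circle_measure E < d \<longrightarrow> \<alpha> (indicator E) < e"

definition extended_norm :: "((complex \<Rightarrow> complex) \<Rightarrow> real) \<Rightarrow> (complex \<Rightarrow> complex) \<Rightarrow> ennreal" where
  "extended_norm \<alpha> f =
     (SUP s \<in> {s. simple_function circle_measure s \<and>
                  (AE z in circle_measure. norm (s z) \<le> norm (f z))}. ennreal (\<alpha> s))"

definition script_L_alpha :: "((complex \<Rightarrow> complex) \<Rightarrow> real) \<Rightarrow> (complex \<Rightarrow> complex) set" where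
  "script_L_alpha \<alpha> = {f \<in> borel_measurable circle_measure. extended_norm \<alpha> f < \<infinity>}"

definition alpha_closure ::
  "((complex \<Rightarrow> complex) \<Rightarrow> real) \<Rightarrow> (complex \<Rightarrow> complex) set \<Rightarrow> (complex \<Rightarrow> complex) set" where
  "alpha_closure \<alpha> S =
     {f \<in> script_L_alpha \<alpha>. \<forall>e>0. \<exists>g\<in>S. extended_norm \<alpha> (\<lambda>z. f z - g z) < ennreal e}"

definition L_alpha :: "((complex \<Rightarrow> complex) \<Rightarrow> real) \<Rightarrow> (complex \<Rightarrow> complex) set" where
  "L_alpha \<alpha> = alpha_closure \<alpha> Linf_circle"

text \<open>The linear span of the monomials is the set of polynomial functions.\<close>

definition H_alpha_circle :: "((complex \<Rightarrow> complex) \<Rightarrow> real) \<Rightarrow> (complex \<Rightarrow> complex) set" where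
  "H_alpha_circle \<alpha> = alpha_closure \<alpha> (range (poly :: complex poly \<Rightarrow> complex \<Rightarrow> complex))"

definition H1_disk :: "(complex \<Rightarrow> complex) set" where
  "H1_disk = {f. f holomorphic_on ball 0 1 \<and>
     (SUP r \<in> {0..<1::real}. \<integral>\<^sup>+ z. ennreal (norm (f (of_real r * z))) \<partial>circle_measure) < \<infinity>}"

definition boundary_function :: "(complex \<Rightarrow> complex) \<Rightarrow> complex \<Rightarrow> complex" where
  "boundary_function f z = Lim (at_left (1::real)) (\<lambda>r. f (of_real r * z))"

text \<open>
  By Fatou's theorem the radial limits of a function in \<open>H\<^sup>1\<close> exist almost everywhere, so the
  convergence clause excludes nothing; it only makes explicit that the boundary
  function is made of genuine limits and not of arbitrary values of \<^const>\<open>Lim\<close>.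
\<close>

definition H_alpha_disk :: "((complex \<Rightarrow> complex) \<Rightarrow> real) \<Rightarrow> (complex \<Rightarrow> complex) set" where
  "H_alpha_disk \<alpha> = {f \<in> H1_disk.
     (AE z in circle_measure.
        ((\<lambda>r. f (of_real r * z)) \<longlongrightarrow> boundary_function f z) (at_left (1::real))) \<and>
     boundary_function f \<in> H_alpha_circle \<alpha>}"

definition H_alpha_disk_norm ::
  "((complex \<Rightarrow> complex) \<Rightarrow> real) \<Rightarrow> (complex \<Rightarrow> complex) \<Rightarrow> ennreal" where
  "H_alpha_disk_norm \<alpha> f = extended_norm \<alpha> (boundary_function f)"

definition Hinf_norm :: "(complex \<Rightarrow> complex) \<Rightarrow> ennreal" where
  "Hinf_norm f = (SUP z \<in> ball 0 1. ennreal (norm (f z)))"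

definition Hinf_disk :: "(complex \<Rightarrow> complex) set" where
  "Hinf_disk = {f. f holomorphic_on ball 0 1 \<and> Hinf_norm f < \<infinity>}"

definition mult_op :: "(complex \<Rightarrow> complex) \<Rightarrow> (complex \<Rightarrow> complex) \<Rightarrow> complex \<Rightarrow> complex" where
  "mult_op \<psi> f = (\<lambda>z. \<psi> z * f z)"

text \<open>
  The norm of an operator \<open>T\<close> on the normed function space \<open>S\<close> with norm \<open>N\<close>.  The library's
  \<^const>\<open>onorm\<close> is not applicable, since it needs the space to be a type.
\<close>

definition operator_norm ::
  "((complex \<Rightarrow> complex) \<Rightarrow> ennreal) \<Rightarrow> (complex \<Rightarrow> complex) set \<Rightarrow>
   ((complex \<Rightarrow> complex) \<Rightarrow> complex \<Rightarrow> complex) \<Rightarrow> ennreal" where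
  "operator_norm N S T = (SUP f \<in> {f \<in> S. N f \<le> 1}. N (T f))"

end

(*
  A unimodular averaging argument makes the norm monotone, and continuity of the norm gives the
  Fatou property.  In (1), if \<psi> is unbounded, a series of normalised indicator functions of
  the sets |\<psi>| >= 4^n lies in L^alpha and is multiplied out of it.

  In (2), bounded functions are multipliers by Fatou's theorem on radial limits: the boundary
  function is the bounded pointwise limit of the dilations, hence an alpha-limit of polynomials.
  Fatou's theorem comes from an L^2 maximal inequality for the radial maximal function, by the
  TT* method applied to the Poisson kernel along an arbitrary measurable choice of radii.
  Conversely, let \<phi> be an unbounded multiplier.  All powers of \<phi> lie in H^alpha(D), and since
  point evaluations are bounded by the means on circles, the norms of \<phi>^n grow faster than
  geometrically.  A gliding hump over these powers produces an entire function h such that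
  h o \<phi> lies in H^alpha(D) but \<phi> (h o \<phi>) does not; composing with an entire function makes
  its radial limits evident, so that no theory of H^1 is needed.  For the operator norm, a bound
  K > ||M_\<phi>|| gives alpha(\<phi>^n) <= K^n, hence |\<phi>| <= K almost everywhere on the circle, hence
  in the disk by the Poisson formula.
*)

theory Submission
  imports Defs
begin

section \<open>Integration over the circle\<close>

text \<open>In (1) indicator functions detect where the multiplier is large. Analytic functions
  cannot be localised in this way, so in (2) the multiplier itself has to supply the test functions:
  in the converse they all have the form g o \<phi>. A closed graph argument would presuppose
  completeness and the boundary theory of H^1; an explicit sum of humps replaces it. Membership in
  \<open>H_alpha_disk\<close> asks for two things, bounded L^1 means inside the disk and a boundary
  function in the closure of the polynomials. Since no comparison between the two is established,
  the hump argument runs on the larger of both quantities. The maximal inequality is an L^2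
  statement because Parseval's identity makes the Taylor tails of a bounded function small in L^2 on
  all circles at once. It rests on the fact that Poisson kernels reproduce each other: composing
  those of radii r and s gives the kernel of radius rs.\<close>

abbreviation "\<mu> \<equiv> circle_measure"

interpretation circle: prob_space \<mu>
  by (rule prob_space_circle_measure)

lemma borel_measurable_circle_measureI:
  assumes "f \<in> borel_measurable borel"
  shows "f \<in> borel_measurable \<mu>"
proof -
  have "f \<in> borel_measurable (restrict_space borel (sphere 0 1))"
    using assms by (rule measurable_restrict_space1)
  then show ?thesis
    unfolding circle_measure_def by (intro measurable_completion) simp
qed

lemma measurable_ident_circle_measure [measurable]:
  "(\<lambda>z. z) \<in> borel_measurable \<mu>"
  by (rule borel_measurable_circle_measureI) simp

lemma continuous_on_sphere_borel_measurable:
  assumes "continuous_on (sphere 0 1) f"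
  shows "f \<in> borel_measurable \<mu>"
proof -
  have "f \<in> borel_measurable (restrict_space borel (sphere 0 1))"
    using assms by (rule borel_measurable_continuous_on_restrict)
  then show ?thesis
    unfolding circle_measure_def by (intro measurable_completion) simp
qed

text \<open>The completion in \<open>circle_measure\<close> pays here: a set that differs from a
  measurable one by a null set is measurable. Boundary functions are determined only almost
  everywhere and become measurable in this way.\<close>

lemma borel_measurable_circle_measure_AE_eq:
  fixes f g :: "complex \<Rightarrow> complex"
  assumes "f \<in> borel_measurable \<mu>" and "AE z in \<mu>. f z = g z"
  shows "g \<in> borel_measurable \<mu>"
proof -
  interpret complete_measure \<mu>
    unfolding circle_measure_def by (rule completion.complete_measure_axioms)
  show ?thesis
  proof (rule measurableI)
    fix A :: "complex set" assume "A \<in> sets borel"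
    with assms(1) have "f -` A \<inter> space \<mu> \<in> sets \<mu>"
      by (rule measurable_sets)
    moreover have "AE z in \<mu>.
        z \<in> f -` A \<inter> space \<mu> \<longleftrightarrow> z \<in> g -` A \<inter> space \<mu>"
      using assms(2) by eventually_elim auto
    ultimately show "g -` A \<inter> space \<mu> \<in> sets \<mu>"
      using in_sets_AE by blast
  qed auto
qed

text \<open>This links the abstract measure to integrals over the parameter interval, through which
  contour integrals along \<open>circlepath\<close> turn into integrals for \<mu>.\<close>

lemma integral_circle_measure:
  fixes f :: "complex \<Rightarrow> complex"
  assumes "continuous_on (sphere 0 1) f"
  shows "((\<lambda>t. f (cis (2 * pi * t))) has_integral (\<integral>z. f z \<partial>\<mu>)) {0..1}"
proof -
  let ?D = "distr (uniform_measure lborel {0..<1::real}) (restrict_space borel (sphere 0 1))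
       (\<lambda>t. cis (2 * pi * t))"
  have f: "f \<in> borel_measurable (restrict_space borel (sphere 0 1))"
    using assms by (rule borel_measurable_continuous_on_restrict)
  have c: "(\<lambda>t. cis (2 * pi * t)) \<in> borel_measurable borel"
    by (intro borel_measurable_continuous_onI continuous_intros)
  have "(\<lambda>t. cis (2 * pi * t)) \<in> borel_measurable (uniform_measure lborel {0..<1::real})"
    using c by (simp add: measurable_def)
  then have m: "(\<lambda>t. cis (2 * pi * t))
      \<in> uniform_measure lborel {0..<1::real} \<rightarrow>\<^sub>M restrict_space borel (sphere 0 1)"
    by (rule measurable_restrict_space2[rotated]) auto
  have cont: "continuous_on {0..1} (\<lambda>t. f (cis (2 * pi * t)))"
    by (rule continuous_on_compose2[OF assms]) (auto intro!: continuous_intros)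
  have fm: "(\<lambda>t. f (cis (2 * pi * t))) \<in> borel_measurable borel"
  proof (rule borel_measurable_continuous_onI)
    show "continuous_on UNIV (\<lambda>t. f (cis (2 * pi * t)))"
      by (rule continuous_on_compose2[OF assms]) (auto intro!: continuous_intros)
  qed
  have "(\<integral>z. f z \<partial>\<mu>) = (\<integral>z. f z \<partial>?D)"
    unfolding circle_measure_def using f by (intro integral_completion) simp
  also have "\<dots> = (\<integral>t. f (cis (2 * pi * t)) \<partial>uniform_measure lborel {0..<1::real})"
    using f m by (intro integral_distr) auto
  also have "\<dots> = (\<integral>t. f (cis (2 * pi * t)) \<partial>density lborel (\<lambda>t. ennreal (indicator {0..<1::real} t)))"
    unfolding uniform_measure_def by (simp add: divide_ennreal_def ennreal_indicator)
  also have "\<dots> = (\<integral>t. indicator {0..<1::real} t *\<^sub>R f (cis (2 * pi * t)) \<partial>lborel)"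
    using fm by (intro integral_density) auto
  also have "\<dots> = (\<integral>t. indicator {0..1::real} t *\<^sub>R f (cis (2 * pi * t)) \<partial>lborel)"
  proof (rule integral_cong_AE)
    show "AE x in lborel. indicat_real {0..<1} x *\<^sub>R f (cis (2 * pi * x)) =
                   indicat_real {0..1} x *\<^sub>R f (cis (2 * pi * x))"
      using AE_lborel_singleton[of 1] by eventually_elim (auto simp: indicator_def)
  qed (use fm in auto)
  finally have eq: "(\<integral>z. f z \<partial>\<mu>) = set_lebesgue_integral lborel {0..1::real} (\<lambda>t. f (cis (2 * pi * t)))"
    by (simp add: set_lebesgue_integral_def)
  have "set_integrable lborel {0..1} (\<lambda>t. f (cis (2 * pi * t)))"
    by (rule borel_integrable_atLeastAtMost') (rule cont)
  then show ?thesis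
    using has_integral_set_lebesgue[of "{0..1}" "\<lambda>t. f (cis (2 * pi * t))"] eq
      set_borel_integral_eq_integral[of "{0..1}" "\<lambda>t. f (cis (2 * pi * t))"]
    by (metis has_integral_integral)
qed

text \<open>On the circle dz / (2 \<pi> i) is z times normalized arc length; hence the extra factor
  \<open>z\<close> in the integrand.\<close>

lemma Cauchy_integral_circle_measure:
  assumes "continuous_on (cball 0 1) g" and "g holomorphic_on ball 0 1" and "norm w < 1"
  shows "(\<integral>z. g z * z / (z - w) \<partial>\<mu>) = g w"
proof -
  have "((\<lambda>u. g u / (u - w)) has_contour_integral (2 * of_real pi * \<i> * g w)) (circlepath 0 1)"
    using assms by (intro Cauchy_integral_circlepath) auto
  then have "((\<lambda>t. g (cis (2 * pi * t)) / (cis (2 * pi * t) - w) * (2 * of_real pi * \<i> * cis (2 * pi * t)))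
      has_integral (2 * of_real pi * \<i> * g w)) {0..1}"
    unfolding has_contour_integral_def
    by (rule has_integral_eq[rotated])
       (auto simp: vector_derivative_circlepath01, auto simp: circlepath cis_conv_exp mult_ac)
  from has_integral_mult_right[OF this, of "1 / (2 * of_real pi * \<i>)"]
  have 1: "((\<lambda>t. g (cis (2 * pi * t)) * cis (2 * pi * t) / (cis (2 * pi * t) - w)) has_integral g w) {0..1}"
    by (simp add: field_simps)
  have "continuous_on (sphere 0 1) (\<lambda>z. g z * z / (z - w))"
    using assms(3) by (intro continuous_intros continuous_on_subset[OF assms(1)]) auto
  from integral_circle_measure[OF this] 1 show ?thesis
    by (rule has_integral_unique)
qed

text \<open>Since \<open>cnj z\<close> inverts \<open>z\<close> on the circle, everything reduces to
  the mean of a nonnegative power or of its conjugate, which is Cauchy's formula at 0.\<close>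

lemma integral_circle_measure_power_cnj_power:
  "(\<integral>z. z ^ n * cnj z ^ m \<partial>\<mu>) = (if n = m then 1 else 0)"
proof -
  have pw: "(\<integral>z. z ^ k \<partial>\<mu>) = (if k = 0 then 1 else 0)" for k
  proof -
    have "(\<integral>z. z ^ k \<partial>\<mu>) = (\<integral>z. z ^ k * z / (z - 0) \<partial>\<mu>)"
      by (rule Bochner_Integration.integral_cong) (auto simp: space_circle_measure)
    also have "\<dots> = 0 ^ k"
      by (rule Cauchy_integral_circle_measure) (auto intro!: continuous_intros holomorphic_intros)
    finally show ?thesis by simp
  qed
  have cn: "z * cnj z = 1" if "norm z = 1" for z
    using that by (simp add: complex_norm_square[symmetric])
  show ?thesis
  proof (cases "m \<le> n")
    case True
    have "(\<integral>z. z ^ n * cnj z ^ m \<partial>\<mu>) = (\<integral>z. z ^ (n - m) \<partial>\<mu>)"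
    proof (rule Bochner_Integration.integral_cong)
      fix z assume "z \<in> space \<mu>"
      then have "z * cnj z = 1" by (auto simp: space_circle_measure intro: cn)
      have "z ^ n * cnj z ^ m = z ^ (n - m) * (z * cnj z) ^ m"
        using True by (simp add: power_mult_distrib power_add[symmetric] mult.assoc[symmetric])
      then show "z ^ n * cnj z ^ m = z ^ (n - m)" using \<open>z * cnj z = 1\<close> by simp
    qed simp
    with pw[of "n - m"] True show ?thesis by auto
  next
    case False
    have "(\<integral>z. z ^ n * cnj z ^ m \<partial>\<mu>) = (\<integral>z. cnj (z ^ (m - n)) \<partial>\<mu>)"
    proof (rule Bochner_Integration.integral_cong)
      fix z assume "z \<in> space \<mu>"
      then have "z * cnj z = 1" by (auto simp: space_circle_measure intro: cn)
      have "z ^ n * cnj z ^ m = cnj z ^ (m - n) * (z * cnj z) ^ n"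
        using False by (simp add: power_mult_distrib power_add[symmetric] mult_ac)
      then show "z ^ n * cnj z ^ m = cnj (z ^ (m - n))" using \<open>z * cnj z = 1\<close> by simp
    qed simp
    also have "\<dots> = cnj (\<integral>z. z ^ (m - n) \<partial>\<mu>)"
      by (simp flip: complex_cnj_power)
    finally show ?thesis using pw[of "m - n"] False by auto
  qed
qed

lemma AE_circle_measure_notin:
  "E \<in> sets \<mu> \<Longrightarrow> (AE z in \<mu>. z \<notin> E) \<longleftrightarrow> emeasure \<mu> E = 0"
  by (subst AE_iff_measurable[of E]) (auto dest: sets.sets_into_space)

lemma dilation_in_ball:
  fixes z :: complex
  assumes "0 \<le> r" "r < 1" "norm z \<le> 1"
  shows "of_real r * z \<in> ball 0 1"
proof -
  have "norm (of_real r * z) \<le> r * 1"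
    unfolding norm_mult using assms by (intro mult_mono) auto
  also have "\<dots> < 1" using assms by simp
  finally show ?thesis by (simp only: mem_ball_0)
qed

lemma holomorphic_dilation:
  assumes "f holomorphic_on ball 0 1" "0 \<le> r" "r < 1"
  shows "continuous_on (cball 0 1) (\<lambda>z. f (of_real r * z))"
    and "(\<lambda>z. f (of_real r * z)) holomorphic_on ball 0 1"
    and "(\<lambda>z. f (of_real r * z)) \<in> borel_measurable \<mu>"
proof -
  note ball = dilation_in_ball[OF assms(2,3)]
  show cont: "continuous_on (cball 0 1) (\<lambda>z. f (of_real r * z))"
    by (intro continuous_on_compose2[OF holomorphic_on_imp_continuous_on[OF assms(1)]] continuous_intros)
       (use ball in auto)
  show "(\<lambda>z. f (of_real r * z)) holomorphic_on ball 0 1"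
    by (intro holomorphic_on_compose_gen[OF _ assms(1), unfolded comp_def] holomorphic_intros)
       (use ball in auto)
  show "(\<lambda>z. f (of_real r * z)) \<in> borel_measurable \<mu>"
    by (intro continuous_on_sphere_borel_measurable continuous_on_subset[OF cont]) auto
qed

section \<open>Monotonicity and the Fatou property of the norm\<close>

lemma Linf_circle_iff:
  "f \<in> Linf_circle \<longleftrightarrow> f \<in> borel_measurable \<mu> \<and>
     (\<exists>C::real. AE z in \<mu>. norm (f z) \<le> C)"
proof safe
  assume f: "f \<in> Linf_circle"
  then show "f \<in> borel_measurable \<mu>" by (simp add: Linf_circle_def)
  obtain C where C: "Linf_norm f = ennreal C"
    using f by (cases "Linf_norm f") (auto simp: Linf_circle_def)
  have "AE z in \<mu>. ennreal (norm (f z)) \<le> ennreal C"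
    using esssup_AE[of "\<lambda>z. ennreal (norm (f z))" \<mu>] by (simp add: Linf_norm_def[symmetric] C)
  then have "AE z in \<mu>. norm (f z) \<le> max 0 C"
    by eventually_elim (metis ennreal_le_iff2 max.coboundedI1 max.coboundedI2 norm_ge_zero order.trans)
  then show "\<exists>C. AE z in \<mu>. norm (f z) \<le> C" by blast
next
  fix C assume f: "f \<in> borel_measurable \<mu>" and C: "AE z in \<mu>. norm (f z) \<le> C"
  have "Linf_norm f \<le> ennreal C"
    unfolding Linf_norm_def using f C
    by (intro esssup_I) (auto elim!: eventually_mono intro: ennreal_leI)
  then have "Linf_norm f < \<infinity>"
    using ennreal_less_top le_less_trans by fastforce
  with f show "f \<in> Linf_circle" by (simp add: Linf_circle_def)
qed

lemma Linf_circle_measurable [measurable_dest]: "f \<in> Linf_circle \<Longrightarrow> f \<in> borel_measurable \<mu>"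
  by (simp add: Linf_circle_def)

lemma Linf_circleI:
  "f \<in> borel_measurable \<mu> \<Longrightarrow> AE z in \<mu>. norm (f z) \<le> C \<Longrightarrow> f \<in> Linf_circle"
  by (auto simp: Linf_circle_iff)

lemma Linf_circleE:
  assumes "f \<in> Linf_circle"
  obtains C where "0 \<le> C" "AE z in \<mu>. norm (f z) \<le> C"
proof -
  obtain C where "AE z in \<mu>. norm (f z) \<le> C" using assms by (auto simp: Linf_circle_iff)
  then have "AE z in \<mu>. norm (f z) \<le> max 0 C" by eventually_elim auto
  then show ?thesis by (intro that) auto
qed

lemma Linf_circle_mono:
  assumes "g \<in> Linf_circle" "f \<in> borel_measurable \<mu>"
    "AE z in \<mu>. norm (f z) \<le> norm (g z)"
  shows "f \<in> Linf_circle"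
proof -
  obtain C where C: "AE z in \<mu>. norm (g z) \<le> C" using assms(1) by (auto simp: Linf_circle_iff)
  show ?thesis
    by (rule Linf_circleI[OF assms(2), of C]) (use assms(3) C in eventually_elim, auto)
qed

lemma Linf_circle_mult:
  assumes "f \<in> Linf_circle" "g \<in> Linf_circle"
  shows "(\<lambda>z. f z * g z) \<in> Linf_circle"
proof -
  obtain C where C: "0 \<le> C" "AE z in \<mu>. norm (f z) \<le> C" using assms(1) by (rule Linf_circleE)
  obtain D where D: "0 \<le> D" "AE z in \<mu>. norm (g z) \<le> D" using assms(2) by (rule Linf_circleE)
  show ?thesis
  proof (rule Linf_circleI)
    show "AE z in \<mu>. norm (f z * g z) \<le> C * D"
      using C(2) D(2) by eventually_elim (auto simp: norm_mult intro!: mult_mono C(1) D(1))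
  qed (use assms in measurable)
qed

lemma Linf_circle_add:
  assumes "f \<in> Linf_circle" "g \<in> Linf_circle"
  shows "(\<lambda>z. f z + g z) \<in> Linf_circle"
proof -
  obtain C D where *: "AE z in \<mu>. norm (f z) \<le> C" "AE z in \<mu>. norm (g z) \<le> D"
    using assms unfolding Linf_circle_iff by blast
  show ?thesis
  proof (rule Linf_circleI)
    show "AE z in \<mu>. norm (f z + g z) \<le> C + D"
      using * by eventually_elim (auto intro: norm_triangle_le)
  qed (use assms in measurable)
qed

lemma Linf_circle_const: "(\<lambda>z. c) \<in> Linf_circle"
  by (rule Linf_circleI[of _ "norm c"]) auto

lemma Linf_circle_cmult: "f \<in> Linf_circle \<Longrightarrow> (\<lambda>z. c * f z) \<in> Linf_circle"
  by (intro Linf_circle_mult Linf_circle_const)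

lemma Linf_circle_diff:
  assumes "f \<in> Linf_circle" "g \<in> Linf_circle"
  shows "(\<lambda>z. f z - g z) \<in> Linf_circle"
  using Linf_circle_add[OF assms(1) Linf_circle_cmult[OF assms(2), of "-1"]] by simp

lemma Linf_circle_sum:
  "(\<And>i. i \<in> I \<Longrightarrow> f i \<in> Linf_circle) \<Longrightarrow> (\<lambda>z. \<Sum>i\<in>I. f i z) \<in> Linf_circle"
  by (induction I rule: infinite_finite_induct) (auto intro: Linf_circle_const Linf_circle_add)

lemma Linf_circle_indicator: "E \<in> sets \<mu> \<Longrightarrow> indicator E \<in> Linf_circle"
  by (rule Linf_circleI[of _ 1]) (auto simp: indicator_def)

lemma simple_function_bounded:
  assumes "simple_function \<mu> (s :: complex \<Rightarrow> complex)"
  obtains C where "0 \<le> C" "\<And>z. z \<in> space \<mu> \<Longrightarrow> norm (s z) \<le> C"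
proof -
  have "finite (s ` space \<mu>)" using assms by (rule simple_functionD)
  then have "bounded (s ` space \<mu>)" by (rule finite_imp_bounded)
  then obtain C where "0 < C" "\<forall>x\<in>s ` space \<mu>. norm x \<le> C" by (auto simp: bounded_pos)
  then show ?thesis by (intro that[of C]) auto
qed

lemma simple_function_Linf_circle:
  assumes "simple_function \<mu> s" shows "s \<in> Linf_circle"
proof -
  obtain C where "\<And>z. z \<in> space \<mu> \<Longrightarrow> norm (s z) \<le> C"
    using simple_function_bounded[OF assms] by blast
  then show ?thesis
    by (intro Linf_circleI[of _ C] borel_measurable_simple_function assms) auto
qed

text \<open>This is convergence almost everywhere turned into convergence in measure:
  \<open>A k\<close> will be the set where the k-th function is still far from its limit. It is
  dominated convergence for the indicators.\<close>

lemma measure_eventually_notin_tendsto_0: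
  assumes "\<And>k. A k \<in> sets \<mu>"
    and "AE z in \<mu>. eventually (\<lambda>k. z \<notin> A k) sequentially"
  shows "(\<lambda>k. measure \<mu> (A k)) \<longlonglongrightarrow> 0"
proof -
  have "(\<lambda>k. \<integral>z. indicator (A k) z \<partial>\<mu>) \<longlonglongrightarrow> (\<integral>z. (0::real) \<partial>\<mu>)"
  proof (rule integral_dominated_convergence[where w = "\<lambda>_. 1"])
    show "AE x in \<mu>. (\<lambda>k. indicator (A k) x :: real) \<longlonglongrightarrow> 0"
      using assms(2)
      by eventually_elim (auto intro!: tendsto_eventually elim!: eventually_mono)
  qed (use assms(1) in \<open>auto simp: indicator_def\<close>)
  then show ?thesis using assms(1) sets.sets_into_space by (simp add: Int_absorb2)
qed

context continuous_rotationally_symmetric_norm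
begin

abbreviation \<N> :: "(complex \<Rightarrow> complex) \<Rightarrow> ennreal" where
  "\<N> \<equiv> extended_norm \<alpha>"

section \<open>The norm on bounded functions\<close>

lemma alpha_AE_le:
  assumes f: "f \<in> Linf_circle" and g: "g \<in> Linf_circle" and "AE z in \<mu>. f z = g z"
  shows "\<alpha> f \<le> \<alpha> g"
proof -
  have d: "(\<lambda>z. f z - g z) \<in> Linf_circle" by (rule Linf_circle_diff[OF f g])
  have "\<alpha> (\<lambda>z. f z - g z) = 0"
    using eq_0_iff[OF d] assms(3) by auto
  with triangle[OF g d] show ?thesis by simp
qed

lemma alpha_AE_cong:
  assumes "f \<in> Linf_circle" "g \<in> Linf_circle" "AE z in \<mu>. f z = g z"
  shows "\<alpha> f = \<alpha> g"
proof (rule antisym)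
  have "AE z in \<mu>. g z = f z" using assms(3) by eventually_elim simp
  then show "\<alpha> g \<le> \<alpha> f" using alpha_AE_le assms by blast
qed (rule alpha_AE_le[OF assms])

text \<open>
  If \<open>\<bar>f\<bar> \<le> \<bar>g\<bar>\<close>, then \<open>\<bar>f\<bar>\<close> is the average of \<open>u \<bar>g\<bar>\<close> and its conjugate for a unimodular \<open>u\<close>.
\<close>

lemma alpha_mono:
  assumes f: "f \<in> Linf_circle" and g: "g \<in> Linf_circle"
    and le: "AE z in \<mu>. norm (f z) \<le> norm (g z)"
  shows "\<alpha> f \<le> \<alpha> g"
proof -
  \<comment> \<open>The minimum keeps \<open>h\<close> in [0,1] also on the null set where the
    hypothesis fails. Where \<open>g\<close> vanishes the quotient is 0 by convention, which is the
    right value because \<open>f\<close> vanishes there too, almost everywhere. The function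
    \<open>u\<close> below is the unimodular function with real part \<open>h\<close>.\<close>
  define h where "h z = min 1 (norm (f z) / norm (g z))" for z
  define u where "u z = Complex (h z) (sqrt (1 - (h z)^2))" for z
  have h: "0 \<le> h z" "h z \<le> 1" for z by (auto simp: h_def)
  then have "(h z)^2 \<le> 1" for z by (simp add: power_le_one)
  then have nu: "norm (u z) = 1" for z by (simp add: u_def complex_norm)
  have hm [measurable]: "h \<in> borel_measurable \<mu>"
    unfolding h_def using f g by measurable
  have um: "u \<in> borel_measurable \<mu>"
    unfolding u_def Complex_eq by measurable
  have ucm: "(\<lambda>z. cnj (u z)) \<in> borel_measurable \<mu>"
    by (rule borel_measurable_continuous_on[OF _ um]) (intro continuous_intros)
  have ng: "(\<lambda>z. of_real (norm (g z))) \<in> Linf_circle" "(\<lambda>z. of_real (norm (f z))) \<in> Linf_circle"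
    using f g by (intro Linf_circle_mono[OF g] Linf_circle_mono[OF f]; simp add: Linf_circle_measurable)+
  have u: "u \<in> Linf_circle" "(\<lambda>z. cnj (u z)) \<in> Linf_circle"
    using um ucm nu by (auto intro!: Linf_circleI[of _ 1])
  let ?a = "\<lambda>z. u z * of_real (norm (g z))" and ?b = "\<lambda>z. cnj (u z) * of_real (norm (g z))"
  have ab: "?a \<in> Linf_circle" "?b \<in> Linf_circle" by (intro Linf_circle_mult u ng)+
  have "\<alpha> ?a = \<alpha> g" "\<alpha> ?b = \<alpha> g"
    using abs[OF ab(1)] abs[OF ab(2)] abs[OF g] by (simp_all add: norm_mult nu)
  moreover have "\<alpha> (\<lambda>z. of_real (norm (f z))) = \<alpha> (\<lambda>z. (1/2) * (?a z + ?b z))"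
  proof (rule alpha_AE_cong)
    show "AE z in \<mu>. of_real (norm (f z)) = (1/2) * (?a z + ?b z)"
      using le
    proof eventually_elim
      case (elim z)
      have "?a z + ?b z = of_real (2 * h z * norm (g z))"
        by (simp add: u_def complex_eq_iff algebra_simps)
      also have "h z * norm (g z) = norm (f z)"
        using elim by (cases "g z = 0") (auto simp: h_def min_def field_simps)
      then have "2 * h z * norm (g z) = 2 * norm (f z)" by simp
      finally show ?case by simp
    qed
  qed (intro ng ab Linf_circle_cmult Linf_circle_add)+
  ultimately show ?thesis
    using scale[OF Linf_circle_add[OF ab], of "1/2"] triangle[OF ab] abs[OF f] by simp
qed

lemma alpha_const: "\<alpha> (\<lambda>z. c) = norm c"
  using scale[OF Linf_circle_const, of c 1] one by simp

lemma alpha_le: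
  assumes "f \<in> borel_measurable \<mu>" "AE z in \<mu>. norm (f z) \<le> C" "0 \<le> C"
  shows "\<alpha> f \<le> C"
proof -
  have "\<alpha> f \<le> \<alpha> (\<lambda>z. of_real C)"
    using assms by (intro alpha_mono Linf_circle_const Linf_circleI[OF assms(1,2)]) auto
  then show ?thesis using assms(3) by (simp add: alpha_const)
qed

text \<open>The continuity axiom speaks of sets of positive measure. The indicator of a null set has
  norm 0, so null sets can be included and need not be treated separately later.\<close>

lemma alpha_indicator_small:
  assumes "0 < e"
  obtains d where "0 < d" "\<And>E. E \<in> sets \<mu> \<Longrightarrow> measure \<mu> E < d \<Longrightarrow> \<alpha> (indicator E) < e"
proof -
  obtain d where d: "0 < d" "\<And>E. E \<in> sets \<mu> \<Longrightarrow> 0 < measure \<mu> E \<Longrightarrow>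
      measure \<mu> E < d \<Longrightarrow> \<alpha> (indicator E) < e"
    using continuity[OF assms] by blast
  show ?thesis
  proof (rule that[OF d(1)])
    fix E assume E: "E \<in> sets \<mu>" "measure \<mu> E < d"
    show "\<alpha> (indicator E) < e"
    proof (cases "measure \<mu> E = 0")
      case True
      then have "AE z in \<mu>. z \<notin> E"
        using E(1) by (simp add: AE_circle_measure_notin circle.emeasure_eq_measure)
      then have "AE z in \<mu>. indicator E z = (0::complex)" by eventually_elim auto
      then have "\<alpha> (indicator E) = 0" using eq_0_iff[OF Linf_circle_indicator[OF E(1)]] by blast
      then show ?thesis using assms by simp
    qed (use d(2)[OF E(1)] E(2) in \<open>auto simp: zero_less_measure_iff\<close>)
  qed
qed

lemma alpha_indicator_pos:
  assumes "E \<in> sets \<mu>" "emeasure \<mu> E \<noteq> 0"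
  shows "0 < \<alpha> (indicator E)"
proof -
  have "\<not> (AE z in \<mu>. indicator E z = (0::complex))"
  proof
    assume "AE z in \<mu>. indicator E z = (0::complex)"
    then have "AE z in \<mu>. z \<notin> E" by eventually_elim (auto simp: indicator_def split: if_splits)
    then show False using assms by (simp add: AE_circle_measure_notin)
  qed
  then show ?thesis
    using eq_0_iff[OF Linf_circle_indicator[OF assms(1)]] nonneg[OF Linf_circle_indicator[OF assms(1)]] by force
qed

section \<open>The extended norm on measurable functions\<close>

lemma extended_norm_mono:
  assumes "AE z in \<mu>. norm (F z) \<le> norm (G z)"
  shows "\<N> F \<le> \<N> G"
  unfolding extended_norm_def
proof (rule SUP_subset_mono)
  have "AE z in \<mu>. norm (s z) \<le> norm (G z)"
    if "AE z in \<mu>. norm (s z) \<le> norm (F z)" for s :: "complex \<Rightarrow> complex"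
    using that assms by eventually_elim auto
  then show "{s :: complex \<Rightarrow> complex. simple_function \<mu> s \<and> (AE z in \<mu>. norm (s z) \<le> norm (F z))}
    \<subseteq> {s. simple_function \<mu> s \<and> (AE z in \<mu>. norm (s z) \<le> norm (G z))}"
    by blast
qed auto

lemma extended_norm_cong:
  assumes "AE z in \<mu>. norm (F z) = norm (G z)"
  shows "\<N> F = \<N> G"
proof (rule antisym)
  show "\<N> F \<le> \<N> G"
    using assms by (intro extended_norm_mono) (auto elim: eventually_mono)
  show "\<N> G \<le> \<N> F"
    using assms by (intro extended_norm_mono) (auto elim: eventually_mono)
qed

lemma extended_norm_le_alpha:
  assumes "f \<in> Linf_circle" shows "\<N> f \<le> ennreal (\<alpha> f)"
  unfolding extended_norm_def
  by (rule SUP_least) (auto intro!: ennreal_leI alpha_mono simple_function_Linf_circle assms)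

text \<open>Rounding the modulus of \<open>u\<close> down to a multiple of \<open>e\<close> gives a
  simple function below \<open>F\<close>, and the rounding error, being at most \<open>e\<close>
  everywhere, costs at most \<open>e\<close> in norm. Thus bounded functions may replace simple ones
  in the supremum.\<close>

lemma alpha_le_extended_norm:
  assumes u: "u \<in> Linf_circle" and le: "AE z in \<mu>. norm (u z) \<le> norm (F z)"
  shows "ennreal (\<alpha> u) \<le> \<N> F"
proof (rule ennreal_le_epsilon)
  fix e :: real assume e: "0 < e"
  obtain C where C: "0 \<le> C" "AE z in \<mu>. norm (u z) \<le> C" using u by (rule Linf_circleE)
  \<comment> \<open>The bound \<open>C\<close> holds only almost everywhere; cutting off above it
    makes the rounded function take finitely many values on all of the circle.\<close>
  define v where "v z = (if norm (u z) \<le> C then norm (u z) else 0)" for z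
  define s where "s z = complex_of_real (e * of_int \<lfloor>v z / e\<rfloor>)" for z
  have v: "0 \<le> v z" "v z \<le> C" "v z \<le> norm (u z)" for z using C(1) by (auto simp: v_def)
  have vm [measurable]: "v \<in> borel_measurable \<mu>" unfolding v_def using u by measurable
  have sm: "s \<in> borel_measurable \<mu>" unfolding s_def by measurable
  have "simple_function \<mu> s"
  proof (rule simple_function_borel_measurable[OF sm])
    have "s ` space \<mu> \<subseteq> (\<lambda>k. complex_of_real (e * of_int k)) ` {0..\<lfloor>C / e\<rfloor>}"
      using v e by (auto simp: s_def intro!: imageI floor_mono divide_right_mono)
    then show "finite (s ` space \<mu>)" by (rule finite_subset) auto
  qed
  moreover have s0: "0 \<le> e * of_int \<lfloor>v z / e\<rfloor>" "e * of_int \<lfloor>v z / e\<rfloor> \<le> v z" "v z \<le> e * of_int \<lfloor>v z / e\<rfloor> + e" for z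
  proof -
    have "e * of_int \<lfloor>v z / e\<rfloor> \<le> e * (v z / e)" "e * (v z / e) \<le> e * (of_int \<lfloor>v z / e\<rfloor> + 1)"
      using e by (intro mult_left_mono; linarith)+
    then show "e * of_int \<lfloor>v z / e\<rfloor> \<le> v z" "v z \<le> e * of_int \<lfloor>v z / e\<rfloor> + e"
      using e by (simp_all add: algebra_simps)
    show "0 \<le> e * of_int \<lfloor>v z / e\<rfloor>" using v(1)[of z] e by simp
  qed
  moreover have ns: "norm (s z) = e * of_int \<lfloor>v z / e\<rfloor>" for z
    using s0(1)[of z] unfolding s_def norm_of_real by simp
  moreover have "AE z in \<mu>. norm (s z) \<le> norm (F z)"
    using le by eventually_elim (metis ns order.trans s0(2) v(3))
  ultimately have 1: "ennreal (\<alpha> s) \<le> \<N> F"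
    unfolding extended_norm_def by (intro SUP_upper) auto
  have sL: "s \<in> Linf_circle"
    using v(2) s0(2) ns by (intro Linf_circleI[OF sm, of C]) (auto intro: order.trans)
  have dm: "(\<lambda>z. of_real (v z) - s z) \<in> borel_measurable \<mu>" using sm by measurable
  have nd: "norm (of_real (v z) - s z) \<le> e" for z
  proof -
    have "of_real (v z) - s z = of_real (v z - e * of_int \<lfloor>v z / e\<rfloor>)" by (simp add: s_def)
    then have "norm (of_real (v z) - s z) = \<bar>v z - e * of_int \<lfloor>v z / e\<rfloor>\<bar>" by (simp only: norm_of_real)
    then show ?thesis using s0(2,3)[of z] by linarith
  qed
  have dL: "(\<lambda>z. of_real (v z) - s z) \<in> Linf_circle" by (rule Linf_circleI[OF dm, of e]) (use nd in auto)
  have "\<alpha> u \<le> \<alpha> (\<lambda>z. s z + (of_real (v z) - s z))"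
  proof (rule alpha_mono[OF u Linf_circle_add[OF sL dL]])
    show "AE z in \<mu>. norm (u z) \<le> norm (s z + (of_real (v z) - s z))"
      using C(2) by eventually_elim (simp add: v_def)
  qed
  also have "\<dots> \<le> \<alpha> s + \<alpha> (\<lambda>z. of_real (v z) - s z)" by (rule triangle[OF sL dL])
  also have "\<alpha> (\<lambda>z. of_real (v z) - s z) \<le> e" using nd e by (intro alpha_le[OF dm]) auto
  finally have "\<alpha> u \<le> \<alpha> s + e" by simp
  then have "ennreal (\<alpha> u) \<le> ennreal (\<alpha> s) + ennreal e"
    using nonneg[OF sL] e by (simp add: ennreal_plus[symmetric] ennreal_leI del: ennreal_plus)
  also have "\<dots> \<le> \<N> F + ennreal e" using 1 by (rule add_right_mono)
  finally show "ennreal (\<alpha> u) \<le> \<N> F + ennreal e" .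
qed

lemma extended_norm_Linf: "f \<in> Linf_circle \<Longrightarrow> \<N> f = ennreal (\<alpha> f)"
  by (intro antisym extended_norm_le_alpha alpha_le_extended_norm) auto

text \<open>A simple function below |F + G| is divided in the ratio |F| : |G| into two parts below
  |F| and |G|. The parts are bounded but need not be simple, which is why
  \<open>alpha_le_extended_norm\<close> is needed.\<close>

lemma extended_norm_triangle:
  assumes [measurable]: "F \<in> borel_measurable \<mu>" "G \<in> borel_measurable \<mu>"
  shows "\<N> (\<lambda>z. F z + G z) \<le> \<N> F + \<N> G"
  unfolding extended_norm_def[of \<alpha> "\<lambda>z. F z + G z"]
proof (rule SUP_least, safe)
  fix s :: "complex \<Rightarrow> complex" assume s: "simple_function \<mu> s" and le: "AE z in \<mu>. norm (s z) \<le> norm (F z + G z)"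
  have sL: "s \<in> Linf_circle" by (rule simple_function_Linf_circle[OF s])
  note [measurable] = Linf_circle_measurable[OF sL]
  define a where "a z = s z * of_real (norm (F z) / (norm (F z) + norm (G z)))" for z
  define b where "b z = s z * of_real (norm (G z) / (norm (F z) + norm (G z)))" for z
  have am: "a \<in> borel_measurable \<mu>" "b \<in> borel_measurable \<mu>"
    unfolding a_def b_def by measurable
  have na: "norm (a z) = norm (s z) * (norm (F z) / (norm (F z) + norm (G z)))"
       "norm (b z) = norm (s z) * (norm (G z) / (norm (F z) + norm (G z)))" for z
    unfolding a_def b_def norm_mult norm_of_real by (simp_all add: add_nonneg_nonneg)
  have q: "x / (x + y) \<le> 1" "y / (x + y) \<le> 1" if "0 \<le> x" "0 \<le> y" for x y :: real
    using that by (cases "x + y = 0"; simp add: divide_le_eq)+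
  have "norm (a z) \<le> norm (s z)" "norm (b z) \<le> norm (s z)" for z
    unfolding na by (intro mult_left_le q norm_ge_zero; simp add: add.commute q)+
  then have L: "a \<in> Linf_circle" "b \<in> Linf_circle" using am sL by (auto intro: Linf_circle_mono)
  have bd: "AE z in \<mu>. norm (a z) \<le> norm (F z) \<and> norm (b z) \<le> norm (G z) \<and> norm (s z) \<le> norm (a z + b z)"
    using le
  proof eventually_elim
    case (elim z)
    let ?S = "norm (F z) + norm (G z)"
    have s1: "norm (s z) \<le> ?S" using elim norm_triangle_ineq[of "F z" "G z"] by linarith
    show ?case
    proof (cases "?S = 0")
      case True
      then have "s z = 0" using s1 by simp
      then show ?thesis by (simp add: a_def b_def)
    next
      case False
      then have S: "0 < ?S" by (metis add_nonneg_nonneg less_eq_real_def norm_ge_zero)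
      have "norm (s z) * (norm (F z) / ?S) \<le> norm (F z)" "norm (s z) * (norm (G z) / ?S) \<le> norm (G z)"
        using S s1 by (auto simp: divide_simps intro: mult_left_mono mult_right_mono)
          (metis mult.commute mult_left_mono norm_ge_zero)+
      moreover have "a z + b z = s z"
      proof -
        have "a z + b z = s z * of_real ((norm (F z) + norm (G z)) / ?S)"
          by (simp only: a_def b_def add_divide_distrib distrib_left of_real_add)
        then show ?thesis using False by simp
      qed
      ultimately show ?thesis unfolding na by simp
    qed
  qed
  have "\<alpha> s \<le> \<alpha> (\<lambda>z. a z + b z)"
    using bd by (intro alpha_mono sL Linf_circle_add L) (auto elim: eventually_mono)
  also have "\<dots> \<le> \<alpha> a + \<alpha> b" by (rule triangle[OF L])
  finally have "ennreal (\<alpha> s) \<le> ennreal (\<alpha> a) + ennreal (\<alpha> b)"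
    using nonneg L by (simp add: ennreal_plus[symmetric] ennreal_leI del: ennreal_plus)
  also have "\<dots> \<le> \<N> F + \<N> G"
    using bd L by (intro add_mono alpha_le_extended_norm) (auto elim: eventually_mono)
  finally show "ennreal (\<alpha> s) \<le> \<N> F + \<N> G" .
qed

lemma extended_norm_scale_le: "\<N> (\<lambda>z. c * F z) \<le> ennreal (norm c) * \<N> F"
  unfolding extended_norm_def[of \<alpha> "\<lambda>z. c * F z"]
proof (rule SUP_least, safe)
  fix s :: "complex \<Rightarrow> complex" assume s: "simple_function \<mu> s" and le: "AE z in \<mu>. norm (s z) \<le> norm (c * F z)"
  have sL: "s \<in> Linf_circle" by (rule simple_function_Linf_circle[OF s])
  show "ennreal (\<alpha> s) \<le> ennreal (norm c) * \<N> F"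
  proof (cases "c = 0")
    case True
    then have "AE z in \<mu>. s z = 0" using le by auto
    then have "\<alpha> s = 0" using eq_0_iff[OF sL] by blast
    then show ?thesis by simp
  next
    case False
    have L: "(\<lambda>z. (1 / c) * s z) \<in> Linf_circle" by (rule Linf_circle_cmult[OF sL])
    have "\<alpha> s = norm c * \<alpha> (\<lambda>z. (1 / c) * s z)" using scale[OF L, of c] False by simp
    moreover have "AE z in \<mu>. norm ((1 / c) * s z) \<le> norm (F z)"
      using le by eventually_elim (use False in \<open>simp add: norm_mult norm_divide field_simps\<close>)
    then have "ennreal (norm c) * ennreal (\<alpha> (\<lambda>z. (1 / c) * s z)) \<le> ennreal (norm c) * \<N> F"
      by (intro mult_left_mono alpha_le_extended_norm[OF L]) auto
    ultimately show ?thesis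
      by (simp only: ennreal_mult[OF norm_ge_zero nonneg[OF L]])
  qed
qed

lemma extended_norm_scale: "\<N> (\<lambda>z. c * F z) = ennreal (norm c) * \<N> F"
proof (cases "c = 0")
  case True
  then show ?thesis using extended_norm_scale_le[of c F] by simp
next
  case False
  have "ennreal (norm c) * \<N> F
      = ennreal (norm c) * \<N> (\<lambda>z. (1 / c) * (c * F z))" using False by simp
  also have "\<dots> \<le> ennreal (norm c) * (ennreal (norm (1 / c)) * \<N> (\<lambda>z. c * F z))"
    by (intro mult_left_mono extended_norm_scale_le) auto
  also have "\<dots> = \<N> (\<lambda>z. c * F z)"
    using False by (simp add: mult.assoc[symmetric] ennreal_mult[symmetric] norm_divide)
  finally show ?thesis by (intro antisym extended_norm_scale_le)
qed

lemma extended_norm_mult_le: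
  assumes "AE z in \<mu>. norm (g z) \<le> C" "0 \<le> C"
  shows "\<N> (\<lambda>z. g z * F z) \<le> ennreal C * \<N> F"
proof -
  have "\<N> (\<lambda>z. g z * F z) \<le> \<N> (\<lambda>z. of_real C * F z)"
    using assms(1)
    by (intro extended_norm_mono, eventually_elim) (use assms(2) in \<open>auto simp: norm_mult intro: mult_right_mono\<close>)
  then show ?thesis using assms(2) by (simp add: extended_norm_scale)
qed

text \<open>Continuity of the norm enters here, through convergence in measure.\<close>

lemma extended_norm_Fatou:
  assumes [measurable]: "\<And>k. F k \<in> borel_measurable \<mu>" "G \<in> borel_measurable \<mu>"
    and lim: "AE z in \<mu>. (\<lambda>k. F k z) \<longlonglongrightarrow> G z"
    and B: "\<And>k. \<N> (F k) \<le> B"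
  shows "\<N> G \<le> B"
  unfolding extended_norm_def
proof (rule SUP_least, safe, rule ennreal_le_epsilon)
  fix s :: "complex \<Rightarrow> complex" and e :: real
  assume s: "simple_function \<mu> s" and le: "AE z in \<mu>. norm (s z) \<le> norm (G z)" and e: "0 < e"
  have sL: "s \<in> Linf_circle" by (rule simple_function_Linf_circle[OF s])
  note [measurable] = Linf_circle_measurable[OF sL]
  obtain C where C: "0 \<le> C" "\<And>z. z \<in> space \<mu> \<Longrightarrow> norm (s z) \<le> C"
    using simple_function_bounded[OF s] by blast
  have "0 < e / 2 / (C + 1)" using e C by simp
  then obtain d where d: "0 < d" "\<And>E. E \<in> sets \<mu> \<Longrightarrow> measure \<mu> E < d \<Longrightarrow> \<alpha> (indicator E) < e / 2 / (C + 1)"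
    by (rule alpha_indicator_small) blast
  \<comment> \<open>The part of \<open>s\<close> off \<open>A k\<close> is below |F k| + e/2. The
    part on \<open>A k\<close> is at most \<open>C\<close> times an indicator whose norm tends to 0
    with the measure of \<open>A k\<close>.\<close>
  define A where "A k = {z \<in> space \<mu>. norm (F k z) + e / 2 < norm (s z)}" for k
  have A [measurable]: "A k \<in> sets \<mu>" for k unfolding A_def by measurable
  have "(\<lambda>k. measure \<mu> (A k)) \<longlonglongrightarrow> 0"
  proof (rule measure_eventually_notin_tendsto_0[OF A])
    show "AE z in \<mu>. \<forall>\<^sub>F k in sequentially. z \<notin> A k"
      using lim le
    proof eventually_elim
      case (elim z)
      then have "(\<lambda>k. norm (F k z) + e / 2) \<longlonglongrightarrow> norm (G z) + e / 2" by (intro tendsto_intros)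
      then have "\<forall>\<^sub>F k in sequentially. norm (s z) < norm (F k z) + e / 2"
        by (rule order_tendstoD) (use elim e in simp)
      then show ?case by eventually_elim (auto simp: A_def)
    qed
  qed
  then have "\<forall>\<^sub>F k in sequentially. measure \<mu> (A k) < d" by (rule order_tendstoD) (rule d)
  then obtain k where k: "measure \<mu> (A k) < d" by (auto simp: eventually_sequentially)
  let ?g = "\<lambda>z. s z * indicator (space \<mu> - A k) z" and ?b = "\<lambda>z. s z * indicator (A k) z"
  have L: "?g \<in> Linf_circle" "?b \<in> Linf_circle"
    by (intro Linf_circle_mult sL Linf_circle_indicator; measurable)+
  have "\<alpha> s \<le> \<alpha> (\<lambda>z. ?g z + ?b z)"
    by (rule alpha_mono[OF sL Linf_circle_add[OF L]], rule AE_I2) (auto simp: indicator_def)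
  also have "\<dots> \<le> \<alpha> ?g + \<alpha> ?b" by (rule triangle[OF L])
  also have "\<alpha> ?b \<le> \<alpha> (\<lambda>z. of_real C * indicator (A k) z)"
    by (intro alpha_mono L Linf_circle_cmult Linf_circle_indicator A AE_I2)
       (use C in \<open>auto simp: indicator_def norm_mult\<close>)
  also have "\<alpha> (\<lambda>z. of_real C * indicator (A k) z) = C * \<alpha> (indicator (A k))"
    using scale[OF Linf_circle_indicator[OF A], of "of_real C"] C(1) by simp
  also have "C * \<alpha> (indicator (A k)) \<le> (C + 1) * (e / 2 / (C + 1))"
    using d(2)[OF A k] nonneg[OF Linf_circle_indicator[OF A]] C(1) by (intro mult_mono) auto
  also have "\<dots> = e / 2"
      using C(1) by (subst times_divide_eq_right, subst nonzero_mult_div_cancel_left) auto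
  finally have 1: "\<alpha> s \<le> \<alpha> ?g + e / 2" by simp
  have "ennreal (\<alpha> ?g) \<le> \<N> (\<lambda>z. of_real (norm (F k z)) + of_real (e / 2))"
  proof (rule alpha_le_extended_norm[OF L(1)], rule AE_I2)
    fix z assume z: "z \<in> space \<mu>"
    have "norm (complex_of_real (norm (F k z)) + of_real (e / 2)) = norm (F k z) + e / 2"
      unfolding of_real_add[symmetric] norm_of_real using e by simp
    then show "norm (?g z) \<le> norm (complex_of_real (norm (F k z)) + of_real (e / 2))"
      using z e by (auto simp: A_def indicator_def)
  qed
  also have "\<dots> \<le> \<N> (\<lambda>z. of_real (norm (F k z))) + \<N> (\<lambda>z. of_real (e / 2))"
    by (rule extended_norm_triangle) measurable
  also have "\<N> (\<lambda>z. of_real (norm (F k z))) = \<N> (F k)"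
    by (rule extended_norm_cong) auto
  also have "\<N> (\<lambda>z. of_real (e / 2)) = ennreal (e / 2)"
    using extended_norm_Linf[OF Linf_circle_const] e by (simp add: alpha_const norm_divide)
  finally have 2: "ennreal (\<alpha> ?g) \<le> B + ennreal (e / 2)"
    using add_right_mono[OF B[of k]] by (rule order.trans)
  have "ennreal (\<alpha> s) \<le> ennreal (\<alpha> ?g) + ennreal (e / 2)"
    using 1 nonneg[OF L(1)] e by (simp add: ennreal_plus[symmetric] ennreal_leI del: ennreal_plus)
  also have "\<dots> \<le> (B + ennreal (e / 2)) + ennreal (e / 2)" using 2 by (rule add_right_mono)
  also have "\<dots> = B + ennreal e" using e by (simp add: add.assoc ennreal_plus[symmetric] del: ennreal_plus)
  finally show "ennreal (\<alpha> s) \<le> B + ennreal e" .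
qed

text \<open>Dominated convergence in the norm \<alpha>: off a set of small measure the functions are
  uniformly small, and on it they are at most a constant times an indicator of small norm.\<close>

lemma alpha_dominated_tendsto_0:
  assumes [measurable]: "\<And>k. g k \<in> borel_measurable \<mu>"
    and C: "\<And>k. AE z in \<mu>. norm (g k z) \<le> C"
    and lim: "AE z in \<mu>. (\<lambda>k. g k z) \<longlonglongrightarrow> 0"
    and e: "0 < e"
  shows "\<forall>\<^sub>F k in sequentially. \<alpha> (g k) < e"
proof -
  define D where "D = max 0 C"
  have D: "0 \<le> D" "AE z in \<mu>. norm (g k z) \<le> D" for k
    using C[of k] by (auto simp: D_def elim!: eventually_mono)
  have "0 < e / 2 / (D + 1)" using e D by simp
  then obtain d where d: "0 < d" "\<And>E. E \<in> sets \<mu> \<Longrightarrow> measure \<mu> E < d \<Longrightarrow> \<alpha> (indicator E) < e / 2 / (D + 1)"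
    by (rule alpha_indicator_small) blast
  define A where "A k = {z \<in> space \<mu>. e / 4 < norm (g k z)}" for k
  have A [measurable]: "A k \<in> sets \<mu>" for k unfolding A_def by measurable
  have "(\<lambda>k. measure \<mu> (A k)) \<longlonglongrightarrow> 0"
  proof (rule measure_eventually_notin_tendsto_0[OF A])
    show "AE z in \<mu>. \<forall>\<^sub>F k in sequentially. z \<notin> A k"
      using lim
    proof eventually_elim
      case (elim z)
      then have "(\<lambda>k. norm (g k z)) \<longlonglongrightarrow> 0" by (rule tendsto_norm_zero)
      then have "\<forall>\<^sub>F k in sequentially. norm (g k z) < e / 4"
        by (rule order_tendstoD) (use e in simp)
      then show ?case by eventually_elim (auto simp: A_def)
    qed
  qed
  then have "\<forall>\<^sub>F k in sequentially. measure \<mu> (A k) < d" by (rule order_tendstoD) (rule d)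
  then show ?thesis
  proof eventually_elim
    case (elim k)
    have gL: "g k \<in> Linf_circle" by (rule Linf_circleI[OF _ D(2)]) measurable
    have L: "(\<lambda>z. of_real (e / 4)) \<in> Linf_circle" "(\<lambda>z. of_real D * indicator (A k) z) \<in> Linf_circle"
      by (intro Linf_circle_const Linf_circle_cmult Linf_circle_indicator A)+
    have "\<alpha> (g k) \<le> \<alpha> (\<lambda>z. of_real (e / 4) + of_real D * indicator (A k) z)"
    proof (rule alpha_mono[OF gL Linf_circle_add[OF L]])
      show "AE z in \<mu>. norm (g k z) \<le> norm (complex_of_real (e / 4) + of_real D * indicator (A k) z)"
        using D(2)[of k] AE_space
      proof eventually_elim
        case (elim z)
        have "norm (complex_of_real (e / 4) + of_real D * indicator (A k) z) = norm (complex_of_real (e / 4 + D * indicator (A k) z))"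
          by (simp add: indicator_def)
        also have "\<dots> = e / 4 + D * indicator (A k) z"
          unfolding norm_of_real using e D(1) by (simp add: indicator_def)
        finally show ?case using elim e by (auto simp: A_def indicator_def)
      qed
    qed
    also have "\<dots> \<le> \<alpha> (\<lambda>z. of_real (e / 4)) + \<alpha> (\<lambda>z. of_real D * indicator (A k) z)" by (rule triangle[OF L])
    also have "\<dots> = e / 4 + D * \<alpha> (indicator (A k))"
      using scale[OF Linf_circle_indicator[OF A], of "of_real D"] D(1) e by (simp add: alpha_const norm_divide)
    also have "D * \<alpha> (indicator (A k)) \<le> (D + 1) * (e / 2 / (D + 1))"
      using d(2)[OF A elim] nonneg[OF Linf_circle_indicator[OF A]] D(1) by (intro mult_mono) auto
    also have "\<dots> = e / 2"
      using D(1) by (subst times_divide_eq_right, subst nonzero_mult_div_cancel_left) auto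
    finally show ?case using e by simp
  qed
qed

end

section \<open>Multiplication on the circle\<close>

lemma ennreal_mult_less_ennreal:
  assumes "x < ennreal (e / D)" "0 < D"
  shows "ennreal D * x < ennreal e"
proof -
  obtain r where r: "x = ennreal r" "0 \<le> r" using assms(1) by (cases x) (auto simp: top.extremum_strict)
  with assms have "r < e / D" by (simp add: ennreal_less_iff)
  then show ?thesis using assms r by (simp add: ennreal_mult[symmetric] ennreal_less_iff field_simps)
qed

context continuous_rotationally_symmetric_norm
begin

lemma script_L_alpha_measurable: "f \<in> script_L_alpha \<alpha> \<Longrightarrow> f \<in> borel_measurable \<mu>"
  by (simp add: script_L_alpha_def)

lemma Linf_subset_script_L_alpha: "Linf_circle \<subseteq> script_L_alpha \<alpha>"
  by (auto simp: script_L_alpha_def Linf_circle_measurable extended_norm_Linf)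

lemma script_L_alpha_Linf_mult:
  assumes "g \<in> Linf_circle" "f \<in> script_L_alpha \<alpha>"
  shows "(\<lambda>z. g z * f z) \<in> script_L_alpha \<alpha>"
proof -
  obtain C where C: "0 \<le> C" "AE z in \<mu>. norm (g z) \<le> C" using assms(1) by (rule Linf_circleE)
  have "\<N> (\<lambda>z. g z * f z) \<le> ennreal C * \<N> f"
    by (rule extended_norm_mult_le[OF C(2,1)])
  also have "\<dots> < \<infinity>" using assms(2) by (auto simp: script_L_alpha_def ennreal_mult_less_top)
  finally show ?thesis
    using assms by (auto simp: script_L_alpha_def dest: Linf_circle_measurable)
qed

lemma Linf_subset_L_alpha: "Linf_circle \<subseteq> L_alpha \<alpha>"
proof
  fix f assume f: "f \<in> Linf_circle"
  have "\<N> (\<lambda>z. f z - f z) = 0"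
    using extended_norm_Linf[OF Linf_circle_const, of 0] by (simp add: alpha_const)
  with f show "f \<in> L_alpha \<alpha>"
    unfolding L_alpha_def alpha_closure_def
    using Linf_subset_script_L_alpha by (auto intro!: bexI[of _ f])
qed

lemma Linf_mult_L_alpha:
  assumes \<psi>: "\<psi> \<in> Linf_circle" and f: "f \<in> L_alpha \<alpha>"
  shows "mult_op \<psi> f \<in> L_alpha \<alpha>"
  unfolding L_alpha_def alpha_closure_def
proof safe
  show "mult_op \<psi> f \<in> script_L_alpha \<alpha>"
    unfolding mult_op_def using \<psi> f by (intro script_L_alpha_Linf_mult) (auto simp: L_alpha_def alpha_closure_def)
next
  fix e :: real assume e: "0 < e"
  obtain C where C: "0 \<le> C" "AE z in \<mu>. norm (\<psi> z) \<le> C" using \<psi> by (rule Linf_circleE)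
  obtain g where g: "g \<in> Linf_circle" "\<N> (\<lambda>z. f z - g z) < ennreal (e / (C + 1))"
    using f e C(1) by (auto simp: L_alpha_def alpha_closure_def dest!: spec[of _ "e / (C + 1)"])
  have "\<N> (\<lambda>z. mult_op \<psi> f z - \<psi> z * g z) = \<N> (\<lambda>z. \<psi> z * (f z - g z))"
    by (simp add: mult_op_def right_diff_distrib)
  also have "\<dots> \<le> ennreal (C + 1) * \<N> (\<lambda>z. f z - g z)"
    using C by (intro extended_norm_mult_le) (auto elim!: eventually_mono)
  also have "\<dots> < ennreal e" using g(2) C(1) by (intro ennreal_mult_less_ennreal) auto
  finally show "\<exists>g\<in>Linf_circle. \<N> (\<lambda>z. mult_op \<psi> f z - g z) < ennreal e"
    by (intro bexI[OF _ Linf_circle_mult[OF \<psi> g(1)]])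
qed

text \<open>
  If \<open>\<psi>\<close> is unbounded, the sets \<open>E n = {\<bar>\<psi>\<bar> \<ge> 4^n}\<close> are not null, and
  \<open>f = (\<Sum>n. 2^(-n) \<chi>\<^bsub>E n\<^esub> / \<alpha> \<chi>\<^bsub>E n\<^esub>)\<close> is multiplied out of the space.
\<close>

lemma mult_L_alpha_imp_Linf:
  assumes [measurable]: "\<psi> \<in> borel_measurable \<mu>"
    and sub: "mult_op \<psi> ` L_alpha \<alpha> \<subseteq> L_alpha \<alpha>"
  shows "\<psi> \<in> Linf_circle"
proof (rule ccontr)
  assume notL: "\<psi> \<notin> Linf_circle"
  define E where "E n = {z \<in> space \<mu>. 4 ^ n \<le> norm (\<psi> z)}" for n :: nat
  have E [measurable]: "E n \<in> sets \<mu>" for n unfolding E_def by measurable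
  have E0: "emeasure \<mu> (E n) \<noteq> 0" for n
  proof
    assume "emeasure \<mu> (E n) = 0"
    then have "AE z in \<mu>. z \<notin> E n"
      by (simp add: AE_circle_measure_notin E)
    then have "AE z in \<mu>. norm (\<psi> z) \<le> 4 ^ n"
      using AE_space by eventually_elim (auto simp: E_def)
    with notL show False by (auto simp: Linf_circle_iff)
  qed
  define a where "a n = \<alpha> (indicator (E n))" for n
  have a: "0 < a n" for n unfolding a_def by (rule alpha_indicator_pos[OF E E0])
  \<comment> \<open>With this normalisation the n-th term of the series has norm exactly
    2^(-n).\<close>
  define c where "c n = (1 / 2) ^ n / a n" for n
  have c: "0 < c n" for n using a by (simp add: c_def)
  define g where "g n z = complex_of_real (\<Sum>k<n. c k * indicator (E k) z)" for n z
  define f where "f z = complex_of_real (\<Sum>k. c k * indicator (E k) z)" for z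
  have ind: "(\<lambda>z. of_real (c k * indicator (E k) z)) = (\<lambda>z. of_real (c k) * (indicator (E k) z :: complex))" for k
    by (auto simp: indicator_def)
  have tL: "(\<lambda>z. of_real (c k * indicator (E k) z)) \<in> Linf_circle" for k
    unfolding ind by (intro Linf_circle_cmult Linf_circle_indicator E)
  have at: "\<alpha> (\<lambda>z. of_real (c k * indicator (E k) z)) = (1 / 2) ^ k" for k
    unfolding ind using scale[OF Linf_circle_indicator[OF E], of "of_real (c k)" k] c[of k] a[of k]
    by (simp add: c_def a_def[symmetric] norm_divide norm_power)
  have gL: "g n \<in> Linf_circle" for n
    unfolding g_def of_real_sum by (intro Linf_circle_sum tL)
  note [measurable] = Linf_circle_measurable[OF gL]
  \<comment> \<open>Since \<psi> has finite values, each point lies in only finitely many of the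
    sets \<open>E k\<close>; the series is a finite sum at every point.\<close>
  have summ: "summable (\<lambda>k. c k * indicator (E k) z)" for z
  proof -
    obtain N :: nat where N: "norm (\<psi> z) < 4 ^ N"
      using real_arch_pow[of 4 "norm (\<psi> z)"] by auto
    have "c k * indicator (E k) z = 0" if "k \<notin> {..<N}" for k
    proof -
      have "(4::real) ^ N \<le> 4 ^ k" using that by (intro power_increasing) auto
      then have "norm (\<psi> z) < 4 ^ k" using N by linarith
      then show ?thesis by (simp add: E_def indicator_def)
    qed
    then show ?thesis by (intro summable_finite[of "{..<N}"]) auto
  qed
  have lim: "(\<lambda>n. g n z) \<longlonglongrightarrow> f z" for z
    unfolding g_def f_def by (intro tendsto_of_real summable_LIMSEQ summ)
  have fm [measurable]: "f \<in> borel_measurable \<mu>"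
    by (rule borel_measurable_LIMSEQ_metric[of g]) (auto simp: lim)
  \<comment> \<open>The geometric bound holds for the finite differences g (k + n) - g n, and the
    Fatou property carries it over to the pointwise limit.\<close>
  have bound: "\<N> (\<lambda>z. f z - g n z) \<le> ennreal (2 * (1 / 2) ^ n)" for n
  proof (rule extended_norm_Fatou[where F = "\<lambda>k z. g (k + n) z - g n z"])
    show "AE z in \<mu>. (\<lambda>k. g (k + n) z - g n z) \<longlonglongrightarrow> f z - g n z"
      by (intro AE_I2 tendsto_intros LIMSEQ_ignore_initial_segment lim)
    fix k
    have *: "(\<lambda>z. g (k + n) z - g n z) \<in> Linf_circle" for k by (intro Linf_circle_diff gL)
    have "\<alpha> (\<lambda>z. g (k + n) z - g n z) \<le> (\<Sum>j<k. (1 / 2) ^ (j + n))"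
    proof (induction k)
      case 0
      show ?case by (simp add: alpha_const)
    next
      case (Suc k)
      have "\<alpha> (\<lambda>z. g (Suc k + n) z - g n z)
          = \<alpha> (\<lambda>z. (g (k + n) z - g n z) + of_real (c (k + n) * indicator (E (k + n)) z))"
        by (simp add: g_def algebra_simps)
      also have "\<dots> \<le> \<alpha> (\<lambda>z. g (k + n) z - g n z) + (1 / 2) ^ (k + n)"
        using triangle[OF * tL, of k "k + n"] by (simp only: at)
      finally show ?case using Suc by simp
    qed
    also have "\<dots> = (\<Sum>j<k. (1 / 2) ^ j) * (1 / 2) ^ n" by (simp add: power_add sum_distrib_right)
    also have "\<dots> \<le> 2 * (1 / 2) ^ n"
      by (intro mult_right_mono) (auto simp: geometric_sum)
    finally show "\<N> (\<lambda>z. g (k + n) z - g n z) \<le> ennreal (2 * (1 / 2) ^ n)"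
      unfolding extended_norm_Linf[OF *] by (rule ennreal_leI)
  qed measurable
  have "f \<in> L_alpha \<alpha>"
    unfolding L_alpha_def alpha_closure_def script_L_alpha_def
  proof safe
    have "\<N> f \<le> ennreal 2" using bound[of 0] by (simp add: g_def)
    then show "\<N> f < \<infinity>" using le_less_trans by fastforce
  next
    fix e :: real assume "0 < e"
    then obtain n where n: "(1 / 2) ^ n < e / 2" using real_arch_pow_inv[of "e / 2" "1 / 2"] by auto
    have "\<N> (\<lambda>z. f z - g n z) < ennreal e"
      using bound[of n] n \<open>0 < e\<close> by (elim le_less_trans) (auto intro!: ennreal_lessI)
    then show "\<exists>g\<in>Linf_circle. \<N> (\<lambda>z. f z - g z) < ennreal e" using gL by blast
  qed measurable
  with sub have "mult_op \<psi> f \<in> L_alpha \<alpha>" by blast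
  then have "\<N> (mult_op \<psi> f) < \<infinity>"
    by (auto simp: L_alpha_def alpha_closure_def script_L_alpha_def)
  then obtain B where B: "0 \<le> B" "\<N> (mult_op \<psi> f) = ennreal B"
    by (cases "\<N> (mult_op \<psi> f)") auto
  obtain n :: nat where n: "B < 2 ^ n" using real_arch_pow[of 2 B] by auto
  have term_le: "x n \<le> suminf x" if "summable x" "\<And>k. 0 \<le> x k" for x :: "nat \<Rightarrow> real"
    using sum_le_suminf[OF that(1), of "{n}"] that(2) by simp
  \<comment> \<open>All terms are nonnegative, so the n-th term alone bounds the product from below.
    On \<open>E n\<close> the multiplier is at least 4^n, and 4^n times the norm 2^(-n) of this term
    is 2^n.\<close>
  have "ennreal (\<alpha> (\<lambda>z. 4 ^ n * of_real (c n * indicator (E n) z))) \<le> \<N> (mult_op \<psi> f)"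
  proof (rule alpha_le_extended_norm[OF Linf_circle_cmult[OF tL]], rule AE_I2)
    fix z
    have "c n * indicator (E n) z \<le> (\<Sum>k. c k * indicator (E k) z)"
      using c by (intro term_le summ) (auto simp: less_imp_le)
    moreover have "0 \<le> c n * indicator (E n) z" using c[of n] by (simp add: indicator_def)
    ultimately have 1: "\<bar>c n * indicator (E n) z\<bar> \<le> \<bar>\<Sum>k. c k * indicator (E k) z\<bar>" by linarith
    show "norm (4 ^ n * complex_of_real (c n * indicator (E n) z)) \<le> norm (mult_op \<psi> f z)"
      unfolding mult_op_def f_def norm_mult norm_of_real norm_power
    proof (cases "z \<in> E n")
      case True
      then show "norm (4::complex) ^ n * \<bar>c n * indicator (E n) z\<bar> \<le> norm (\<psi> z) * \<bar>\<Sum>k. c k * indicator (E k) z\<bar>"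
        using 1 by (intro mult_mono) (auto simp: E_def)
    qed auto
  qed
  moreover have "\<alpha> (\<lambda>z. 4 ^ n * of_real (c n * indicator (E n) z)) = 2 ^ n"
    using scale[OF tL, of "4 ^ n" n] at[of n] by (simp add: norm_power power_mult_distrib[symmetric])
  ultimately show False using B n by simp
qed

text \<open>The lower bound comes from testing the operator on the normalised indicator of the set
  where |\<psi>| exceeds a level below its essential supremum.\<close>

lemma Linf_norm_eq_operator_norm:
  assumes \<psi>: "\<psi> \<in> Linf_circle"
  shows "Linf_norm \<psi> = operator_norm (\<N>) (L_alpha \<alpha>) (mult_op \<psi>)"
proof (rule antisym)
  note [measurable] = Linf_circle_measurable[OF \<psi>]
  show "operator_norm (\<N>) (L_alpha \<alpha>) (mult_op \<psi>) \<le> Linf_norm \<psi>"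
    unfolding operator_norm_def
  proof (rule SUP_least, safe)
    fix f assume f: "\<N> f \<le> 1"
    obtain C where C: "0 \<le> C" "Linf_norm \<psi> = ennreal C"
      using \<psi> by (cases "Linf_norm \<psi>") (auto simp: Linf_circle_def)
    have "AE z in \<mu>. ennreal (norm (\<psi> z)) \<le> ennreal C"
      using esssup_AE[of "\<lambda>z. ennreal (norm (\<psi> z))" \<mu>] by (simp add: Linf_norm_def[symmetric] C)
    then have "AE z in \<mu>. norm (\<psi> z) \<le> C" using C(1) by simp
    from extended_norm_mult_le[OF this C(1)]
    have "\<N> (mult_op \<psi> f) \<le> ennreal C * \<N> f"
      by (simp add: mult_op_def)
    also have "\<dots> \<le> ennreal C * 1" using f by (rule mult_left_mono) auto
    finally show "\<N> (mult_op \<psi> f) \<le> Linf_norm \<psi>" by (simp add: C)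
  qed
  show "Linf_norm \<psi> \<le> operator_norm (\<N>) (L_alpha \<alpha>) (mult_op \<psi>)" (is "_ \<le> ?M")
  proof (rule ccontr)
    assume "\<not> Linf_norm \<psi> \<le> ?M"
    then obtain x where x: "?M < x" "x < Linf_norm \<psi>" by (auto simp: not_le dest: dense)
    then obtain c where c: "0 \<le> c" "x = ennreal c" by (cases x) auto
    define E where "E = {z \<in> space \<mu>. c < norm (\<psi> z)}"
    have E: "E \<in> sets \<mu>" unfolding E_def by measurable
    have "emeasure \<mu> E \<noteq> 0"
    proof
      assume "emeasure \<mu> E = 0"
      then have "AE z in \<mu>. z \<notin> E"
        by (simp add: AE_circle_measure_notin E)
      then have "AE z in \<mu>. ennreal (norm (\<psi> z)) \<le> ennreal c"
        using AE_space by eventually_elim (auto simp: E_def intro: ennreal_leI)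
      then have "Linf_norm \<psi> \<le> ennreal c" unfolding Linf_norm_def by (intro esssup_I) measurable
      with x c show False by simp
    qed
    then have pos: "0 < \<alpha> (indicator E)" by (rule alpha_indicator_pos[OF E])
    define f where "f = (\<lambda>z. of_real (1 / \<alpha> (indicator E)) * (indicator E z :: complex))"
    have fL: "f \<in> Linf_circle" unfolding f_def by (intro Linf_circle_cmult Linf_circle_indicator E)
    have "\<alpha> f = 1"
      unfolding f_def using scale[OF Linf_circle_indicator[OF E], of "of_real (1 / \<alpha> (indicator E))"] pos
      by (simp add: norm_divide)
    then have Nf: "\<N> f = 1" by (simp add: extended_norm_Linf[OF fL])
    have "x = \<N> (\<lambda>z. of_real c * f z)"
      unfolding extended_norm_scale Nf using c by simp
    also have "\<dots> \<le> \<N> (mult_op \<psi> f)"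
    proof (rule extended_norm_mono, rule AE_I2)
      fix z
      show "norm (of_real c * f z) \<le> norm (mult_op \<psi> f z)"
      proof (cases "z \<in> E")
        case True
        then show ?thesis
          unfolding mult_op_def norm_mult using c(1) by (intro mult_right_mono) (auto simp: E_def)
      qed (simp add: mult_op_def f_def)
    qed
    also have "\<dots> \<le> ?M"
      unfolding operator_norm_def using Nf fL Linf_subset_L_alpha by (intro SUP_upper) auto
    finally show False using x by simp
  qed
qed

end

section \<open>Radial limits of bounded functions\<close>

lemma Cauchy_at_left_imp_tendsto:
  fixes f :: "real \<Rightarrow> complex"
  assumes "\<And>e. 0 < e \<Longrightarrow> \<exists>d<1. \<forall>r\<in>{d<..<1}. \<forall>s\<in>{d<..<1}. dist (f r) (f s) < e"
  shows "\<exists>l. (f \<longlongrightarrow> l) (at_left 1)"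
proof -
  define x where "x n = 1 - 1 / (real n + 2)" for n
  have x: "x n < 1" for n by (simp add: x_def)
  have lx: "x \<longlonglongrightarrow> 1" unfolding x_def by real_asymp
  have ev: "\<forall>\<^sub>F n in sequentially. x n \<in> {d<..<1}" if "d < 1" for d
    using order_tendstoD(1)[OF lx that] by eventually_elim (auto simp: x)
  have "Cauchy (\<lambda>n. f (x n))"
  proof (rule metric_CauchyI)
    fix e :: real assume "0 < e"
    then obtain d where d: "d < 1" "\<And>r s. r \<in> {d<..<1} \<Longrightarrow> s \<in> {d<..<1} \<Longrightarrow> dist (f r) (f s) < e"
      using assms by blast
    obtain N where N: "\<And>n. N \<le> n \<Longrightarrow> x n \<in> {d<..<1}"
      using ev[OF d(1)] unfolding eventually_sequentially by blast
    then show "\<exists>M. \<forall>m\<ge>M. \<forall>n\<ge>M. dist (f (x m)) (f (x n)) < e"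
      by (intro exI[of _ N] allI impI d(2)) auto
  qed
  then obtain l where l: "(\<lambda>n. f (x n)) \<longlonglongrightarrow> l" by (auto simp: Cauchy_convergent_iff convergent_def)
  have "(f \<longlongrightarrow> l) (at_left 1)"
  proof (rule tendstoI)
    fix e :: real assume e: "0 < e"
    then obtain d where d: "d < 1" "\<And>r s. r \<in> {d<..<1} \<Longrightarrow> s \<in> {d<..<1} \<Longrightarrow> dist (f r) (f s) < e / 2"
      using assms[of "e / 2"] by auto
    have "\<forall>\<^sub>F n in sequentially. dist (f (x n)) l < e / 2" using l e by (intro tendstoD) auto
    with ev[OF d(1)] have "\<forall>\<^sub>F n in sequentially. x n \<in> {d<..<1} \<and> dist (f (x n)) l < e / 2"
      by eventually_elim auto
    then obtain n where n: "x n \<in> {d<..<1}" "dist (f (x n)) l < e / 2"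
      by (auto simp: eventually_sequentially)
    have "\<forall>\<^sub>F r in at_left 1. r \<in> {d<..<1}" using d(1) by (rule eventually_at_leftI[rotated]) auto
    then show "\<forall>\<^sub>F r in at_left 1. dist (f r) l < e"
    proof eventually_elim
      case (elim r)
      then show ?case using d(2)[OF elim n(1)] n(2) dist_triangle[of "f r" l "f (x n)"] by simp
    qed
  qed
  then show ?thesis by blast
qed

subsection \<open>A maximal inequality for positive kernels\<close>

text \<open>
  The \<open>T T\<^sup>*\<close> method: by hypothesis \<open>T T\<^sup>* \<le> C (T + T\<^sup>*)\<close>, so a bound \<open>A\<close> for \<open>\<parallel>T\<parallel>^2\<close>
  improves to \<open>2 C \<surd>A\<close>, and the least bound is at most \<open>(2 C)^2\<close>.  The constant \<open>B\<close> only
  serves to start with some finite bound.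
\<close>

lemma TT_star_bound:
  fixes k :: "'a \<Rightarrow> 'a \<Rightarrow> ennreal" and B C :: real
  assumes "prob_space M"
    and k: "(\<lambda>(x, y). k x y) \<in> borel_measurable (M \<Otimes>\<^sub>M M)"
    and B: "\<And>x y. x \<in> space M \<Longrightarrow> y \<in> space M \<Longrightarrow> k x y \<le> ennreal B"
    and C: "\<And>x y. x \<in> space M \<Longrightarrow> y \<in> space M \<Longrightarrow> (\<integral>\<^sup>+u. k x u * k y u \<partial>M) \<le> ennreal C * (k x y + k y x)"
    and nonneg: "0 \<le> B" "0 \<le> C"
    and v: "v \<in> borel_measurable M" "(\<integral>\<^sup>+x. (v x)^2 \<partial>M) < \<infinity>"
  shows "(\<integral>\<^sup>+x. (\<integral>\<^sup>+u. k x u * v u \<partial>M)^2 \<partial>M) \<le> ennreal ((2 * C)^2) * (\<integral>\<^sup>+x. (v x)^2 \<partial>M)"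
proof -
  interpret prob_space M by fact
  interpret pair_sigma_finite M M ..
  have km [measurable (raw)]: "(\<lambda>x. k (f x) (g x)) \<in> borel_measurable N"
    if "f \<in> N \<rightarrow>\<^sub>M M" "g \<in> N \<rightarrow>\<^sub>M M" for f g and N :: "'c measure"
    using measurable_compose[OF measurable_Pair[OF that] k] by simp
  have cm: "(\<integral>\<^sup>+u. c * (k x u * v u) \<partial>M) = c * (\<integral>\<^sup>+u. k x u * v u \<partial>M)"
      "(\<integral>\<^sup>+u. c * (k u x * v u) \<partial>M) = c * (\<integral>\<^sup>+u. k u x * v u \<partial>M)"
    if "x \<in> space M" and [measurable]: "v \<in> borel_measurable M" for x v c
    using that(1) by (intro nn_integral_cmult; measurable)+
  define T where "T v x = (\<integral>\<^sup>+u. k x u * v u \<partial>M)" for v x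
  have Tm [measurable]: "T v \<in> borel_measurable M" if [measurable]: "v \<in> borel_measurable M" for v
    unfolding T_def by measurable
  \<comment> \<open>The admissible bounds for the square of the L^2 operator norm of
    \<open>T\<close>.\<close>
  define P where "P A \<longleftrightarrow> 0 \<le> A \<and> (\<forall>v\<in>borel_measurable M. (\<integral>\<^sup>+x. (v x)^2 \<partial>M) < \<infinity> \<longrightarrow>
    (\<integral>\<^sup>+x. (T v x)^2 \<partial>M) \<le> ennreal A * (\<integral>\<^sup>+x. (v x)^2 \<partial>M))" for A
  have PB: "P (B^2)"
    unfolding P_def
  proof safe
    fix v :: "'a \<Rightarrow> ennreal" assume [measurable]: "v \<in> borel_measurable M"
    have "(\<integral>\<^sup>+x. v x * 1 \<partial>M)^2 \<le> (\<integral>\<^sup>+x. (v x)^2 \<partial>M) * (\<integral>\<^sup>+x. 1^2 \<partial>M)"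
      by (rule Cauchy_Schwarz_nn_integral) measurable
    then have CS: "(\<integral>\<^sup>+x. v x \<partial>M)^2 \<le> (\<integral>\<^sup>+x. (v x)^2 \<partial>M)" by (simp add: emeasure_space_1)
    have "T v x \<le> ennreal B * (\<integral>\<^sup>+x. v x \<partial>M)" if "x \<in> space M" for x
      unfolding T_def using that B
      by (subst nn_integral_cmult[symmetric]) (auto intro!: nn_integral_mono mult_right_mono)
    then have "(\<integral>\<^sup>+x. (T v x)^2 \<partial>M) \<le> (\<integral>\<^sup>+x. (ennreal B * (\<integral>\<^sup>+x. v x \<partial>M))^2 \<partial>M)"
      by (intro nn_integral_mono power_mono) auto
    also have "\<dots> = ennreal (B^2) * (\<integral>\<^sup>+x. v x \<partial>M)^2"
      using nonneg by (simp add: emeasure_space_1 power_mult_distrib ennreal_power)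
    also have "\<dots> \<le> ennreal (B^2) * (\<integral>\<^sup>+x. (v x)^2 \<partial>M)" using CS by (rule mult_left_mono) auto
    finally show "(\<integral>\<^sup>+x. (T v x)^2 \<partial>M) \<le> ennreal (B^2) * (\<integral>\<^sup>+x. (v x)^2 \<partial>M)" .
  qed auto
  have fin: "(\<integral>\<^sup>+x. (T v x)^2 \<partial>M) < \<infinity>"
    if "v \<in> borel_measurable M" "(\<integral>\<^sup>+x. (v x)^2 \<partial>M) < \<infinity>" for v
  proof -
    have "(\<integral>\<^sup>+x. (T v x)^2 \<partial>M) \<le> ennreal (B^2) * (\<integral>\<^sup>+x. (v x)^2 \<partial>M)"
      using PB that by (simp add: P_def)
    also have "\<dots> < \<infinity>" using that by (simp add: ennreal_mult_less_top)
    finally show ?thesis .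
  qed
  have improve: "P (2 * C * sqrt A)" if A: "P A" for A
    unfolding P_def
  proof safe
    have A0: "0 \<le> A" using A by (simp add: P_def)
    then show "0 \<le> 2 * C * sqrt A" using nonneg by simp
    fix v :: "'a \<Rightarrow> ennreal" assume [measurable]: "v \<in> borel_measurable M" and Y: "(\<integral>\<^sup>+x. (v x)^2 \<partial>M) < \<infinity>"
    \<comment> \<open>This is the adjoint of T applied to Tv, so |Tv|^2 = <v, w> and |w|^2 = <Tv, T
      w>. In the latter the kernel of T composed with its adjoint appears, which the hypothesis
      bounds by that of T plus its adjoint; both contribute \<open>S\<close> = <Tv, TTv>.\<close>
    define w where "w u = (\<integral>\<^sup>+x. k x u * T v x \<partial>M)" for u
    have [measurable]: "w \<in> borel_measurable M" unfolding w_def by measurable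
    define S where "S = (\<integral>\<^sup>+x. T v x * T (T v) x \<partial>M)"
    have X: "(\<integral>\<^sup>+x. (T v x)^2 \<partial>M) = (\<integral>\<^sup>+u. v u * w u \<partial>M)"
    proof -
      have "(\<integral>\<^sup>+x. (T v x)^2 \<partial>M) = (\<integral>\<^sup>+x. (\<integral>\<^sup>+u. T v x * (k x u * v u) \<partial>M) \<partial>M)"
        by (intro nn_integral_cong) (simp add: cm T_def[of v] power2_eq_square)
      also have "\<dots> = (\<integral>\<^sup>+u. (\<integral>\<^sup>+x. T v x * (k x u * v u) \<partial>M) \<partial>M)"
        by (rule Fubini'[symmetric]) measurable
      also have "\<dots> = (\<integral>\<^sup>+u. v u * w u \<partial>M)"
        unfolding w_def by (intro nn_integral_cong, subst cm(2)[symmetric]) (auto simp: mult_ac)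
      finally show ?thesis .
    qed
    have C2: "ennreal (2 * C) = ennreal C + ennreal C"
      using nonneg by (simp add: ennreal_plus[symmetric] del: ennreal_plus)
    have W: "(\<integral>\<^sup>+u. (w u)^2 \<partial>M) \<le> ennreal (2 * C) * S"
    proof -
      have "(\<integral>\<^sup>+u. (w u)^2 \<partial>M) = (\<integral>\<^sup>+u. (\<integral>\<^sup>+x. w u * (k x u * T v x) \<partial>M) \<partial>M)"
        by (intro nn_integral_cong) (simp add: cm w_def[of u for u] power2_eq_square)
      also have "\<dots> = (\<integral>\<^sup>+x. (\<integral>\<^sup>+u. w u * (k x u * T v x) \<partial>M) \<partial>M)"
        by (rule Fubini') measurable
      also have "\<dots> = (\<integral>\<^sup>+x. T v x * (\<integral>\<^sup>+u. k x u * w u \<partial>M) \<partial>M)"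
        by (intro nn_integral_cong, subst cm(1)[symmetric]) (auto simp: mult_ac)
      also have "\<dots> \<le> (\<integral>\<^sup>+x. T v x * (\<integral>\<^sup>+y. T v y * (ennreal C * (k x y + k y x)) \<partial>M) \<partial>M)"
      proof (rule nn_integral_mono, rule mult_left_mono)
        fix x assume [measurable]: "x \<in> space M"
        have "(\<integral>\<^sup>+u. k x u * w u \<partial>M) = (\<integral>\<^sup>+u. (\<integral>\<^sup>+y. k x u * (k y u * T v y) \<partial>M) \<partial>M)"
          unfolding w_def by (intro nn_integral_cong) (simp add: cm)
        also have "\<dots> = (\<integral>\<^sup>+y. (\<integral>\<^sup>+u. k x u * (k y u * T v y) \<partial>M) \<partial>M)"
          by (rule Fubini') measurable
        also have "\<dots> = (\<integral>\<^sup>+y. T v y * (\<integral>\<^sup>+u. k x u * k y u \<partial>M) \<partial>M)"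
          using \<open>x \<in> space M\<close>
          by (intro nn_integral_cong, subst nn_integral_cmult[symmetric]) (auto simp: mult_ac)
        also have "\<dots> \<le> (\<integral>\<^sup>+y. T v y * (ennreal C * (k x y + k y x)) \<partial>M)"
          using C \<open>x \<in> space M\<close> by (intro nn_integral_mono mult_left_mono) auto
        finally show "(\<integral>\<^sup>+u. k x u * w u \<partial>M) \<le> (\<integral>\<^sup>+y. T v y * (ennreal C * (k x y + k y x)) \<partial>M)" .
      qed auto
      also have "\<dots> = (\<integral>\<^sup>+x. ennreal C * (T v x * (\<integral>\<^sup>+y. k x y * T v y \<partial>M)) +
          ennreal C * (T v x * (\<integral>\<^sup>+y. k y x * T v y \<partial>M)) \<partial>M)"
      proof (rule nn_integral_cong)
        fix x assume [measurable]: "x \<in> space M"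
        have "(\<integral>\<^sup>+y. T v y * (ennreal C * (k x y + k y x)) \<partial>M)
            = (\<integral>\<^sup>+y. ennreal C * (k x y * T v y) + ennreal C * (k y x * T v y) \<partial>M)"
          by (intro nn_integral_cong) (simp add: algebra_simps)
        also have "\<dots> = ennreal C * (\<integral>\<^sup>+y. k x y * T v y \<partial>M) + ennreal C * (\<integral>\<^sup>+y. k y x * T v y \<partial>M)"
          using \<open>x \<in> space M\<close> by (subst nn_integral_add) (auto simp: cm)
        finally show "T v x * (\<integral>\<^sup>+y. T v y * (ennreal C * (k x y + k y x)) \<partial>M) =
          ennreal C * (T v x * (\<integral>\<^sup>+y. k x y * T v y \<partial>M)) +
          ennreal C * (T v x * (\<integral>\<^sup>+y. k y x * T v y \<partial>M))" by (simp add: algebra_simps)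
      qed
      also have "\<dots> = ennreal C * S + ennreal C * (\<integral>\<^sup>+x. T v x * (\<integral>\<^sup>+y. k y x * T v y \<partial>M) \<partial>M)"
        by (subst nn_integral_add) (auto simp: nn_integral_cmult S_def T_def[of "T v"])
      also have "(\<integral>\<^sup>+x. T v x * (\<integral>\<^sup>+y. k y x * T v y \<partial>M) \<partial>M) = (\<integral>\<^sup>+x. (\<integral>\<^sup>+y. T v x * (k y x * T v y) \<partial>M) \<partial>M)"
        by (intro nn_integral_cong) (simp add: cm)
      also have "\<dots> = (\<integral>\<^sup>+y. (\<integral>\<^sup>+x. T v x * (k y x * T v y) \<partial>M) \<partial>M)"
        by (rule Fubini') measurable
      also have "\<dots> = S"
        unfolding S_def T_def[of "T v"]
        by (intro nn_integral_cong, subst cm(1)[symmetric]) (auto simp: mult_ac)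
      finally show ?thesis using nonneg by (simp add: C2 distrib_right)
    qed
    have SX: "S^2 \<le> (\<integral>\<^sup>+x. (T v x)^2 \<partial>M) * (\<integral>\<^sup>+x. (T (T v) x)^2 \<partial>M)"
      unfolding S_def by (rule Cauchy_Schwarz_nn_integral) measurable
    also have "\<dots> \<le> (\<integral>\<^sup>+x. (T v x)^2 \<partial>M) * (ennreal A * (\<integral>\<^sup>+x. (T v x)^2 \<partial>M))"
      using A fin[OF _ Y] by (intro mult_left_mono) (auto simp: P_def)
    finally have SX: "S^2 \<le> (\<integral>\<^sup>+x. (T v x)^2 \<partial>M) * (ennreal A * (\<integral>\<^sup>+x. (T v x)^2 \<partial>M))" .
    obtain x where x: "(\<integral>\<^sup>+x. (T v x)^2 \<partial>M) = ennreal x" "0 \<le> x"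
      using fin[OF _ Y] by (cases "\<integral>\<^sup>+x. (T v x)^2 \<partial>M") auto
    obtain y where y: "(\<integral>\<^sup>+x. (v x)^2 \<partial>M) = ennreal y" "0 \<le> y"
      using Y by (cases "\<integral>\<^sup>+x. (v x)^2 \<partial>M") auto
    have "S \<noteq> top" using SX x A0 by (auto simp: ennreal_mult[symmetric] top_unique)
    then obtain s where s: "S = ennreal s" "0 \<le> s" by (cases S) auto
    have "s^2 \<le> A * x^2"
      using SX x s A0 by (simp add: ennreal_mult[symmetric] ennreal_power power2_eq_square mult_ac)
    then have "s^2 \<le> (sqrt A * x)^2" using A0 by (simp add: power_mult_distrib)
    then have sx: "s \<le> sqrt A * x" by (rule power2_le_imp_le) (use x(2) A0 in simp)
    have "(ennreal x)^2 \<le> ennreal y * (\<integral>\<^sup>+u. (w u)^2 \<partial>M)"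
      unfolding x(1)[symmetric] y(1)[symmetric] unfolding X by (rule Cauchy_Schwarz_nn_integral) measurable
    also have "\<dots> \<le> ennreal y * (ennreal (2 * C) * ennreal s)"
      using W s by (intro mult_left_mono) auto
    finally have "x^2 \<le> y * (2 * C * s)"
      using x(2) y(2) s(2) nonneg by (simp add: ennreal_mult[symmetric] ennreal_power)
    also have "\<dots> \<le> y * (2 * C * (sqrt A * x))"
      using sx y(2) nonneg by (intro mult_left_mono) auto
    \<comment> \<open>Cancelling \<open>x\<close> requires the L^2 norm of Tv to be finite
      beforehand; this is what the crude bound by B^2 is for.\<close>
    finally have "x * x \<le> (2 * C * sqrt A * y) * x" by (simp add: power2_eq_square mult_ac)
    then have "x \<le> 2 * C * sqrt A * y"
      using x(2) y(2) nonneg A0 by (cases "x = 0") (auto simp: mult_le_cancel_right)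
    then show "(\<integral>\<^sup>+x. (T v x)^2 \<partial>M) \<le> ennreal (2 * C * sqrt A) * (\<integral>\<^sup>+x. (v x)^2 \<partial>M)"
      unfolding x(1) y(1) using y(2) nonneg A0 by (simp add: ennreal_mult[symmetric])
  qed
  \<comment> \<open>The defining inequalities are linear in the bound, so the infimum is itself a
    bound. Applying the improvement to it gives A <= 2 C sqrt A.\<close>
  define A where "A = Inf {A. P A}"
  have bdd: "bdd_below {A. P A}" by (rule bdd_belowI[of _ 0]) (auto simp: P_def)
  have A0: "0 \<le> A" unfolding A_def
  proof (rule cInf_greatest)
    show "{A. P A} \<noteq> {}" using PB by blast
  qed (simp add: P_def)
  have "P A"
    unfolding P_def
  proof safe
    fix v :: "'a \<Rightarrow> ennreal" assume v: "v \<in> borel_measurable M" "(\<integral>\<^sup>+x. (v x)^2 \<partial>M) < \<infinity>"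
    obtain x where x: "(\<integral>\<^sup>+x. (T v x)^2 \<partial>M) = ennreal x" "0 \<le> x"
      using fin[OF v] by (cases "\<integral>\<^sup>+x. (T v x)^2 \<partial>M") auto
    obtain y where y: "(\<integral>\<^sup>+x. (v x)^2 \<partial>M) = ennreal y" "0 \<le> y"
      using v(2) by (cases "\<integral>\<^sup>+x. (v x)^2 \<partial>M") auto
    have le: "x \<le> a * y" if "P a" for a
      using that v x y by (auto simp: P_def ennreal_mult[symmetric])
    have "x \<le> A * y"
    proof (cases "y = 0")
      case True
      then show ?thesis using le[OF PB] by simp
    next
      case False
      have "x / y \<le> A"
        unfolding A_def
      proof (rule cInf_greatest)
        show "{A. P A} \<noteq> {}" using PB by blast
        fix a assume "a \<in> {A. P A}"
        then show "x / y \<le> a" using le[of a] False y(2) by (simp add: divide_le_eq)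
      qed
      then show ?thesis using False y(2) by (simp add: field_simps)
    qed
    then show "(\<integral>\<^sup>+x. (T v x)^2 \<partial>M) \<le> ennreal A * (\<integral>\<^sup>+x. (v x)^2 \<partial>M)"
      unfolding x(1) y(1) using A0 y(2) by (simp add: ennreal_mult[symmetric])
  qed (rule A0)
  from improve[OF this] have "A \<le> 2 * C * sqrt A" unfolding A_def by (intro cInf_lower bdd) simp
  then have sq: "sqrt A * sqrt A \<le> (2 * C) * sqrt A" using A0 by simp
  have "sqrt A \<le> 2 * C"
  proof (cases "A = 0")
    case False
    then have "0 < sqrt A" using A0 by simp
    with sq show ?thesis by (rule mult_right_le_imp_le)
  qed (use nonneg in simp)
  then have "A \<le> (2 * C)^2" using power_mono[of "sqrt A" "2 * C" 2] A0 by simp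
  have "(\<integral>\<^sup>+x. (T v x)^2 \<partial>M) \<le> ennreal A * (\<integral>\<^sup>+x. (v x)^2 \<partial>M)"
    using \<open>P A\<close> v by (simp add: P_def)
  also have "\<dots> \<le> ennreal ((2 * C)^2) * (\<integral>\<^sup>+x. (v x)^2 \<partial>M)"
    using \<open>A \<le> (2 * C)^2\<close> by (intro mult_right_mono ennreal_leI) auto
  finally show ?thesis by (simp add: T_def)
qed

subsection \<open>Fatou's theorem for bounded functions\<close>

definition Poisson :: "complex \<Rightarrow> complex \<Rightarrow> real" where
  "Poisson w z = (1 - (norm w)^2) / (norm (z - w))^2"

lemma Poisson_nonneg: "norm w \<le> 1 \<Longrightarrow> 0 \<le> Poisson w z"
  by (simp add: Poisson_def power_le_one)

lemma integrable_circle_measure_continuous: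
  fixes f :: "complex \<Rightarrow> 'b::{banach, second_countable_topology}"
  assumes "continuous_on (sphere 0 1) f"
  shows "integrable \<mu> f"
proof -
  have "bounded (f ` sphere 0 1)"
    by (intro compact_imp_bounded compact_continuous_image[OF assms compact_sphere])
  then obtain B where B: "\<And>z. z \<in> sphere 0 1 \<Longrightarrow> norm (f z) \<le> B"
    unfolding bounded_iff by blast
  show ?thesis
  proof (rule circle.integrable_const_bound)
    show "AE z in \<mu>. norm (f z) \<le> B"
      using B by (intro AE_I2) (simp add: space_circle_measure)
    have "f \<in> borel_measurable (restrict_space borel (sphere 0 1))"
      using assms by (rule borel_measurable_continuous_on_restrict)
    then show "f \<in> borel_measurable \<mu>"
      unfolding circle_measure_def by (intro measurable_completion) simp
  qed
qed

lemma Poisson_continuous: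
  assumes "norm w < 1" shows "continuous_on (sphere 0 1) (Poisson w)"
  unfolding Poisson_def using assms by (intro continuous_intros) auto

text \<open>For z on the circle z * cnj (z - w) = 1 - cnj w * z, so 1 / |z - w|^2 equals z / ((z -
  w) (1 - cnj w z)). The formula is therefore Cauchy's for \<open>G\<close>, which is g times a
  holomorphic factor with value 1 at w.\<close>

lemma Poisson_formula:
  assumes cont: "continuous_on (cball 0 1) g" and holo: "g holomorphic_on ball 0 1" and w: "norm w < 1"
  shows "(\<integral>z. g z * of_real (Poisson w z) \<partial>\<mu>) = g w"
proof -
  have ne: "1 - cnj w * z \<noteq> 0" if "norm z \<le> 1" for z
  proof
    assume "1 - cnj w * z = 0"
    then have "cnj w * z = 1" by simp
    then have "norm (cnj w * z) = 1" by (simp only: norm_one)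
    moreover have "norm (cnj w * z) \<le> norm w * 1" unfolding norm_mult using that by (intro mult_mono) auto
    ultimately show False using w by simp
  qed
  define G where "G z = g z * (1 - of_real ((norm w)^2)) / (1 - cnj w * z)" for z
  have "(\<integral>z. g z * of_real (Poisson w z) \<partial>\<mu>) = (\<integral>z. G z * z / (z - w) \<partial>\<mu>)"
  proof (rule Bochner_Integration.integral_cong)
    fix z assume "z \<in> space \<mu>"
    then have z: "norm z = 1" by (simp add: space_circle_measure)
    then have zz: "z * cnj z = 1" by (simp add: complex_norm_square[symmetric])
    then have "z \<noteq> 0" by auto
    have "z * cnj (z - w) = 1 - cnj w * z" using zz by (simp add: algebra_simps)
    then have "G z * z / (z - w) = g z * (1 - of_real ((norm w)^2)) / ((z - w) * cnj (z - w))"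
      unfolding G_def \<open>z * cnj (z - w) = 1 - cnj w * z\<close>[symmetric]
      using \<open>z \<noteq> 0\<close> by (simp add: mult.commute)
    then show "g z * of_real (Poisson w z) = G z * z / (z - w)"
      unfolding Poisson_def of_real_divide of_real_diff of_real_1 complex_norm_square[of "z - w"]
      by simp
  qed simp
  also have "\<dots> = G w"
  proof (rule Cauchy_integral_circle_measure[OF _ _ w])
    show "continuous_on (cball 0 1) G"
      unfolding G_def using ne by (intro continuous_intros cont) auto
    show "G holomorphic_on ball 0 1"
      unfolding G_def using ne by (intro holomorphic_intros holo) auto
  qed
  also have "\<dots> = g w"
  proof -
    have "1 - cnj w * w = 1 - of_real ((norm w)^2)" by (simp only: complex_norm_square mult.commute)
    then show ?thesis using ne[of w] w by (simp add: G_def)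
  qed
  finally show ?thesis .
qed

lemma norm_le_Poisson_integral:
  assumes "continuous_on (cball 0 1) g" "g holomorphic_on ball 0 1" "norm w < 1"
  shows "ennreal (norm (g w)) \<le> (\<integral>\<^sup>+z. ennreal (Poisson w z) * ennreal (norm (g z)) \<partial>\<mu>)"
proof -
  have "continuous_on (sphere 0 1) (\<lambda>z. g z * of_real (Poisson w z))"
    using assms by (intro continuous_intros Poisson_continuous continuous_on_subset[OF assms(1)]) auto
  then have "integrable \<mu> (\<lambda>z. g z * of_real (Poisson w z))"
    by (rule integrable_circle_measure_continuous)
  then have "ennreal (norm (\<integral>z. g z * of_real (Poisson w z) \<partial>\<mu>))
      \<le> (\<integral>\<^sup>+z. ennreal (norm (g z * of_real (Poisson w z))) \<partial>\<mu>)"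
    by (rule integral_norm_bound_ennreal)
  also have "\<dots> = (\<integral>\<^sup>+z. ennreal (Poisson w z) * ennreal (norm (g z)) \<partial>\<mu>)"
    using Poisson_nonneg[of w] assms(3)
    by (intro nn_integral_cong) (simp add: norm_mult ennreal_mult mult.commute)
  finally show ?thesis by (simp add: Poisson_formula[OF assms])
qed

text \<open>The Poisson kernel as the real part of (1 + x) / (1 - x). The case r = 1 gives its
  boundary values, and r < 1 its harmonic extension into the disk, which is again a Poisson kernel,
  of radius rs.\<close>

lemma Poisson_eq_Re:
  assumes "norm z = 1" "norm w = 1" "0 \<le> s" "s < 1" "0 \<le> r" "r \<le> 1"
  shows "Re ((1 + of_real s * cnj w * (of_real r * z)) / (1 - of_real s * cnj w * (of_real r * z)))
     = (1 - (r * s)^2) / (norm (1 - of_real (r * s) * (cnj w * z)))^2"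
proof -
  define x where "x = of_real (r * s) * (cnj w * z)"
  have nx: "norm x = r * s" using assms by (simp add: x_def norm_mult)
  have "Re ((1 + x) / (1 - x)) = Re ((1 + x) * cnj (1 - x)) / (norm (1 - x))^2"
    by (simp add: complex_div_cnj[of "1 + x"])
  also have "Re ((1 + x) * cnj (1 - x)) = 1 - (norm x)^2"
    unfolding cmod_power2[of x] by (simp add: power2_eq_square algebra_simps)
  finally have "Re ((1 + x) / (1 - x)) = (1 - (norm x)^2) / (norm (1 - x))^2" .
  moreover have "of_real s * cnj w * (of_real r * z) = x" by (simp add: x_def mult_ac)
  ultimately show ?thesis by (simp only: nx x_def[symmetric])
qed

text \<open>The kernel depends only on the radius and on the angle between the two points, so it is
  symmetric in \<open>z\<close> and \<open>w\<close>. The common expression is the one in which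
  \<open>Poisson_eq_Re\<close> and \<open>Poisson_quotient_bound\<close> are stated.\<close>

lemma Poisson_rotate:
  assumes "norm z = 1" "norm w = 1" "0 \<le> s"
  shows "Poisson (of_real s * w) z = (1 - s^2) / (norm (1 - of_real s * (cnj w * z)))^2"
    and "Poisson (of_real s * z) w = (1 - s^2) / (norm (1 - of_real s * (cnj w * z)))^2"
proof -
  have ww: "cnj w * w = 1" and zz: "cnj z * z = 1"
    using assms(1,2) by (simp_all add: complex_norm_square[symmetric] mult.commute)
  have "norm (z - of_real s * w) = norm (cnj z * (z - of_real s * w))"
    using assms by (simp add: norm_mult)
  also have "cnj z * (z - of_real s * w) = cnj (1 - of_real s * (cnj w * z))"
    using zz by (simp add: algebra_simps)
  finally have 1: "norm (z - of_real s * w) = norm (1 - of_real s * (cnj w * z))" by (simp only: complex_mod_cnj)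
  have "norm (w - of_real s * z) = norm (cnj w * (w - of_real s * z))"
    using assms by (simp add: norm_mult)
  also have "cnj w * (w - of_real s * z) = 1 - of_real s * (cnj w * z)"
    using ww by (simp add: algebra_simps)
  finally have 2: "norm (w - of_real s * z) = norm (1 - of_real s * (cnj w * z))" .
  show "Poisson (of_real s * w) z = (1 - s^2) / (norm (1 - of_real s * (cnj w * z)))^2"
    "Poisson (of_real s * z) w = (1 - s^2) / (norm (1 - of_real s * (cnj w * z)))^2"
    using assms by (simp_all add: Poisson_def 1 2 norm_mult)
qed

text \<open>The kernel of radius rs is comparable to that of the smaller radius r. The factor 16 is
  4 for the numerators times 4 for the denominators, the latter because |1 - r x| is at most 2 |1 -
  r s x|.\<close>

lemma Poisson_quotient_bound:
  fixes x :: complex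
  assumes "0 \<le> r" "r \<le> s" "s < 1" "norm x = 1"
  shows "(1 - (r * s)^2) / (norm (1 - of_real (r * s) * x))^2 \<le> 16 * ((1 - r^2) / (norm (1 - of_real r * x))^2)"
proof -
  let ?a = "norm (1 - of_real (r * s) * x)" and ?b = "norm (1 - of_real r * x)"
  have rs: "0 \<le> r * s" "r * s < 1" 
  proof -
    have "r * s \<le> 1 * s" using assms by (intro mult_right_mono) auto
    then show "0 \<le> r * s" "r * s < 1" using assms by auto
  qed
  have a1: "1 - r * s \<le> ?a"
    using norm_triangle_ineq2[of 1 "of_real (r * s) * x"] assms rs by (simp add: norm_mult)
  have b1: "1 - r \<le> ?b"
    using norm_triangle_ineq2[of 1 "of_real r * x"] assms by (simp add: norm_mult)
  then have b0: "0 < ?b" using assms by linarith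
  have "?b = norm ((1 - of_real (r * s) * x) - of_real (r * (1 - s)) * x)"
    by (simp add: algebra_simps)
  also have "\<dots> \<le> ?a + norm (of_real (r * (1 - s)) * x)" by (rule norm_triangle_ineq4)
  also have "norm (of_real (r * (1 - s)) * x) = r * (1 - s)"
    using assms unfolding norm_mult norm_of_real by simp
  also have "r * (1 - s) \<le> 1 - r * s" using assms by (simp add: algebra_simps)
  finally have ba: "?b \<le> 2 * ?a" using a1 by linarith
  have "1 - (r * s)^2 = (1 - r * s) * (1 + r * s)" by (simp add: power2_eq_square algebra_simps)
  also have "\<dots> \<le> (2 * (1 - r)) * 2"
  proof (rule mult_mono)
    have "r * (1 - s) \<le> 1 - s" using assms by (intro mult_left_le_one_le) auto
    then show "1 - r * s \<le> 2 * (1 - r)" using assms by (simp add: algebra_simps)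
  qed (use rs assms in auto)
  also have "\<dots> \<le> 4 * (1 - r^2)"
    using mult_left_mono[of r 1 r] assms by (simp add: power2_eq_square)
  finally have num: "1 - (r * s)^2 \<le> 4 * (1 - r^2)" .
  have r2: "0 \<le> 1 - r^2" using assms by (simp add: power_le_one)
  have "(1 - (r * s)^2) / ?a^2 \<le> 4 * (1 - r^2) / (?b / 2)^2"
    using num r2 b0 ba by (intro frac_le power_mono) auto
  also have "\<dots> = 16 * ((1 - r^2) / ?b^2)" by (simp add: power_divide)
  finally show ?thesis .
qed

text \<open>The integral on the left is exactly the kernel of radius rs, and this is controlled by
  the kernel of the smaller of the two radii, whichever it is. Both terms on the right are needed
  because the radii will depend on the points.\<close>

lemma Poisson_semigroup_bound:
  assumes z: "norm z = 1" and w: "norm w = 1" and r: "0 \<le> r" "r < 1" and s: "0 \<le> s" "s < 1"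
  shows "(\<integral>\<^sup>+u. ennreal (Poisson (of_real r * z) u) * ennreal (Poisson (of_real s * w) u) \<partial>\<mu>)
    \<le> ennreal 16 * (ennreal (Poisson (of_real r * z) w) + ennreal (Poisson (of_real s * w) z))"
proof -
  \<comment> \<open>The real part of this holomorphic function is the second kernel on the circle,
    so the Poisson formula for \<open>g\<close> at the point of radius \<open>r\<close> evaluates
    the integral.\<close>
  define g where "g u = (1 + of_real s * cnj w * u) / (1 - of_real s * cnj w * u)" for u
  have ne: "1 - of_real s * cnj w * u \<noteq> 0" if "norm u \<le> 1" for u
  proof
    assume "1 - of_real s * cnj w * u = 0"
    then have "of_real s * cnj w * u = 1" by simp
    then have "norm (of_real s * cnj w * u) = 1" by (simp only: norm_one)
    moreover have "norm (of_real s * cnj w * u) \<le> s * 1"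
      using that s w by (simp add: norm_mult mult_left_le)
    ultimately show False using s by simp
  qed
  have gc: "continuous_on (cball 0 1) g" unfolding g_def using ne by (intro continuous_intros) auto
  have gh: "g holomorphic_on ball 0 1" unfolding g_def using ne by (intro holomorphic_intros) auto
  have nr: "norm (of_real r * z) < 1" "norm (of_real s * w) < 1" using r s z w by (auto simp: norm_mult)
  have "continuous_on (sphere 0 1) (\<lambda>u. g u * of_real (Poisson (of_real r * z) u))"
    by (intro continuous_intros Poisson_continuous nr continuous_on_subset[OF gc]) auto
  then have int: "integrable \<mu> (\<lambda>u. g u * of_real (Poisson (of_real r * z) u))"
    by (rule integrable_circle_measure_continuous)
  have Re: "Re (g u * of_real (Poisson (of_real r * z) u))
      = Poisson (of_real r * z) u * Poisson (of_real s * w) u" if "u \<in> space \<mu>" for u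
  proof -
    have "Re (g u) = Poisson (of_real s * w) u"
      using that w s Poisson_eq_Re[of u w s 1] Poisson_rotate(1)[of u w s]
      by (simp add: g_def space_circle_measure)
    then show ?thesis by simp
  qed
  have "(\<integral>\<^sup>+u. ennreal (Poisson (of_real r * z) u) * ennreal (Poisson (of_real s * w) u) \<partial>\<mu>)
      = (\<integral>\<^sup>+u. ennreal (Re (g u * of_real (Poisson (of_real r * z) u))) \<partial>\<mu>)"
    using nr by (intro nn_integral_cong, subst Re) (simp_all add: Poisson_nonneg ennreal_mult)
  also have "\<dots> = ennreal (\<integral>u. Re (g u * of_real (Poisson (of_real r * z) u)) \<partial>\<mu>)"
    using int nr
    by (intro nn_integral_eq_integral AE_I2 integrable_Re) (simp_all add: Re Poisson_nonneg mult_nonneg_nonneg del: Re_complex_of_real times_complex.sel)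
  also have "(\<integral>u. Re (g u * of_real (Poisson (of_real r * z) u)) \<partial>\<mu>) = Re (g (of_real r * z))"
    using integral_Re[OF int] Poisson_formula[OF gc gh nr(1)] by simp
  also have "Re (g (of_real r * z)) = (1 - (r * s)^2) / (norm (1 - of_real (r * s) * (cnj w * z)))^2"
    unfolding g_def using z w r s by (intro Poisson_eq_Re) auto
  also have "\<dots> \<le> 16 * (Poisson (of_real r * z) w + Poisson (of_real s * w) z)"
  proof (cases "r \<le> s")
    case True
    have "(1 - (r * s)^2) / (norm (1 - of_real (r * s) * (cnj w * z)))^2
        \<le> 16 * ((1 - r^2) / (norm (1 - of_real r * (cnj w * z)))^2)"
      using True r s z w by (intro Poisson_quotient_bound) (auto simp: norm_mult)
    then show ?thesis
      using Poisson_rotate(2)[OF z w r(1)] Poisson_nonneg[of "of_real s * w" z] nr(2) by simp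
  next
    case False
    have "(1 - (s * r)^2) / (norm (1 - of_real (s * r) * (cnj w * z)))^2
        \<le> 16 * ((1 - s^2) / (norm (1 - of_real s * (cnj w * z)))^2)"
      using False r s z w by (intro Poisson_quotient_bound) (auto simp: norm_mult)
    then show ?thesis
      using Poisson_rotate(1)[OF z w s(1)] Poisson_nonneg[of "of_real r * z" w] nr(1)
      by (simp add: mult.commute)
  qed
  finally have le: "(\<integral>\<^sup>+u. ennreal (Poisson (of_real r * z) u) * ennreal (Poisson (of_real s * w) u) \<partial>\<mu>)
    \<le> ennreal (16 * (Poisson (of_real r * z) w + Poisson (of_real s * w) z))"
    by (simp add: ennreal_leI)
  have n: "0 \<le> Poisson (of_real r * z) w" "0 \<le> Poisson (of_real s * w) z"
    using nr by (auto intro: Poisson_nonneg)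
  show ?thesis
    using le by (simp only: ennreal_plus[OF n, symmetric] ennreal_mult[OF zero_le_numeral add_nonneg_nonneg[OF n], symmetric])
qed

text \<open>The Poisson kernel along the chosen radii defines a positive operator T with |g (r(z)
  z)| <= T|g| (z). By \<open>Poisson_semigroup_bound\<close> it satisfies the hypothesis of
  \<open>TT_star_bound\<close> with C = 16, hence 1024 = (2 * 16)^2. The bound R < 1 makes the
  kernel bounded but does not enter the constant, so the selection may come arbitrarily close to the
  circle.\<close>

lemma radial_selection_bound:
  assumes cont: "continuous_on (cball 0 1) g" and holo: "g holomorphic_on ball 0 1"
    and r [measurable]: "r \<in> borel_measurable \<mu>"
    and R: "\<And>z. 0 \<le> r z" "\<And>z. r z \<le> R" "R < (1::real)"
  shows "(\<integral>\<^sup>+z. ennreal ((norm (g (of_real (r z) * z)))^2) \<partial>\<mu>)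
     \<le> ennreal 1024 * (\<integral>\<^sup>+z. ennreal ((norm (g z))^2) \<partial>\<mu>)"
proof -
  let ?k = "\<lambda>z u. ennreal (Poisson (of_real (r z) * z) u)"
  have R0: "0 \<le> R" using R order.trans by blast
  have r1: "norm (of_real (r z) * z) \<le> R" if "norm z = 1" for z :: complex
    using that R by (simp add: norm_mult)
  have gs: "continuous_on (sphere 0 1) g" by (rule continuous_on_subset[OF cont]) auto
  have gm [measurable]: "g \<in> borel_measurable \<mu>"
    by (rule continuous_on_sphere_borel_measurable[OF gs])
  have "(\<integral>\<^sup>+z. ennreal ((norm (g (of_real (r z) * z)))^2) \<partial>\<mu>)
      \<le> (\<integral>\<^sup>+z. (\<integral>\<^sup>+u. ?k z u * ennreal (norm (g u)) \<partial>\<mu>)^2 \<partial>\<mu>)"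
  proof (rule nn_integral_mono)
    fix z assume "z \<in> space \<mu>"
    then have "norm z = 1" by (simp add: space_circle_measure)
    then have "ennreal (norm (g (of_real (r z) * z))) \<le> (\<integral>\<^sup>+u. ?k z u * ennreal (norm (g u)) \<partial>\<mu>)"
      using r1 R(3) by (intro norm_le_Poisson_integral cont holo) (meson le_less_trans)
    then have "(ennreal (norm (g (of_real (r z) * z))))^2 \<le> (\<integral>\<^sup>+u. ?k z u * ennreal (norm (g u)) \<partial>\<mu>)^2"
      by (rule power_mono) simp
    then show "ennreal ((norm (g (of_real (r z) * z)))^2) \<le> (\<integral>\<^sup>+u. ?k z u * ennreal (norm (g u)) \<partial>\<mu>)^2"
      by (simp add: ennreal_power)
  qed
  also have "\<dots> \<le> ennreal ((2 * 16)^2) * (\<integral>\<^sup>+u. (ennreal (norm (g u)))^2 \<partial>\<mu>)"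
  proof (rule TT_star_bound[where B = "1 / (1 - R)^2"])
    show "prob_space \<mu>" by (rule prob_space_circle_measure)
    show "(\<lambda>(z, u). ?k z u) \<in> borel_measurable (\<mu> \<Otimes>\<^sub>M \<mu>)"
      unfolding Poisson_def by measurable
    show "(\<lambda>u. ennreal (norm (g u))) \<in> borel_measurable \<mu>" by measurable
    have "continuous_on (sphere 0 1) (\<lambda>z. (norm (g z))^2)" by (intro continuous_intros gs)
    then have "integrable \<mu> (\<lambda>z. (norm (g z))^2)" by (rule integrable_circle_measure_continuous)
    then show "(\<integral>\<^sup>+u. (ennreal (norm (g u)))^2 \<partial>\<mu>) < \<infinity>"
      by (simp add: ennreal_power integrable_iff_bounded)
    fix z u assume zu: "z \<in> space \<mu>" "u \<in> space \<mu>"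
    then have n: "norm z = 1" "norm u = 1" by (auto simp: space_circle_measure)
    have "1 - R \<le> norm (u - of_real (r z) * z)"
      using norm_triangle_ineq2[of u "of_real (r z) * z"] r1[OF n(1)] n by linarith
    then have "Poisson (of_real (r z) * z) u \<le> 1 / (1 - R)^2"
      unfolding Poisson_def using R(3) by (intro frac_le power_mono) auto
    then show "?k z u \<le> ennreal (1 / (1 - R)^2)" by (rule ennreal_leI)
    show "(\<integral>\<^sup>+v. ?k z v * ?k u v \<partial>\<mu>) \<le> ennreal 16 * (?k z u + ?k u z)"
      using n R by (intro Poisson_semigroup_bound) (auto intro: le_less_trans)
  qed auto
  finally show ?thesis by (simp add: ennreal_power)
qed

text \<open>The maximum over the first n radii is attained along a measurable selection, to which
  the bound for selections applies with a constant independent of n. Monotone convergence then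
  yields the supremum.\<close>

lemma radial_maximal_inequality:
  assumes holo: "h holomorphic_on ball 0 1"
    and Y: "\<And>\<rho>. 0 < \<rho> \<Longrightarrow> \<rho> < 1 \<Longrightarrow> (\<integral>\<^sup>+z. ennreal ((norm (h (of_real \<rho> * z)))^2) \<partial>\<mu>) \<le> Y"
    and q: "\<And>n. 0 \<le> q n" "\<And>n. q n < (1::real)"
  shows "(\<integral>\<^sup>+z. (SUP n::nat. ennreal ((norm (h (of_real (q n) * z)))^2)) \<partial>\<mu>) \<le> ennreal 1024 * Y"
proof -
  \<comment> \<open>\<open>R n z\<close> is the first among \<open>q 0\<close>, ...,
    \<open>q n\<close> at which |h| is largest on the ray through z.\<close>
  define R where "R = rec_nat (\<lambda>z. q 0)
    (\<lambda>n r z. if norm (h (of_real (r z) * z)) < norm (h (of_real (q (Suc n)) * z)) then q (Suc n) else r z)"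
  have R0: "R 0 z = q 0"
    and RS: "R (Suc n) z = (if norm (h (of_real (R n z) * z)) < norm (h (of_real (q (Suc n)) * z)) then q (Suc n) else R n z)" for n z
    by (simp_all add: R_def)
  have hq [measurable]: "(\<lambda>z. h (of_real (q n) * z)) \<in> borel_measurable \<mu>" for n
    by (rule holomorphic_dilation[OF holo q])
  have meas: "R n \<in> borel_measurable \<mu> \<and> (\<lambda>z. h (of_real (R n z) * z)) \<in> borel_measurable \<mu>" for n
  proof (induction n)
    case 0
    then show ?case by (simp add: R0 hq)
  next
    case (Suc n)
    then have [measurable]: "R n \<in> borel_measurable \<mu>" "(\<lambda>z. h (of_real (R n z) * z)) \<in> borel_measurable \<mu>"
      by auto
    have "(\<lambda>z. h (of_real (R (Suc n) z) * z)) = (\<lambda>z. if norm (h (of_real (R n z) * z)) < norm (h (of_real (q (Suc n)) * z))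
       then h (of_real (q (Suc n)) * z) else h (of_real (R n z) * z))" by (auto simp: RS)
    moreover have "R (Suc n) = (\<lambda>z. if norm (h (of_real (R n z) * z)) < norm (h (of_real (q (Suc n)) * z)) then q (Suc n) else R n z)"
      by (auto simp: RS)
    ultimately show ?case by simp
  qed
  have Rbd: "0 \<le> R n z \<and> R n z \<le> Max (q ` {..n})" for n z
  proof (induction n)
    case (Suc n)
    have "Max (q ` {..n}) \<le> Max (q ` {..Suc n})" by (intro Max_mono) auto
    with Suc have "R n z \<le> Max (q ` {..Suc n})" by linarith
    moreover have "q (Suc n) \<le> Max (q ` {..Suc n})" by (intro Max_ge) auto
    ultimately show ?case using Suc q(1)[of "Suc n"] by (simp add: RS)
  qed (use q in \<open>simp add: R0\<close>)
  have inc: "norm (h (of_real (R n z) * z)) \<le> norm (h (of_real (R (Suc n) z) * z))" for n z by (simp add: RS)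
  have qR: "norm (h (of_real (q n) * z)) \<le> norm (h (of_real (R n z) * z))" for n z
    by (cases n) (auto simp: R0 RS)
  have bd: "(\<integral>\<^sup>+z. ennreal ((norm (h (of_real (R n z) * z)))^2) \<partial>\<mu>) \<le> ennreal 1024 * Y" for n
  proof -
    define m where "m = Max (q ` {..n})"
    have m: "0 \<le> m" "m < 1"
      unfolding m_def using q by (auto simp: Max_ge_iff)
    \<comment> \<open>\<open>h\<close> need not extend continuously to the closed disk. Dilating by
      a factor between the largest available radius and 1 gives a function that does, and the
      selection becomes \<open>R n z / \<rho>\<close>, still bounded by a constant below 1.\<close>
    define \<rho> where "\<rho> = (1 + m) / 2"
    have \<rho>: "0 < \<rho>" "\<rho> < 1" "m < \<rho>" using m by (auto simp: \<rho>_def)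
    have "(\<integral>\<^sup>+z. ennreal ((norm (h (of_real \<rho> * (of_real (R n z / \<rho>) * z))))^2) \<partial>\<mu>)
        \<le> ennreal 1024 * (\<integral>\<^sup>+z. ennreal ((norm (h (of_real \<rho> * z)))^2) \<partial>\<mu>)"
    proof (rule radial_selection_bound[where R = "m / \<rho>" and g = "\<lambda>z. h (of_real \<rho> * z)"])
      show "continuous_on (cball 0 1) (\<lambda>z. h (of_real \<rho> * z))" "(\<lambda>z. h (of_real \<rho> * z)) holomorphic_on ball 0 1"
        using \<rho> by (intro holomorphic_dilation[OF holo]; simp)+
      show "(\<lambda>z. R n z / \<rho>) \<in> borel_measurable \<mu>" 
        by (intro borel_measurable_divide conjunct1[OF meas] borel_measurable_const)
      show "0 \<le> R n z / \<rho>" "R n z / \<rho> \<le> m / \<rho>" for z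
        using Rbd[of n z] \<rho> by (auto simp: m_def[symmetric] divide_right_mono)
      show "m / \<rho> < 1" using \<rho> by simp
    qed
    also have "\<dots> \<le> ennreal 1024 * Y" using \<rho> by (intro mult_left_mono Y) auto
    finally have "(\<integral>\<^sup>+z. ennreal ((norm (h (of_real \<rho> * (of_real (R n z / \<rho>) * z))))^2) \<partial>\<mu>)
        \<le> ennreal 1024 * Y" .
    moreover have "of_real \<rho> * (of_real (R n z / \<rho>) * z) = of_real (R n z) * z" for z :: complex using \<rho> by simp
    ultimately show ?thesis by (simp only:)
  qed
  have "(\<integral>\<^sup>+z. (SUP n::nat. ennreal ((norm (h (of_real (q n) * z)))^2)) \<partial>\<mu>)
      \<le> (\<integral>\<^sup>+z. (SUP n::nat. ennreal ((norm (h (of_real (R n z) * z)))^2)) \<partial>\<mu>)"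
    by (intro nn_integral_mono SUP_mono') (intro ennreal_leI power_mono qR norm_ge_zero)
  also have "\<dots> = (SUP n. \<integral>\<^sup>+z. ennreal ((norm (h (of_real (R n z) * z)))^2) \<partial>\<mu>)"
  proof (rule nn_integral_monotone_convergence_SUP)
    show "incseq (\<lambda>n z. ennreal ((norm (h (of_real (R n z) * z)))^2))"
      by (intro incseq_SucI le_funI ennreal_leI power_mono inc) auto
    show "(\<lambda>z. ennreal ((norm (h (of_real (R n z) * z)))^2)) \<in> borel_measurable \<mu>" for n
      using meas[of n, THEN conjunct2] by measurable
  qed
  also have "\<dots> \<le> ennreal 1024 * Y" by (intro SUP_least bd)
  finally show ?thesis .
qed

section \<open>Square means and Taylor coefficients\<close>

lemma integral_norm_square_polynomial:
  "(\<integral>z. (\<Sum>n<N. b n * z ^ n) * cnj (\<Sum>n<N. b n * z ^ n) \<partial>\<mu>) = of_real (\<Sum>n<N. (norm (b n))^2)"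
proof -
  have int: "integrable \<mu> (\<lambda>z. b n * cnj (b m) * (z ^ n * cnj z ^ m))" for n m
    by (intro integrable_circle_measure_continuous continuous_intros)
  have "(\<integral>z. (\<Sum>n<N. b n * z ^ n) * cnj (\<Sum>n<N. b n * z ^ n) \<partial>\<mu>)
      = (\<integral>z. (\<Sum>n<N. \<Sum>m<N. b n * cnj (b m) * (z ^ n * cnj z ^ m)) \<partial>\<mu>)"
    by (simp add: sum_product mult_ac)
  also have "\<dots> = (\<Sum>n<N. \<Sum>m<N. b n * cnj (b m) * (if n = m then 1 else 0))"
    using int by (simp add: integral_circle_measure_power_cnj_power Bochner_Integration.integral_sum)
  also have "\<dots> = (\<Sum>n<N. b n * cnj (b n))"
    by (intro sum.cong refl) (simp add: if_distrib sum.delta cong: if_cong)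
  also have "\<dots> = of_real (\<Sum>n<N. (norm (b n))^2)"
    by (simp only: complex_norm_square of_real_sum)
  finally show ?thesis .
qed

text \<open>Absolute summability bounds the partial sums on the circle by a constant, so that
  Parseval's identity passes from polynomials to the limit by dominated convergence.\<close>

lemma Parseval_absolutely_summable:
  fixes b :: "nat \<Rightarrow> complex"
  assumes b: "summable (\<lambda>n. norm (b n))"
  shows "summable (\<lambda>n. (norm (b n))^2)"
    and "(\<integral>\<^sup>+z. ennreal ((norm (\<Sum>n. b n * z ^ n))^2) \<partial>\<mu>) = ennreal (\<Sum>n. (norm (b n))^2)"
proof -
  define K where "K = (\<Sum>n. norm (b n))"
  define S where "S N z = (\<Sum>n<N. b n * z ^ n)" for N z
  define g where "g z = (\<Sum>n. b n * z ^ n)" for z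
  have nz: "norm (b n * z ^ n) = norm (b n)" if "norm z = 1" for z n
    using that by (simp add: norm_mult norm_power)
  have lim: "(\<lambda>N. S N z) \<longlonglongrightarrow> g z" if "norm z = 1" for z
    unfolding S_def g_def using b by (intro summable_LIMSEQ summable_norm_cancel[of "\<lambda>n. b n * z ^ n"]) (simp add: nz[OF that])
  have SK: "norm (S N z) \<le> K" if "norm z = 1" for N z
  proof -
    have "norm (S N z) \<le> (\<Sum>n<N. norm (b n))"
      unfolding S_def by (rule sum_norm_le) (simp add: nz[OF that])
    also have "\<dots> \<le> K" unfolding K_def by (rule sum_le_suminf[OF b]) auto
    finally show ?thesis .
  qed
  have K0: "0 \<le> K" unfolding K_def by (rule suminf_nonneg[OF b]) simp
  have Sm [measurable]: "S N \<in> borel_measurable \<mu>" for N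
    unfolding S_def by measurable
  have gm [measurable]: "g \<in> borel_measurable \<mu>"
    by (rule borel_measurable_LIMSEQ_metric[of S]) (auto simp: space_circle_measure intro: lim)
  have gK: "norm (g z) \<le> K" if "norm z = 1" for z
    by (rule tendsto_upperbound[OF tendsto_norm[OF lim[OF that]]]) (auto simp: SK that)
  have [measurable]: "(\<lambda>z. cnj (u z)) \<in> borel_measurable \<mu>"
    if "u \<in> borel_measurable \<mu>" for u :: "complex \<Rightarrow> complex"
    by (rule borel_measurable_continuous_on[OF _ that]) (intro continuous_intros)
  have "(\<lambda>N. \<integral>z. S N z * cnj (S N z) \<partial>\<mu>) \<longlonglongrightarrow> (\<integral>z. g z * cnj (g z) \<partial>\<mu>)"
  proof (rule integral_dominated_convergence[where w = "\<lambda>_. K * K"])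
    show "AE z in \<mu>. (\<lambda>N. S N z * cnj (S N z)) \<longlonglongrightarrow> g z * cnj (g z)"
      by (intro AE_I2 tendsto_intros lim) (auto simp: space_circle_measure)
    show "AE z in \<mu>. norm (S N z * cnj (S N z)) \<le> K * K" for N
      using SK K0 by (intro AE_I2) (auto simp: norm_mult space_circle_measure intro!: mult_mono)
  qed auto
  then have "(\<lambda>N. complex_of_real (\<Sum>n<N. (norm (b n))^2)) \<longlonglongrightarrow> (\<integral>z. of_real ((norm (g z))^2) \<partial>\<mu>)"
    unfolding S_def integral_norm_square_polynomial by (simp only: complex_norm_square)
  then have "(\<lambda>N. complex_of_real (\<Sum>n<N. (norm (b n))^2)) \<longlonglongrightarrow> of_real (\<integral>z. (norm (g z))^2 \<partial>\<mu>)"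
    by (simp only: integral_complex_of_real)
  then have sums: "(\<lambda>n. (norm (b n))^2) sums (\<integral>z. (norm (g z))^2 \<partial>\<mu>)"
    unfolding sums_def tendsto_of_real_iff .
  then show "summable (\<lambda>n. (norm (b n))^2)" by (rule sums_summable)
  have "integrable \<mu> (\<lambda>z. (norm (g z))^2)"
    using gK by (intro circle.integrable_const_bound[where B = "K^2"] AE_I2) (auto simp: space_circle_measure intro!: power_mono)
  then have "(\<integral>\<^sup>+z. ennreal ((norm (g z))^2) \<partial>\<mu>) = ennreal (\<integral>z. (norm (g z))^2 \<partial>\<mu>)"
    by (rule nn_integral_eq_integral) auto
  then show "(\<integral>\<^sup>+z. ennreal ((norm (\<Sum>n. b n * z ^ n))^2) \<partial>\<mu>) = ennreal (\<Sum>n. (norm (b n))^2)"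
    using sums_unique[OF sums] by (simp add: g_def)
qed

lemma holomorphic_ball_power_series:
  assumes holo: "f holomorphic_on ball 0 1"
  obtains a :: "nat \<Rightarrow> complex"
  where "\<And>z. norm z < 1 \<Longrightarrow> (\<lambda>n. a n * z ^ n) sums f z"
    "\<And>\<rho>. 0 < \<rho> \<Longrightarrow> \<rho> < 1 \<Longrightarrow> summable (\<lambda>n. norm (a n * of_real \<rho> ^ n))"
proof -
  define a where "a n = (deriv ^^ n) f 0 / fact n" for n
  have sums: "(\<lambda>n. a n * z ^ n) sums f z" if "norm z < 1" for z
    using holomorphic_power_series[OF holo, of z] that by (simp add: a_def)
  have "summable (\<lambda>n. norm (a n * of_real \<rho> ^ n))" if "0 < \<rho>" "\<rho> < 1" for \<rho>
  proof (rule powser_insidea)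
    have "norm (complex_of_real ((1 + \<rho>) / 2)) = (1 + \<rho>) / 2" using that unfolding norm_of_real by simp
    then show "summable (\<lambda>n. a n * of_real ((1 + \<rho>) / 2) ^ n)" "norm (complex_of_real \<rho>) < norm (complex_of_real ((1 + \<rho>) / 2))"
      using that by (auto intro!: sums_summable[OF sums])
  qed
  with sums show ?thesis by (rule that)
qed

text \<open>\<open>p N\<close> is the Taylor polynomial and \<open>\<tau> N\<close> the tail of the
  series of squared coefficients. Parseval on the circle of radius \<rho> and the bound
  \<open>M\<close>, followed by \<rho> tending to 1 in finite partial sums, give that this series
  converges. Its tail then bounds the error on all circles at once.\<close>

lemma holomorphic_tail_tendsto_0:
  assumes holo: "f holomorphic_on ball 0 1" and M: "\<And>z. z \<in> ball 0 1 \<Longrightarrow> norm (f z) \<le> M"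
  obtains p :: "nat \<Rightarrow> complex \<Rightarrow> complex" and \<tau> :: "nat \<Rightarrow> real"
  where "\<And>N. p N holomorphic_on UNIV" "\<tau> \<longlonglongrightarrow> 0"
    "\<And>N \<rho>. 0 < \<rho> \<Longrightarrow> \<rho> < 1 \<Longrightarrow>
      (\<integral>\<^sup>+z. ennreal ((norm (f (of_real \<rho> * z) - p N (of_real \<rho> * z)))^2) \<partial>\<mu>) \<le> ennreal (\<tau> N)"
proof -
  obtain a :: "nat \<Rightarrow> complex" where sums: "\<And>z. norm z < 1 \<Longrightarrow> (\<lambda>n. a n * z ^ n) sums f z"
    and abs: "\<And>\<rho>. 0 < \<rho> \<Longrightarrow> \<rho> < 1 \<Longrightarrow> summable (\<lambda>n. norm (a n * of_real \<rho> ^ n))"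
    using holomorphic_ball_power_series[OF holo] by blast
  define p where "p N z = (\<Sum>n<N. a n * z ^ n)" for N z
  have M0: "0 \<le> M" using M[of 0] by (meson centre_in_ball norm_ge_zero order.trans zero_less_one)
  have part: "(\<Sum>n<N. (norm (a n))^2 * (\<rho>^2) ^ n) \<le> M^2" if \<rho>: "0 < \<rho>" "\<rho> < 1" for \<rho> N
  proof -
    note P = Parseval_absolutely_summable[OF abs[OF \<rho>]]
    have "ennreal (\<Sum>n. (norm (a n * of_real \<rho> ^ n))^2)
        = (\<integral>\<^sup>+z. ennreal ((norm (\<Sum>n. a n * of_real \<rho> ^ n * z ^ n))^2) \<partial>\<mu>)"
      by (rule P(2)[symmetric])
    also have "\<dots> \<le> (\<integral>\<^sup>+z. ennreal (M^2) \<partial>\<mu>)"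
    proof (intro nn_integral_mono ennreal_leI power_mono)
      fix z assume "z \<in> space \<mu>"
      then have n: "norm (of_real \<rho> * z) < 1" using \<rho> by (simp add: space_circle_measure norm_mult)
      have "(\<Sum>n. a n * of_real \<rho> ^ n * z ^ n) = f (of_real \<rho> * z)"
        using sums_unique[OF sums[OF n]] by (simp add: power_mult_distrib mult_ac)
      then show "norm (\<Sum>n. a n * of_real \<rho> ^ n * z ^ n) \<le> M" using M[of "of_real \<rho> * z"] n by simp
    qed auto
    also have "\<dots> = ennreal (M^2)" by (simp add: circle.emeasure_space_1)
    finally have "(\<Sum>n. (norm (a n * of_real \<rho> ^ n))^2) \<le> M^2" by simp
    moreover have "(\<Sum>n<N. (norm (a n * of_real \<rho> ^ n))^2) \<le> (\<Sum>n. (norm (a n * of_real \<rho> ^ n))^2)"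
      by (rule sum_le_suminf[OF P(1)]) auto
    moreover have "(norm (a n * of_real \<rho> ^ n))^2 = (norm (a n))^2 * (\<rho>^2) ^ n" for n
      using \<rho> by (simp add: norm_mult norm_power power_mult_distrib power_mult[symmetric] mult.commute)
    ultimately show ?thesis by simp
  qed
  have "(\<Sum>n<N. (norm (a n))^2) \<le> M^2" for N
  proof -
    have "((\<lambda>\<rho>. \<Sum>n<N. (norm (a n))^2 * (\<rho>^2) ^ n) \<longlongrightarrow> (\<Sum>n<N. (norm (a n))^2 * (1^2) ^ n)) (at_left (1::real))"
      by (intro tendsto_intros)
    moreover have "\<forall>\<^sub>F \<rho> in at_left (1::real). (\<Sum>n<N. (norm (a n))^2 * (\<rho>^2) ^ n) \<le> M^2"
      by (rule eventually_at_leftI[of 0]) (auto intro: part)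
    ultimately show ?thesis by (auto dest!: tendsto_upperbound)
  qed
  then have summ: "summable (\<lambda>n. (norm (a n))^2)" by (intro summableI_nonneg_bounded[where x = "M^2"]) auto
  define \<tau> where "\<tau> N = (\<Sum>n. (norm (a (n + N)))^2)" for N
  show ?thesis
  proof (rule that[of p \<tau>])
    show "p N holomorphic_on UNIV" for N unfolding p_def by (intro holomorphic_intros)
    show "\<tau> \<longlonglongrightarrow> 0" unfolding \<tau>_def by (rule suminf_exist_split2[OF summ])
    fix N and \<rho> :: real assume \<rho>: "0 < \<rho>" "\<rho> < 1"
    define b where "b n = (if n < N then 0 else a n * of_real \<rho> ^ n)" for n
    have bs: "summable (\<lambda>n. norm (b n))"
      by (rule summable_comparison_test'[OF abs[OF \<rho>], of 0]) (auto simp: b_def)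
    note P = Parseval_absolutely_summable[OF bs]
    have "(\<integral>\<^sup>+z. ennreal ((norm (f (of_real \<rho> * z) - p N (of_real \<rho> * z)))^2) \<partial>\<mu>)
      = (\<integral>\<^sup>+z. ennreal ((norm (\<Sum>n. b n * z ^ n))^2) \<partial>\<mu>)"
    proof (rule nn_integral_cong)
      fix z assume "z \<in> space \<mu>"
      then have n: "norm (of_real \<rho> * z) < 1" using \<rho> by (simp add: space_circle_measure norm_mult)
      have "(\<lambda>n. (if n \<in> {..<N} then a n * (of_real \<rho> * z) ^ n else 0)) sums p N (of_real \<rho> * z)"
        unfolding p_def by (rule sums_If_finite_set) simp
      from sums_diff[OF sums[OF n] this] have "(\<lambda>n. b n * z ^ n) sums (f (of_real \<rho> * z) - p N (of_real \<rho> * z))"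
        by (rule sums_cong[THEN iffD1, rotated]) (auto simp: b_def power_mult_distrib)
      then show "ennreal ((norm (f (of_real \<rho> * z) - p N (of_real \<rho> * z)))^2) = ennreal ((norm (\<Sum>n. b n * z ^ n))^2)"
        by (simp add: sums_iff)
    qed
    also have "\<dots> = ennreal (\<Sum>n. (norm (b n))^2)" by (rule P(2))
    also have "(\<Sum>n. (norm (b n))^2) = (\<Sum>n. (norm (b (n + N)))^2)"
      using suminf_split_initial_segment[OF P(1), of N] by (simp add: b_def)
    also have "\<dots> \<le> \<tau> N"
      unfolding \<tau>_def
    proof (rule suminf_le)
      show "summable (\<lambda>n. (norm (b (n + N)))^2)" using P(1) by (rule summable_ignore_initial_segment)
      show "summable (\<lambda>n. (norm (a (n + N)))^2)" using summ by (rule summable_ignore_initial_segment)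
      show "(norm (b (n + N)))^2 \<le> (norm (a (n + N)))^2" for n
        using \<rho> by (intro power_mono) (auto simp: b_def norm_mult norm_power power_le_one intro!: mult_left_le)
    qed
    finally show "(\<integral>\<^sup>+z. ennreal ((norm (f (of_real \<rho> * z) - p N (of_real \<rho> * z)))^2) \<partial>\<mu>) \<le> ennreal (\<tau> N)"
      by (simp add: ennreal_leI)
  qed
qed

text \<open>By the maximal inequality the integral of sup_r |f - p N|^2 is at most 1024
  \<open>\<tau> N\<close>. Hence for almost every z and every e some N, depending on z and e, makes
  f - p N small along the whole radius. Since p N is continuous up to the circle, f satisfies the
  Cauchy criterion there.\<close>

theorem Fatou_radial_limit:
  assumes holo: "f holomorphic_on ball 0 1" and M: "\<And>z. z \<in> ball 0 1 \<Longrightarrow> norm (f z) \<le> M"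
  shows "AE z in \<mu>. \<exists>l. ((\<lambda>r. f (of_real r * z)) \<longlongrightarrow> l) (at_left (1::real))"
proof -
  obtain p \<tau> where p: "\<And>N. p N holomorphic_on UNIV" and \<tau>: "\<tau> \<longlonglongrightarrow> 0"
    and Y: "\<And>N \<rho>. 0 < \<rho> \<Longrightarrow> \<rho> < 1 \<Longrightarrow>
      (\<integral>\<^sup>+z. ennreal ((norm (f (of_real \<rho> * z) - p N (of_real \<rho> * z)))^2) \<partial>\<mu>) \<le> ennreal (\<tau> N)"
    using holomorphic_tail_tendsto_0[OF holo M] by blast
  \<comment> \<open>A countable dense set of radii keeps the supremum measurable; continuity along
    the ray recovers the other radii.\<close>
  define q where "q = from_nat_into (\<rat> \<inter> {0..<1::real})"
  have "\<rat> \<inter> {0..<1::real} \<noteq> {}" by (auto intro!: exI[of _ 0])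
  then have q: "q n \<in> \<rat> \<inter> {0..<1}" for n unfolding q_def by (rule from_nat_into)
  have q_surj: "\<exists>n. q n = r" if "r \<in> \<rat>" "0 \<le> r" "r < 1" for r
    unfolding q_def using that
    by (intro from_nat_into_surj countable_subset[OF _ countable_rat]) auto
  have hol: "(\<lambda>z. f z - p N z) holomorphic_on ball 0 1" for N
    by (intro holomorphic_intros holo holomorphic_on_subset[OF p]) auto
  define S where "S N z = (SUP n. ennreal ((norm (f (of_real (q n) * z) - p N (of_real (q n) * z)))^2))" for N z
  have meas: "(\<lambda>z. f (of_real r * z) - p N (of_real r * z)) \<in> borel_measurable \<mu>" if "0 \<le> r" "r < 1" for r N
    by (rule holomorphic_dilation[OF hol that])
  have Sm [measurable]: "S N \<in> borel_measurable \<mu>" for N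
    unfolding S_def
    by (intro borel_measurable_SUP measurable_compose[OF meas, of _ "\<lambda>w. ennreal ((norm w)^2)"]) (use q in auto)
  have SI: "(\<integral>\<^sup>+z. S N z \<partial>\<mu>) \<le> ennreal 1024 * ennreal (\<tau> N)" for N
    unfolding S_def using q by (intro radial_maximal_inequality[OF hol Y]) auto
  have "(\<integral>\<^sup>+z. (INF N. S N z) \<partial>\<mu>) \<le> ennreal 1024 * ennreal (\<tau> N)" for N
    using SI[of N] by (rule order.trans[rotated]) (intro nn_integral_mono INF_lower UNIV_I)
  moreover have "(\<lambda>N. ennreal 1024 * ennreal (\<tau> N)) \<longlonglongrightarrow> ennreal 1024 * ennreal 0"
    by (intro ennreal_tendsto_cmult tendsto_ennrealI \<tau>) auto
  ultimately have "(\<integral>\<^sup>+z. (INF N. S N z) \<partial>\<mu>) \<le> ennreal 1024 * ennreal 0"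
    by (intro LIMSEQ_le_const) auto
  then have "(\<integral>\<^sup>+z. (INF N. S N z) \<partial>\<mu>) = 0" by simp
  then have "AE z in \<mu>. (INF N. S N z) = 0"
    by (subst (asm) nn_integral_0_iff_AE) measurable
  then show ?thesis
    using AE_space
  proof eventually_elim
    case (elim z)
    then have z: "norm z = 1" by (simp add: space_circle_measure)
    show ?case
    proof (rule Cauchy_at_left_imp_tendsto)
      fix e :: real assume e: "0 < e"
      have "(INF N. S N z) < ennreal ((e / 4)^2)" using elim(1) e by simp
      then obtain N where N: "S N z < ennreal ((e / 4)^2)" by (auto simp: INF_less_iff)
      have cont: "continuous_on {0..<1} (\<lambda>r. norm (f (of_real r * z) - p N (of_real r * z)))"
        by (intro continuous_on_norm continuous_on_compose2[OF holomorphic_on_imp_continuous_on[OF hol]] continuous_intros)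
           (use z in \<open>auto simp: norm_mult\<close>)
      \<comment> \<open>If the bound failed at r, continuity from the right would make it fail at a
        rational radius slightly larger than r, against the bound on \<open>S N z\<close>.\<close>
      have bound: "norm (f (of_real r * z) - p N (of_real r * z)) \<le> e / 4" if r: "0 \<le> r" "r < 1" for r
      proof (rule ccontr)
        assume "\<not> ?thesis"
        then have gt: "e / 4 < norm (f (of_real r * z) - p N (of_real r * z))" by simp
        have "((\<lambda>r. norm (f (of_real r * z) - p N (of_real r * z))) \<longlongrightarrow> norm (f (of_real r * z) - p N (of_real r * z))) (at r within {0..<1})"
          using cont r by (auto simp: continuous_on_def)
        then have "((\<lambda>r. norm (f (of_real r * z) - p N (of_real r * z))) \<longlongrightarrow> norm (f (of_real r * z) - p N (of_real r * z))) (at r within {r..(r + 1) / 2})"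
          by (rule tendsto_within_subset) (use r in auto)
        then have "((\<lambda>r. norm (f (of_real r * z) - p N (of_real r * z))) \<longlongrightarrow> norm (f (of_real r * z) - p N (of_real r * z))) (at_right r)"
          using r by (simp add: at_within_Icc_at_right)
        then have "\<forall>\<^sub>F t in at_right r. e / 4 < norm (f (of_real t * z) - p N (of_real t * z))"
          by (rule order_tendstoD) (rule gt)
        then obtain c where c: "r < c" "\<And>t. r < t \<Longrightarrow> t < c \<Longrightarrow> e / 4 < norm (f (of_real t * z) - p N (of_real t * z))"
          by (auto simp: eventually_at_right_field)
        obtain t where t: "t \<in> \<rat>" "r < t" "t < min c 1" using Rats_dense_in_real[of r "min c 1"] c r by auto
        then obtain n where n: "q n = t" using q_surj[of t] r by auto
        have "ennreal ((norm (f (of_real t * z) - p N (of_real t * z)))^2) \<le> S N z"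
          unfolding S_def n[symmetric] by (rule SUP_upper) simp
        with N have "ennreal ((norm (f (of_real t * z) - p N (of_real t * z)))^2) < ennreal ((e / 4)^2)" by simp
        then have "(norm (f (of_real t * z) - p N (of_real t * z)))^2 < (e / 4)^2" by (simp add: ennreal_less_iff)
        then have "norm (f (of_real t * z) - p N (of_real t * z)) < e / 4"
          by (rule power_less_imp_less_base) (use e in simp)
        with c(2)[of t] t show False by simp
      qed
      have "isCont (\<lambda>r. p N (of_real r * z)) 1"
        using p[of N] by (intro continuous_on_interior[of UNIV] continuous_on_compose2[OF holomorphic_on_imp_continuous_on[OF p]] continuous_intros) auto
      then obtain d where d: "0 < d" "\<And>r. dist r 1 < d \<Longrightarrow> dist (p N (of_real r * z)) (p N (of_real 1 * z)) < e / 4"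
        unfolding continuous_at_eps_delta using e by (metis zero_less_divide_iff zero_less_numeral)
      show "\<exists>d<1. \<forall>r\<in>{d<..<1}. \<forall>s\<in>{d<..<1}. dist (f (of_real r * z)) (f (of_real s * z)) < e"
      proof (intro exI[of _ "max 0 (1 - d)"] conjI ballI)
        fix r s assume "r \<in> {max 0 (1 - d)<..<1}" "s \<in> {max 0 (1 - d)<..<1}"
        then have rs: "0 \<le> r" "r < 1" "dist r 1 < d" "0 \<le> s" "s < 1" "dist s 1 < d" by (auto simp: dist_real_def)
        have "dist (f (of_real r * z)) (p N (of_real r * z)) \<le> e / 4" "dist (p N (of_real s * z)) (f (of_real s * z)) \<le> e / 4"
          using bound[OF rs(1,2)] bound[OF rs(4,5)] by (simp_all add: dist_norm norm_minus_commute)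
        moreover have "dist (p N (of_real r * z)) (p N (of_real s * z)) < e / 2"
          using dist_triangle_half_l[of "p N (of_real r * z)" "p N (of_real 1 * z)" "e / 2" "p N (of_real s * z)"] d(2)[OF rs(3)] d(2)[OF rs(6)] by simp
        moreover have "dist (f (of_real r * z)) (f (of_real s * z)) \<le> dist (f (of_real r * z)) (p N (of_real r * z))
           + (dist (p N (of_real r * z)) (p N (of_real s * z)) + dist (p N (of_real s * z)) (f (of_real s * z)))"
          by (rule order.trans[OF dist_triangle add_left_mono[OF dist_triangle]])
        ultimately show "dist (f (of_real r * z)) (f (of_real s * z)) < e" by linarith
      qed (use d in auto)
    qed
  qed
qed

section \<open>Multiplication on the disk\<close>

lemma holomorphic_dilation_polynomial_approx:
  assumes holo: "f holomorphic_on ball 0 1" and \<rho>: "0 < \<rho>" "\<rho> < 1" and e: "0 < e"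
  obtains p where "\<And>z. norm z = 1 \<Longrightarrow> norm (f (of_real \<rho> * z) - poly p z) < e"
proof -
  obtain a :: "nat \<Rightarrow> complex" where sums: "\<And>z. norm z < 1 \<Longrightarrow> (\<lambda>n. a n * z ^ n) sums f z"
    and abs: "\<And>\<rho>. 0 < \<rho> \<Longrightarrow> \<rho> < 1 \<Longrightarrow> summable (\<lambda>n. norm (a n * of_real \<rho> ^ n))"
    using holomorphic_ball_power_series[OF holo] by blast
  have "uniform_limit (sphere 0 1) (\<lambda>N z. \<Sum>n<N. a n * (of_real \<rho> * z) ^ n) (\<lambda>z. \<Sum>n. a n * (of_real \<rho> * z) ^ n) sequentially"
    by (rule Weierstrass_m_test[OF _ abs[OF \<rho>]]) (use \<rho> in \<open>auto simp: norm_mult norm_power\<close>)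
  then have "\<forall>\<^sub>F N in sequentially. \<forall>z\<in>sphere 0 1. dist (\<Sum>n<N. a n * (of_real \<rho> * z) ^ n) (\<Sum>n. a n * (of_real \<rho> * z) ^ n) < e"
    using e by (rule uniform_limitD)
  then obtain N where N: "\<forall>z\<in>sphere 0 1. dist (\<Sum>n<N. a n * (of_real \<rho> * z) ^ n) (\<Sum>n. a n * (of_real \<rho> * z) ^ n) < e"
    unfolding eventually_sequentially by blast
  define p where "p = (\<Sum>n<N. monom (a n * of_real \<rho> ^ n) n)"
  show ?thesis
  proof (rule that[of p])
    fix z :: complex assume z: "norm z = 1"
    then have "norm (of_real \<rho> * z) < 1" using \<rho> by (simp add: norm_mult)
    from sums_unique[OF sums[OF this]] have "f (of_real \<rho> * z) = (\<Sum>n. a n * (of_real \<rho> * z) ^ n)" .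
    moreover have "poly p z = (\<Sum>n<N. a n * (of_real \<rho> * z) ^ n)"
      by (simp add: p_def poly_sum poly_monom power_mult_distrib mult.assoc)
    ultimately show "norm (f (of_real \<rho> * z) - poly p z) < e"
      using bspec[OF N, of z] z by (simp add: dist_norm norm_minus_commute)
  qed
qed

section \<open>Boundary functions\<close>

abbreviation H1_norm :: "(complex \<Rightarrow> complex) \<Rightarrow> ennreal" where
  "H1_norm f \<equiv> SUP r \<in> {0..<1::real}. \<integral>\<^sup>+z. ennreal (norm (f (of_real r * z))) \<partial>\<mu>"

text \<open>A relation rather than the operator \<open>boundary_function\<close>: it asserts that
  the limits exist, and it is preserved by products and by composition with continuous functions,
  with explicit boundary values.\<close>

definition has_boundary_function :: "(complex \<Rightarrow> complex) \<Rightarrow> (complex \<Rightarrow> complex) \<Rightarrow> bool" where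
  "has_boundary_function f F \<longleftrightarrow>
     (AE z in \<mu>. ((\<lambda>r. f (of_real r * z)) \<longlongrightarrow> F z) (at_left (1::real)))"

lemma has_boundary_function_unique:
  assumes "has_boundary_function f F" "has_boundary_function f G"
  shows "AE z in \<mu>. F z = G z"
  using assms unfolding has_boundary_function_def
  by eventually_elim (rule tendsto_unique[OF trivial_limit_at_left_real])

lemma has_boundary_function_eq:
  assumes "has_boundary_function f F"
  shows "AE z in \<mu>. boundary_function f z = F z"
  using assms unfolding has_boundary_function_def boundary_function_def
  by eventually_elim (rule tendsto_Lim[OF trivial_limit_at_left_real])

lemma has_boundary_function_boundary_function:
  assumes "has_boundary_function f F"
  shows "has_boundary_function f (boundary_function f)"
  using assms has_boundary_function_eq[OF assms] unfolding has_boundary_function_def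
  by eventually_elim simp

lemma has_boundary_function_mult:
  assumes "has_boundary_function f F" "has_boundary_function g G"
  shows "has_boundary_function (\<lambda>z. f z * g z) (\<lambda>z. F z * G z)"
  using assms unfolding has_boundary_function_def
  by eventually_elim (rule tendsto_mult)

lemma has_boundary_function_continuous:
  assumes "has_boundary_function f F" "continuous_on UNIV h"
  shows "has_boundary_function (\<lambda>z. h (f z)) (\<lambda>z. h (F z))"
  using assms(1) unfolding has_boundary_function_def
proof eventually_elim
  case (elim z)
  have "isCont h (F z)" using assms(2) by (simp add: continuous_on_eq_continuous_at)
  then show ?case using elim by (rule isCont_tendsto_compose)
qed

text \<open>A fixed sequence of radii in (0,1) tending to 1. Measurability of limits and dominated
  convergence require sequences instead of the filter at 1.\<close>

definition radius :: "nat \<Rightarrow> real" where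
  "radius k = 1 - 1 / (real k + 2)"

lemma radius_bounds: "0 < radius k" "0 \<le> radius k" "radius k < 1"
  by (auto simp: radius_def field_simps)

lemma radius_tendsto: "filterlim radius (at_left 1) sequentially"
  unfolding radius_def by real_asymp

lemma has_boundary_function_sequence:
  assumes "has_boundary_function f F"
  shows "AE z in \<mu>. (\<lambda>k. f (of_real (radius k) * z)) \<longlonglongrightarrow> F z"
  using assms unfolding has_boundary_function_def
  by eventually_elim (rule filterlim_compose[OF _ radius_tendsto])

lemma has_boundary_function_measurable:
  assumes holo: "f holomorphic_on ball 0 1" and F: "has_boundary_function f F"
  shows "F \<in> borel_measurable \<mu>"
proof -
  have "(\<lambda>z. lim (\<lambda>k. f (of_real (radius k) * z))) \<in> borel_measurable \<mu>"
    by (intro borel_measurable_lim_metric holomorphic_dilation[OF holo] radius_bounds)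
  moreover have "AE z in \<mu>. lim (\<lambda>k. f (of_real (radius k) * z)) = F z"
    using has_boundary_function_sequence[OF F] by eventually_elim (rule limI)
  ultimately show ?thesis by (rule borel_measurable_circle_measure_AE_eq)
qed

lemma Hinf_disk_bound:
  assumes "\<phi> \<in> Hinf_disk"
  obtains M where "0 \<le> M" "Hinf_norm \<phi> = ennreal M" "\<And>z. z \<in> ball 0 1 \<Longrightarrow> norm (\<phi> z) \<le> M"
proof -
  obtain M where M: "0 \<le> M" "Hinf_norm \<phi> = ennreal M"
    using assms by (cases "Hinf_norm \<phi>") (auto simp: Hinf_disk_def)
  have "norm (\<phi> z) \<le> M" if "z \<in> ball 0 1" for z
  proof -
    have "ennreal (norm (\<phi> z)) \<le> Hinf_norm \<phi>" unfolding Hinf_norm_def using that by (rule SUP_upper)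
    then show ?thesis using M by simp
  qed
  then show ?thesis using M that by blast
qed

lemma Hinf_disk_boundary:
  assumes \<phi>: "\<phi> \<in> Hinf_disk" and M: "\<And>z. z \<in> ball 0 1 \<Longrightarrow> norm (\<phi> z) \<le> M"
  obtains F where "has_boundary_function \<phi> F" "F \<in> Linf_circle" "AE z in \<mu>. norm (F z) \<le> M"
proof -
  have holo: "\<phi> holomorphic_on ball 0 1" using \<phi> by (simp add: Hinf_disk_def)
  have "AE z in \<mu>. \<exists>l. ((\<lambda>r. \<phi> (of_real r * z)) \<longlongrightarrow> l) (at_left (1::real))"
    using holo M by (rule Fatou_radial_limit)
  then have F: "has_boundary_function \<phi> (boundary_function \<phi>)"
    unfolding has_boundary_function_def boundary_function_def
  proof eventually_elim
    case (elim z)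
    then obtain l where l: "((\<lambda>r. \<phi> (of_real r * z)) \<longlongrightarrow> l) (at_left (1::real))" by blast
    with tendsto_Lim[OF trivial_limit_at_left_real l] show ?case by simp
  qed
  have bd: "AE z in \<mu>. norm (boundary_function \<phi> z) \<le> M"
    using has_boundary_function_sequence[OF F] AE_space
  proof eventually_elim
    case (elim z)
    have "norm (\<phi> (of_real (radius k) * z)) \<le> M" for k
      using elim(2) by (intro M dilation_in_ball radius_bounds) (simp add: space_circle_measure)
    then show ?case by (intro tendsto_upperbound[OF tendsto_norm[OF elim(1)]]) auto
  qed
  show ?thesis
    by (rule that[OF F Linf_circleI[OF has_boundary_function_measurable[OF holo F] bd] bd])
qed

lemma poly_Linf_circle: "poly p \<in> Linf_circle"
proof -
  have c: "continuous_on (sphere 0 1) (poly p)" by (intro continuous_intros)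
  have "bounded (poly p ` sphere 0 1)"
    by (intro compact_imp_bounded compact_continuous_image[OF c compact_sphere])
  then obtain B where "\<And>z. z \<in> sphere 0 1 \<Longrightarrow> norm (poly p z) \<le> B" unfolding bounded_iff by blast
  then show ?thesis
    by (intro Linf_circleI[of _ B] continuous_on_sphere_borel_measurable[OF c] AE_I2) (simp add: space_circle_measure)
qed

context continuous_rotationally_symmetric_norm
begin

section \<open>The closure of the polynomials on the circle\<close>

lemma H_alpha_circle_script_L_alpha: "F \<in> H_alpha_circle \<alpha> \<Longrightarrow> F \<in> script_L_alpha \<alpha>"
  by (simp add: H_alpha_circle_def alpha_closure_def)

lemma H_alpha_circle_measurable: "F \<in> H_alpha_circle \<alpha> \<Longrightarrow> F \<in> borel_measurable \<mu>"
  by (simp add: H_alpha_circle_script_L_alpha script_L_alpha_measurable)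

lemma H_alpha_circle_finite: "F \<in> H_alpha_circle \<alpha> \<Longrightarrow> \<N> F < \<infinity>"
  using H_alpha_circle_script_L_alpha by (auto simp: script_L_alpha_def)

lemma H_alpha_circleE:
  assumes "F \<in> H_alpha_circle \<alpha>" "0 < e"
  obtains p where "\<N> (\<lambda>z. F z - poly p z) < ennreal e"
  using assms unfolding H_alpha_circle_def alpha_closure_def by blast

lemma poly_in_H_alpha_circle: "poly p \<in> H_alpha_circle \<alpha>"
proof -
  have "\<N> (\<lambda>z. poly p z - poly p z) = 0"
    using extended_norm_Linf[OF Linf_circle_const, of 0] by (simp add: alpha_const)
  then have "\<exists>g\<in>range poly. \<N> (\<lambda>z. poly p z - g z) < ennreal e" if "0 < e" for e
    using that by (intro bexI[of _ "poly p"]) auto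
  then show ?thesis
    unfolding H_alpha_circle_def alpha_closure_def
    using poly_Linf_circle Linf_subset_script_L_alpha by blast
qed

text \<open>Closedness is stated for functions that are merely measurable: finiteness of the norm
  follows from an approximation within distance 1.\<close>

lemma H_alpha_circle_limit:
  assumes [measurable]: "F \<in> borel_measurable \<mu>"
    and lim: "\<And>e. 0 < e \<Longrightarrow> \<exists>G\<in>H_alpha_circle \<alpha>. \<N> (\<lambda>z. F z - G z) < ennreal e"
  shows "F \<in> H_alpha_circle \<alpha>"
  unfolding H_alpha_circle_def alpha_closure_def script_L_alpha_def
proof safe
  have approx: "\<N> (\<lambda>z. F z - H z) \<le> \<N> (\<lambda>z. F z - G z) + \<N> (\<lambda>z. G z - H z)"
    if [measurable]: "G \<in> borel_measurable \<mu>" "H \<in> borel_measurable \<mu>" for G H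
    using extended_norm_triangle[of "\<lambda>z. F z - G z" "\<lambda>z. G z - H z"] by simp
  obtain G where G: "G \<in> H_alpha_circle \<alpha>" "\<N> (\<lambda>z. F z - G z) < ennreal 1"
    using lim[of 1] by auto
  have "\<N> (\<lambda>z. F z - 0) \<le> \<N> (\<lambda>z. F z - G z) + \<N> (\<lambda>z. G z - 0)"
    by (rule approx) (use G H_alpha_circle_measurable in auto)
  also have "\<dots> < \<infinity>"
    using G(2) H_alpha_circle_finite[OF G(1)] by (auto simp: ennreal_add_less_top intro: order.strict_trans)
  finally show "\<N> F < \<infinity>" by simp
  fix e :: real assume e: "0 < e"
  obtain G where G: "G \<in> H_alpha_circle \<alpha>" "\<N> (\<lambda>z. F z - G z) < ennreal (e / 2)"
    using lim[of "e / 2"] e by auto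
  obtain p where p: "\<N> (\<lambda>z. G z - poly p z) < ennreal (e / 2)"
    by (rule H_alpha_circleE[OF G(1), of "e / 2"]) (use e in \<open>simp, blast\<close>)
  have "\<N> (\<lambda>z. F z - poly p z) \<le> \<N> (\<lambda>z. F z - G z) + \<N> (\<lambda>z. G z - poly p z)"
    by (rule approx[OF H_alpha_circle_measurable[OF G(1)] Linf_circle_measurable[OF poly_Linf_circle]])
  also have "\<dots> < ennreal (e / 2) + ennreal (e / 2)" by (rule add_strict_mono[OF G(2) p])
  also have "\<dots> = ennreal e" using e by (simp add: ennreal_plus[symmetric] del: ennreal_plus)
  finally show "\<exists>g\<in>range poly. \<N> (\<lambda>z. F z - g z) < ennreal e" by blast
qed measurable

lemma H_alpha_circle_AE_cong:
  assumes F: "F \<in> H_alpha_circle \<alpha>" and eq: "AE z in \<mu>. F z = G z"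
  shows "G \<in> H_alpha_circle \<alpha>"
proof (rule H_alpha_circle_limit)
  show "G \<in> borel_measurable \<mu>"
    by (rule borel_measurable_circle_measure_AE_eq[OF H_alpha_circle_measurable[OF F] eq])
  fix e :: real assume e: "0 < e"
  have "\<N> (\<lambda>z. G z - F z) = \<N> (\<lambda>z. 0)"
    using eq by (intro extended_norm_cong) (auto elim!: eventually_mono)
  then show "\<exists>F\<in>H_alpha_circle \<alpha>. \<N> (\<lambda>z. G z - F z) < ennreal e"
    using F e extended_norm_Linf[OF Linf_circle_const, of 0] by (auto simp: alpha_const intro!: bexI[of _ F])
qed

text \<open>The common core of the next two lemmas. Approximation by polynomials is applied to one
  factor at a time: first \<open>g\<close> is a polynomial and \<open>F\<close> is approximated,
  then \<open>g\<close> is a bounded element of the space and its products with the polynomial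
  approximants of \<open>F\<close> are covered by the first case.\<close>

lemma H_alpha_circle_bounded_mult_limit:
  assumes F: "F \<in> borel_measurable \<mu>" and g: "g \<in> Linf_circle"
    and lim: "\<And>e. 0 < e \<Longrightarrow> \<exists>G. (\<lambda>z. g z * G z) \<in> H_alpha_circle \<alpha> \<and> \<N> (\<lambda>z. F z - G z) < ennreal e"
  shows "(\<lambda>z. g z * F z) \<in> H_alpha_circle \<alpha>"
proof (rule H_alpha_circle_limit)
  show "(\<lambda>z. g z * F z) \<in> borel_measurable \<mu>" using F g by measurable
  fix e :: real assume e: "0 < e"
  obtain C where C: "0 \<le> C" "AE z in \<mu>. norm (g z) \<le> C" using g by (rule Linf_circleE)
  have "0 < e / (C + 1)" using e C by simp
  then obtain G where G: "(\<lambda>z. g z * G z) \<in> H_alpha_circle \<alpha>" "\<N> (\<lambda>z. F z - G z) < ennreal (e / (C + 1))"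
    using lim by blast
  have "\<N> (\<lambda>z. g z * F z - g z * G z) = \<N> (\<lambda>z. g z * (F z - G z))"
    by (simp add: right_diff_distrib)
  also have "\<dots> \<le> ennreal (C + 1) * \<N> (\<lambda>z. F z - G z)"
    using C by (intro extended_norm_mult_le) (auto elim!: eventually_mono)
  also have "\<dots> < ennreal e" using G(2) C(1) by (intro ennreal_mult_less_ennreal) auto
  finally show "\<exists>G\<in>H_alpha_circle \<alpha>. \<N> (\<lambda>z. g z * F z - G z) < ennreal e"
    by (intro bexI[OF _ G(1)])
qed

lemma H_alpha_circle_poly_mult:
  assumes "F \<in> H_alpha_circle \<alpha>"
  shows "(\<lambda>z. poly p z * F z) \<in> H_alpha_circle \<alpha>"
proof (rule H_alpha_circle_bounded_mult_limit[OF H_alpha_circle_measurable[OF assms] poly_Linf_circle])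
  fix e :: real assume "0 < e"
  then obtain q where q: "\<N> (\<lambda>z. F z - poly q z) < ennreal e" using H_alpha_circleE[OF assms] by blast
  have "(\<lambda>z. poly p z * poly q z) = poly (p * q)" by auto
  then have "(\<lambda>z. poly p z * poly q z) \<in> H_alpha_circle \<alpha>" using poly_in_H_alpha_circle[of "p * q"] by simp
  with q show "\<exists>G. (\<lambda>z. poly p z * G z) \<in> H_alpha_circle \<alpha> \<and> \<N> (\<lambda>z. F z - G z) < ennreal e" by blast
qed

lemma H_alpha_circle_mult:
  assumes g: "g \<in> H_alpha_circle \<alpha>" "g \<in> Linf_circle" and F: "F \<in> H_alpha_circle \<alpha>"
  shows "(\<lambda>z. g z * F z) \<in> H_alpha_circle \<alpha>"
proof (rule H_alpha_circle_bounded_mult_limit[OF H_alpha_circle_measurable[OF F] g(2)])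
  fix e :: real assume "0 < e"
  then obtain q where q: "\<N> (\<lambda>z. F z - poly q z) < ennreal e" using H_alpha_circleE[OF F] by blast
  have "(\<lambda>z. g z * poly q z) \<in> H_alpha_circle \<alpha>" using H_alpha_circle_poly_mult[OF g(1), of q] by (simp add: mult.commute)
  with q show "\<exists>G. (\<lambda>z. g z * G z) \<in> H_alpha_circle \<alpha> \<and> \<N> (\<lambda>z. F z - G z) < ennreal e" by blast
qed

lemma H_alpha_circle_add:
  assumes F: "F \<in> H_alpha_circle \<alpha>" and G: "G \<in> H_alpha_circle \<alpha>"
  shows "(\<lambda>z. F z + G z) \<in> H_alpha_circle \<alpha>"
proof (rule H_alpha_circle_limit)
  note [measurable] = H_alpha_circle_measurable[OF F] H_alpha_circle_measurable[OF G] Linf_circle_measurable[OF poly_Linf_circle]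
  show "(\<lambda>z. F z + G z) \<in> borel_measurable \<mu>" by measurable
  fix e :: real assume e: "0 < e"
  obtain p where p: "\<N> (\<lambda>z. F z - poly p z) < ennreal (e / 2)"
    by (rule H_alpha_circleE[OF F, of "e / 2"]) (use e in \<open>simp, blast\<close>)
  obtain q where q: "\<N> (\<lambda>z. G z - poly q z) < ennreal (e / 2)"
    by (rule H_alpha_circleE[OF G, of "e / 2"]) (use e in \<open>simp, blast\<close>)
  have "\<N> (\<lambda>z. F z + G z - poly (p + q) z) = \<N> (\<lambda>z. (F z - poly p z) + (G z - poly q z))"
    by (simp add: algebra_simps)
  also have "\<dots> \<le> \<N> (\<lambda>z. F z - poly p z) + \<N> (\<lambda>z. G z - poly q z)"
    by (rule extended_norm_triangle) measurable
  also have "\<dots> < ennreal (e / 2) + ennreal (e / 2)" by (rule add_strict_mono[OF p q])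
  also have "\<dots> = ennreal e" using e by (simp add: ennreal_plus[symmetric] del: ennreal_plus)
  finally show "\<exists>H\<in>H_alpha_circle \<alpha>. \<N> (\<lambda>z. F z + G z - H z) < ennreal e"
    using poly_in_H_alpha_circle by blast
qed

section \<open>Functions in the disk and their boundary functions\<close>

lemma H_alpha_disk_iff:
  "f \<in> H_alpha_disk \<alpha> \<longleftrightarrow> f \<in> H1_disk \<and> (\<exists>F\<in>H_alpha_circle \<alpha>. has_boundary_function f F)"
proof safe
  assume "f \<in> H_alpha_disk \<alpha>"
  then show "f \<in> H1_disk" "\<exists>F\<in>H_alpha_circle \<alpha>. has_boundary_function f F"
    by (auto simp: H_alpha_disk_def has_boundary_function_def)
next
  fix F assume f: "f \<in> H1_disk" and F: "F \<in> H_alpha_circle \<alpha>" "has_boundary_function f F"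
  have "AE z in \<mu>. F z = boundary_function f z"
    using has_boundary_function_eq[OF F(2)] by eventually_elim simp
  with F(1) have "boundary_function f \<in> H_alpha_circle \<alpha>" by (rule H_alpha_circle_AE_cong)
  with f has_boundary_function_boundary_function[OF F(2)] show "f \<in> H_alpha_disk \<alpha>"
    by (simp add: H_alpha_disk_def has_boundary_function_def)
qed

lemma H_alpha_disk_boundary:
  assumes "f \<in> H_alpha_disk \<alpha>" "has_boundary_function f F"
  shows "F \<in> H_alpha_circle \<alpha>"
proof -
  obtain G where G: "G \<in> H_alpha_circle \<alpha>" "has_boundary_function f G"
    using assms(1) unfolding H_alpha_disk_iff by blast
  show ?thesis by (rule H_alpha_circle_AE_cong[OF G(1) has_boundary_function_unique[OF G(2) assms(2)]])
qed

lemma H_alpha_disk_norm_eq: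
  assumes "has_boundary_function f F"
  shows "H_alpha_disk_norm \<alpha> f = \<N> F"
  unfolding H_alpha_disk_norm_def
  by (rule extended_norm_cong) (use has_boundary_function_eq[OF assms] in \<open>auto elim!: eventually_mono\<close>)

lemma H_alpha_disk_const: "(\<lambda>z. c) \<in> H_alpha_disk \<alpha>"
proof -
  have "(\<lambda>z. c) = poly [:c:]" by auto
  then have "(\<lambda>z. c) \<in> H_alpha_circle \<alpha>" using poly_in_H_alpha_circle[of "[:c:]"] by simp
  moreover have "has_boundary_function (\<lambda>z. c) (\<lambda>z. c)" by (simp add: has_boundary_function_def)
  moreover have "(\<lambda>z. c) \<in> H1_disk" by (simp add: H1_disk_def circle.emeasure_space_1)
  ultimately show ?thesis unfolding H_alpha_disk_iff by blast
qed

lemma Hinf_boundary_in_H_alpha_circle: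
  assumes holo: "\<phi> holomorphic_on ball 0 1" and M: "\<And>z. z \<in> ball 0 1 \<Longrightarrow> norm (\<phi> z) \<le> M"
    and F: "has_boundary_function \<phi> F" "F \<in> Linf_circle" "AE z in \<mu>. norm (F z) \<le> M"
  shows "F \<in> H_alpha_circle \<alpha>"
proof (rule H_alpha_circle_limit)
  note [measurable] = Linf_circle_measurable[OF F(2)]
  have dm [measurable]: "(\<lambda>z. \<phi> (of_real (radius k) * z)) \<in> borel_measurable \<mu>" for k
    by (intro holomorphic_dilation[OF holo] radius_bounds)
  have dM: "norm (\<phi> (of_real (radius k) * z)) \<le> M" if "z \<in> space \<mu>" for k z
    using that by (intro M dilation_in_ball radius_bounds) (simp add: space_circle_measure)
  \<comment> \<open>A dilation is a uniform limit of polynomials on the circle, because its Taylor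
    series converges absolutely there; uniform closeness controls the norm.\<close>
  have dH: "(\<lambda>z. \<phi> (of_real (radius k) * z)) \<in> H_alpha_circle \<alpha>" for k
  proof (rule H_alpha_circle_limit[OF dm])
    fix e :: real assume e: "0 < e"
    obtain p where p: "\<And>z. norm z = 1 \<Longrightarrow> norm (\<phi> (of_real (radius k) * z) - poly p z) < e / 2"
      by (rule holomorphic_dilation_polynomial_approx[OF holo radius_bounds(1,3), of "e / 2" k]) (use e in auto)
    have m: "(\<lambda>z. \<phi> (of_real (radius k) * z) - poly p z) \<in> borel_measurable \<mu>"
      using Linf_circle_measurable[OF poly_Linf_circle[of p]] by measurable
    have b: "AE z in \<mu>. norm (\<phi> (of_real (radius k) * z) - poly p z) \<le> e / 2"
      using p by (intro AE_I2) (auto simp: space_circle_measure intro: less_imp_le)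
    have "\<N> (\<lambda>z. \<phi> (of_real (radius k) * z) - poly p z) \<le> ennreal (e / 2)"
      using alpha_le[OF m b] e extended_norm_le_alpha[OF Linf_circleI[OF m b]]
      by (auto intro: order.trans ennreal_leI)
    also have "\<dots> < ennreal e" using e by (intro ennreal_lessI) auto
    finally show "\<exists>G\<in>H_alpha_circle \<alpha>. \<N> (\<lambda>z. \<phi> (of_real (radius k) * z) - G z) < ennreal e"
      using poly_in_H_alpha_circle by blast
  qed
  show "F \<in> borel_measurable \<mu>" by measurable
  fix e :: real assume e: "0 < e"
  have b: "AE z in \<mu>. norm (F z - \<phi> (of_real (radius k) * z)) \<le> M + M" for k
    using F(3) AE_space
  proof eventually_elim
    case (elim z)
    then show ?case
      using norm_triangle_ineq4[of "F z" "\<phi> (of_real (radius k) * z)"] dM[of z k] by linarith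
  qed
  have "\<forall>\<^sub>F k in sequentially. \<alpha> (\<lambda>z. F z - \<phi> (of_real (radius k) * z)) < e"
  proof (rule alpha_dominated_tendsto_0[OF _ b])
    show "AE z in \<mu>. (\<lambda>k. F z - \<phi> (of_real (radius k) * z)) \<longlonglongrightarrow> 0"
      using has_boundary_function_sequence[OF F(1)]
    proof eventually_elim
      case (elim z)
      from tendsto_diff[OF tendsto_const elim, of "F z"] show ?case by simp
    qed
  qed (use e in measurable)
  then obtain k where k: "\<alpha> (\<lambda>z. F z - \<phi> (of_real (radius k) * z)) < e"
    by (auto simp: eventually_sequentially)
  have "(\<lambda>z. F z - \<phi> (of_real (radius k) * z)) \<in> Linf_circle"
    by (rule Linf_circleI[OF _ b]) measurable
  then have "\<N> (\<lambda>z. F z - \<phi> (of_real (radius k) * z)) < ennreal e"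
    using k e by (simp add: extended_norm_Linf ennreal_lessI)
  then show "\<exists>G\<in>H_alpha_circle \<alpha>. \<N> (\<lambda>z. F z - G z) < ennreal e"
    by (intro bexI[OF _ dH])
qed

lemma Hinf_mult_H_alpha_disk:
  assumes \<phi>: "\<phi> \<in> Hinf_disk" and f: "f \<in> H_alpha_disk \<alpha>"
  shows "mult_op \<phi> f \<in> H_alpha_disk \<alpha>"
proof -
  obtain M where M: "0 \<le> M" "\<And>z. z \<in> ball 0 1 \<Longrightarrow> norm (\<phi> z) \<le> M" using Hinf_disk_bound[OF \<phi>] by blast
  obtain F where F: "has_boundary_function \<phi> F" "F \<in> Linf_circle" "AE z in \<mu>. norm (F z) \<le> M"
    using Hinf_disk_boundary[OF \<phi> M(2)] by blast
  have holo: "\<phi> holomorphic_on ball 0 1" using \<phi> by (simp add: Hinf_disk_def)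
  obtain G where G: "G \<in> H_alpha_circle \<alpha>" "has_boundary_function f G" and f1: "f \<in> H1_disk"
    using f H_alpha_disk_iff by blast
  then have fh: "f holomorphic_on ball 0 1" by (simp add: H1_disk_def)
  have "H1_norm (mult_op \<phi> f)
     \<le> ennreal M * H1_norm f"
  proof (rule SUP_least)
    fix r :: real assume r: "r \<in> {0..<1}"
    have [measurable]: "(\<lambda>z. f (of_real r * z)) \<in> borel_measurable \<mu>"
      using r by (intro holomorphic_dilation[OF fh]) auto
    have "(\<integral>\<^sup>+z. ennreal (norm (mult_op \<phi> f (of_real r * z))) \<partial>\<mu>)
        \<le> (\<integral>\<^sup>+z. ennreal M * ennreal (norm (f (of_real r * z))) \<partial>\<mu>)"
    proof (rule nn_integral_mono)
      fix z assume "z \<in> space \<mu>"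
      then have "of_real r * z \<in> ball 0 1" using r by (simp add: space_circle_measure norm_mult)
      then show "ennreal (norm (mult_op \<phi> f (of_real r * z))) \<le> ennreal M * ennreal (norm (f (of_real r * z)))"
        using M by (simp add: mult_op_def norm_mult ennreal_mult[symmetric] mult_right_mono ennreal_leI)
    qed
    also have "\<dots> = ennreal M * (\<integral>\<^sup>+z. ennreal (norm (f (of_real r * z))) \<partial>\<mu>)"
      by (rule nn_integral_cmult) measurable
    also have "\<dots> \<le> ennreal M * H1_norm f"
      using r by (intro mult_left_mono SUP_upper) auto
    finally show "(\<integral>\<^sup>+z. ennreal (norm (mult_op \<phi> f (of_real r * z))) \<partial>\<mu>)
      \<le> ennreal M * H1_norm f" .
  qed
  also have "\<dots> < \<infinity>" using f1 by (auto simp: H1_disk_def ennreal_mult_less_top)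
  finally have "mult_op \<phi> f \<in> H1_disk"
    unfolding H1_disk_def using holo fh by (auto simp: mult_op_def[abs_def] intro!: holomorphic_intros)
  moreover have "has_boundary_function (mult_op \<phi> f) (\<lambda>z. F z * G z)"
    unfolding mult_op_def by (rule has_boundary_function_mult[OF F(1) G(2)])
  moreover have "(\<lambda>z. F z * G z) \<in> H_alpha_circle \<alpha>"
    by (rule H_alpha_circle_mult[OF Hinf_boundary_in_H_alpha_circle[OF holo M(2) F] F(2) G(1)])
  ultimately show ?thesis unfolding H_alpha_disk_iff by blast
qed

end

section \<open>Bounds in the disk from the boundary and from circle means\<close>

text \<open>The bound \<open>M\<close> only dominates the dilations while the Poisson formula passes
  to the boundary function. The Poisson kernel has mean 1, so the estimate that results has the
  constant \<open>K\<close>.\<close>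

lemma bounded_boundary_imp_bounded:
  assumes holo: "\<phi> holomorphic_on ball 0 1" and M: "\<And>z. z \<in> ball 0 1 \<Longrightarrow> norm (\<phi> z) \<le> M"
    and F: "has_boundary_function \<phi> F" and K: "AE z in \<mu>. norm (F z) \<le> K" and w: "norm w < 1"
  shows "norm (\<phi> w) \<le> K"
proof -
  have P0: "0 \<le> Poisson w z" for z using w by (intro Poisson_nonneg) simp
  have [measurable]: "(\<lambda>z. \<phi> (of_real (radius k) * z)) \<in> borel_measurable \<mu>" for k
    by (intro holomorphic_dilation[OF holo] radius_bounds)
  have [measurable]: "F \<in> borel_measurable \<mu>" by (rule has_boundary_function_measurable[OF holo F])
  have Pm [measurable]: "Poisson w \<in> borel_measurable \<mu>"
    by (rule borel_measurable_integrable[OF integrable_circle_measure_continuous[OF Poisson_continuous[OF w]]])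
  have Pi: "integrable \<mu> (Poisson w)"
    by (rule integrable_circle_measure_continuous[OF Poisson_continuous[OF w]])
  have "(\<integral>z. 1 * of_real (Poisson w z) \<partial>\<mu>) = (1 :: complex)"
    by (rule Poisson_formula[OF _ _ w]) auto
  then have P1: "(\<integral>z. Poisson w z \<partial>\<mu>) = 1"
    by simp
  have "(\<lambda>k. \<integral>z. \<phi> (of_real (radius k) * z) * of_real (Poisson w z) \<partial>\<mu>)
     \<longlonglongrightarrow> (\<integral>z. F z * of_real (Poisson w z) \<partial>\<mu>)"
  proof (rule integral_dominated_convergence[where w = "\<lambda>z. M * Poisson w z"])
    show "AE z in \<mu>. (\<lambda>k. \<phi> (of_real (radius k) * z) * of_real (Poisson w z))
        \<longlonglongrightarrow> F z * of_real (Poisson w z)"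
      using has_boundary_function_sequence[OF F] by eventually_elim (intro tendsto_intros)
    show "AE z in \<mu>. norm (\<phi> (of_real (radius k) * z) * of_real (Poisson w z)) \<le> M * Poisson w z" for k
    proof (rule AE_I2)
      fix z assume "z \<in> space \<mu>"
      then have "norm (\<phi> (of_real (radius k) * z)) \<le> M" by (intro M dilation_in_ball radius_bounds) (simp add: space_circle_measure)
      then show "norm (\<phi> (of_real (radius k) * z) * of_real (Poisson w z)) \<le> M * Poisson w z"
        using P0[of z] unfolding norm_mult norm_of_real by (simp add: mult_right_mono)
    qed
    show "(\<lambda>z. F z * of_real (Poisson w z)) \<in> borel_measurable \<mu>"
      "(\<lambda>z. \<phi> (of_real (radius k) * z) * of_real (Poisson w z)) \<in> borel_measurable \<mu>" for k
      by measurable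
  qed (use Pi in simp)
  moreover have "(\<integral>z. \<phi> (of_real (radius k) * z) * of_real (Poisson w z) \<partial>\<mu>) = \<phi> (of_real (radius k) * w)" for k
    by (intro Poisson_formula[OF _ _ w] holomorphic_dilation[OF holo] radius_bounds)
  ultimately have 1: "(\<lambda>k. \<phi> (of_real (radius k) * w)) \<longlonglongrightarrow> (\<integral>z. F z * of_real (Poisson w z) \<partial>\<mu>)"
    by simp
  have "radius \<longlonglongrightarrow> 1"
    using radius_tendsto by (rule filterlim_mono) (simp_all add: at_within_le_nhds)
  then have "(\<lambda>k. of_real (radius k) * w) \<longlonglongrightarrow> of_real 1 * w" by (intro tendsto_intros)
  moreover have "isCont \<phi> w"
    using holomorphic_on_imp_continuous_on[OF holo] w by (simp add: continuous_on_eq_continuous_at)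
  ultimately have "(\<lambda>k. \<phi> (of_real (radius k) * w)) \<longlonglongrightarrow> \<phi> w"
    by (intro isCont_tendsto_compose[of w \<phi>]) simp_all
  then have "\<phi> w = (\<integral>z. F z * of_real (Poisson w z) \<partial>\<mu>)"
    using 1 by (rule LIMSEQ_unique)
  then have "norm (\<phi> w) \<le> (\<integral>z. norm (F z * of_real (Poisson w z)) \<partial>\<mu>)"
    by (simp only: integral_norm_bound)
  also have "\<dots> \<le> (\<integral>z. K * Poisson w z \<partial>\<mu>)"
  proof -
    have le: "AE z in \<mu>. norm (F z * of_real (Poisson w z)) \<le> K * Poisson w z"
      using K
    proof eventually_elim
      case (elim z)
      then show ?case using P0[of z] unfolding norm_mult norm_of_real by (simp add: mult_right_mono)
    qed
    have KP: "integrable \<mu> (\<lambda>z. K * Poisson w z)" using Pi by simp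
    have m: "(\<lambda>z. F z * of_real (Poisson w z)) \<in> borel_measurable \<mu>" by measurable
    have "integrable \<mu> (\<lambda>z. F z * of_real (Poisson w z))"
      using le by (intro Bochner_Integration.integrable_bound[OF KP m]) (auto elim!: eventually_mono)
    then show ?thesis using KP le by (intro integral_mono_AE integrable_norm)
  qed
  also have "\<dots> = K" by (simp add: P1)
  finally show ?thesis .
qed

text \<open>The Poisson formula on a circle of radius strictly between |w| and 1, where the kernel
  is bounded independently of f. This is what turns large values of a function in the disk into
  large norms.\<close>

lemma point_evaluation_bound:
  assumes w: "norm w < 1"
  obtains C :: real where "0 < C" "\<And>f. f holomorphic_on ball 0 1 \<Longrightarrow>
    ennreal (norm (f w)) \<le> ennreal C * H1_norm f"
proof -
  define r where "r = (1 + norm w) / 2"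
  have r: "0 < r" "r < 1" "norm w < r" using w norm_ge_zero[of w] by (auto simp: r_def simp del: norm_ge_zero)
  define v where "v = w / of_real r"
  have v: "norm v < 1" "of_real r * v = w" using r by (auto simp: v_def norm_divide)
  show ?thesis
  proof (rule that[of "1 / (1 - norm v)^2"])
    show "0 < 1 / (1 - norm v)^2" using v by simp
    fix f assume f: "f holomorphic_on ball 0 1"
    have "ennreal (norm (f (of_real r * v)))
        \<le> (\<integral>\<^sup>+z. ennreal (Poisson v z) * ennreal (norm (f (of_real r * z))) \<partial>\<mu>)"
      using r by (intro norm_le_Poisson_integral[OF _ _ v(1)] holomorphic_dilation[OF f]) auto
    also have "\<dots> \<le> (\<integral>\<^sup>+z. ennreal (1 / (1 - norm v)^2) * ennreal (norm (f (of_real r * z))) \<partial>\<mu>)"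
    proof (intro nn_integral_mono mult_right_mono ennreal_leI)
      fix z assume "z \<in> space \<mu>"
      then have "1 - norm v \<le> norm (z - v)" using norm_triangle_ineq2[of z v] by (simp add: space_circle_measure)
      then show "Poisson v z \<le> 1 / (1 - norm v)^2"
        unfolding Poisson_def using v(1) by (intro frac_le power_mono) auto
    qed auto
    also have "\<dots> = ennreal (1 / (1 - norm v)^2) * (\<integral>\<^sup>+z. ennreal (norm (f (of_real r * z))) \<partial>\<mu>)"
    proof (rule nn_integral_cmult)
      have "(\<lambda>z. f (of_real r * z)) \<in> borel_measurable \<mu>"
        using r by (intro holomorphic_dilation[OF f]) auto
      then show "(\<lambda>z. ennreal (norm (f (of_real r * z)))) \<in> borel_measurable \<mu>" by measurable
    qed
    also have "\<dots> \<le> ennreal (1 / (1 - norm v)^2) * H1_norm f"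
      using r by (intro mult_left_mono SUP_upper) auto
    finally show "ennreal (norm (f w)) \<le> ennreal (1 / (1 - norm v)^2) *
        H1_norm f"
      by (simp only: v(2))
  qed
qed

context continuous_rotationally_symmetric_norm
begin

section \<open>The operator norm on the disk\<close>

lemma operator_norm_le_Hinf_norm:
  assumes \<phi>: "\<phi> \<in> Hinf_disk"
  shows "operator_norm (H_alpha_disk_norm \<alpha>) (H_alpha_disk \<alpha>) (mult_op \<phi>) \<le> Hinf_norm \<phi>"
  unfolding operator_norm_def
proof (rule SUP_least, safe)
  obtain M where M: "0 \<le> M" "Hinf_norm \<phi> = ennreal M" "\<And>z. z \<in> ball 0 1 \<Longrightarrow> norm (\<phi> z) \<le> M"
    using Hinf_disk_bound[OF \<phi>] by blast
  obtain F where F: "has_boundary_function \<phi> F" "AE z in \<mu>. norm (F z) \<le> M"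
    using Hinf_disk_boundary[OF \<phi> M(3)] by blast
  fix f assume f: "f \<in> H_alpha_disk \<alpha>" and le: "H_alpha_disk_norm \<alpha> f \<le> 1"
  obtain G where G: "has_boundary_function f G" using f H_alpha_disk_iff by blast
  have "has_boundary_function (mult_op \<phi> f) (\<lambda>z. F z * G z)"
    unfolding mult_op_def by (rule has_boundary_function_mult[OF F(1) G])
  then have "H_alpha_disk_norm \<alpha> (mult_op \<phi> f) = \<N> (\<lambda>z. F z * G z)" by (rule H_alpha_disk_norm_eq)
  also have "\<dots> \<le> ennreal M * \<N> G" by (rule extended_norm_mult_le[OF F(2) M(1)])
  also have "\<dots> \<le> ennreal M * 1"
    using le by (intro mult_left_mono) (auto simp: H_alpha_disk_norm_eq[OF G])
  finally show "H_alpha_disk_norm \<alpha> (mult_op \<phi> f) \<le> Hinf_norm \<phi>" by (simp add: M(2))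
qed

text \<open>If |F| / K were at least some q > 1 on a set E of positive measure, the norms of the
  powers would be at least q^n \<alpha>(\<chi>_E), which is unbounded.\<close>

lemma power_bounded_imp_AE_bounded:
  assumes [measurable]: "F \<in> borel_measurable \<mu>"
    and K: "0 < K" and N: "\<And>n. \<N> (\<lambda>z. (F z / of_real K) ^ n) \<le> 1"
  shows "AE z in \<mu>. norm (F z) \<le> K"
proof -
  \<comment> \<open>A countable exhaustion of the set where |F| exceeds K; on each piece |F| / K is
    bounded away from 1.\<close>
  define E where "E j = {z \<in> space \<mu>. K * (1 + 1 / real (Suc j)) \<le> norm (F z)}" for j
  have E [measurable]: "E j \<in> sets \<mu>" for j unfolding E_def by measurable
  have "emeasure \<mu> (E j) = 0" for j
  proof (rule ccontr)
    assume "emeasure \<mu> (E j) \<noteq> 0"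
    then have pos: "0 < \<alpha> (indicator (E j))" by (rule alpha_indicator_pos[OF E])
    define q where "q = 1 + 1 / real (Suc j)"
    have "1 < q" by (simp add: q_def)
    then obtain n where n: "1 / \<alpha> (indicator (E j)) < q ^ n" using real_arch_pow by blast
    have L: "(\<lambda>z. of_real (q ^ n) * indicator (E j) z) \<in> Linf_circle"
      by (intro Linf_circle_cmult Linf_circle_indicator E)
    have "ennreal (\<alpha> (\<lambda>z. of_real (q ^ n) * indicator (E j) z)) \<le> \<N> (\<lambda>z. (F z / of_real K) ^ n)"
    proof (rule alpha_le_extended_norm[OF L], rule AE_I2)
      fix z
      show "norm (of_real (q ^ n) * indicator (E j) z :: complex) \<le> norm ((F z / of_real K) ^ n)"
      proof (cases "z \<in> E j")
        case True
        then have "q \<le> norm (F z / of_real K)" using K by (simp add: E_def q_def norm_divide field_simps)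
        then have "q ^ n \<le> norm (F z / of_real K) ^ n" using \<open>1 < q\<close> by (intro power_mono) auto
        then show ?thesis using True \<open>1 < q\<close> by (simp add: norm_power)
      qed simp
    qed
    also have "\<dots> \<le> 1" by (rule N)
    finally have "\<alpha> (\<lambda>z. of_real (q ^ n) * indicator (E j) z) \<le> 1" by simp
    then have "q ^ n * \<alpha> (indicator (E j)) \<le> 1"
      using scale[OF Linf_circle_indicator[OF E], of "of_real (q ^ n)" j] \<open>1 < q\<close> by (simp add: norm_power)
    then show False using n pos by (simp add: divide_less_eq)
  qed
  then have "AE z in \<mu>. z \<notin> E j" for j
    by (simp add: AE_circle_measure_notin E)
  then have "AE z in \<mu>. \<forall>j. z \<notin> E j" by (simp add: AE_all_countable)
  then show ?thesis
    using AE_space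
  proof eventually_elim
    case (elim z)
    show ?case
    proof (rule ccontr)
      assume "\<not> norm (F z) \<le> K"
      then have "0 < norm (F z) / K - 1" using K by (simp add: field_simps)
      then obtain j where j: "inverse (real (Suc j)) < norm (F z) / K - 1" using reals_Archimedean by blast
      then have "1 + 1 / real (Suc j) \<le> norm (F z) / K" by (simp add: inverse_eq_divide)
      then have "K * (1 + 1 / real (Suc j)) \<le> norm (F z)" using K by (simp only: pos_le_divide_eq mult.commute)
      with elim show False by (auto simp: E_def)
    qed
  qed
qed

lemma Hinf_norm_le_operator_norm:
  assumes \<phi>: "\<phi> \<in> Hinf_disk"
  shows "Hinf_norm \<phi> \<le> operator_norm (H_alpha_disk_norm \<alpha>) (H_alpha_disk \<alpha>) (mult_op \<phi>)" (is "_ \<le> ?T")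
proof (rule ccontr)
  assume "\<not> ?thesis"
  then obtain x where x: "?T < x" "x < Hinf_norm \<phi>" by (auto simp: not_le dest: dense)
  then obtain K where K: "0 \<le> K" "x = ennreal K" by (cases x) auto
  have K0: "0 < K" using K x(1) by (cases "K = 0") auto
  have holo: "\<phi> holomorphic_on ball 0 1" using \<phi> by (simp add: Hinf_disk_def)
  obtain M where M: "\<And>z. z \<in> ball 0 1 \<Longrightarrow> norm (\<phi> z) \<le> M" using Hinf_disk_bound[OF \<phi>] by blast
  obtain F where F: "has_boundary_function \<phi> F" using Hinf_disk_boundary[OF \<phi> M] by blast
  \<comment> \<open>The supremum defining the operator norm runs over the unit ball, so dividing by
    K keeps every power inside it, and the induction carries membership along with the norm
    bound.\<close>
  have "(\<lambda>z. (\<phi> z / of_real K) ^ n) \<in> H_alpha_disk \<alpha> \<and> \<N> (\<lambda>z. (F z / of_real K) ^ n) \<le> 1" for n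
  proof (induction n)
    case 0
    then show ?case
      using H_alpha_disk_const[of 1] extended_norm_Linf[OF Linf_circle_const, of 1] by (simp add: alpha_const)
  next
    case (Suc n)
    let ?f = "\<lambda>z. (\<phi> z / of_real K) ^ n"
    have bf: "has_boundary_function ?f (\<lambda>z. (F z / of_real K) ^ n)"
      using K0 by (intro has_boundary_function_continuous[OF F, of "\<lambda>w. (w / of_real K) ^ n"] continuous_intros) auto
    have K\<phi>: "(\<lambda>z. \<phi> z / of_real K) \<in> Hinf_disk"
    proof -
      have "Hinf_norm (\<lambda>z. \<phi> z / of_real K) \<le> ennreal (M / K)"
        unfolding Hinf_norm_def using M K0
        by (intro SUP_least ennreal_leI) (auto simp: norm_divide intro: divide_right_mono)
      then have "Hinf_norm (\<lambda>z. \<phi> z / of_real K) < \<infinity>" using le_less_trans by fastforce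
      then show ?thesis using holo K0 by (auto simp: Hinf_disk_def intro!: holomorphic_intros)
    qed
    have m: "mult_op (\<lambda>z. \<phi> z / of_real K) ?f = (\<lambda>z. (\<phi> z / of_real K) ^ Suc n)" by (simp add: mult_op_def)
    have "\<N> (\<lambda>z. (F z / of_real K) ^ Suc n) = \<N> (\<lambda>z. of_real (1 / K) * (F z * (F z / of_real K) ^ n))"
      by simp
    also have "\<dots> = ennreal (1 / K) * \<N> (\<lambda>z. F z * (F z / of_real K) ^ n)"
      unfolding extended_norm_scale norm_of_real using K0 by simp
    also have "\<N> (\<lambda>z. F z * (F z / of_real K) ^ n) = H_alpha_disk_norm \<alpha> (mult_op \<phi> ?f)"
      unfolding mult_op_def by (rule H_alpha_disk_norm_eq[symmetric, OF has_boundary_function_mult[OF F bf]])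
    also have "ennreal (1 / K) * \<dots> \<le> ennreal (1 / K) * ennreal K"
    proof (rule mult_left_mono)
      have "H_alpha_disk_norm \<alpha> (mult_op \<phi> ?f) \<le> ?T"
        unfolding operator_norm_def using Suc by (intro SUP_upper) (simp add: H_alpha_disk_norm_eq[OF bf])
      with x(1) show "H_alpha_disk_norm \<alpha> (mult_op \<phi> ?f) \<le> ennreal K" by (simp add: K(2))
    qed simp
    also have "\<dots> = 1" using K0 by (simp add: ennreal_mult[symmetric])
    finally show ?case using Hinf_mult_H_alpha_disk[OF K\<phi>, of ?f] Suc unfolding m by blast
  qed
  then have "AE z in \<mu>. norm (F z) \<le> K"
    by (intro power_bounded_imp_AE_bounded has_boundary_function_measurable[OF holo F] K0) blast
  from bounded_boundary_imp_bounded[OF holo M F this] have "Hinf_norm \<phi> \<le> ennreal K"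
    unfolding Hinf_norm_def by (intro SUP_least ennreal_leI) auto
  with x K show False by simp
qed

end

subsection \<open>Unbounded multipliers\<close>

text \<open>
  A gliding hump argument for the functional calculus of one function: \<open>E g\<close> plays the role of
  the norm of \<open>g \<circ> \<Phi>\<close>.  The truncation to \<open>\<bar>x\<bar> \<le> k\<close> makes multiplication by \<open>x\<close> bounded, so that
  later humps cannot destroy earlier ones.
\<close>

lemma gliding_hump:
  fixes E :: "(complex \<Rightarrow> complex) \<Rightarrow> ennreal"
  assumes mono: "\<And>g h. (\<And>x. norm (g x) \<le> norm (h x)) \<Longrightarrow> E g \<le> E h"
    and triangle: "\<And>g h. g \<in> borel_measurable borel \<Longrightarrow> h \<in> borel_measurable borel \<Longrightarrow> E (\<lambda>x. g x + h x) \<le> E g + E h"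
    and scale: "\<And>c g. g \<in> borel_measurable borel \<Longrightarrow> E (\<lambda>x. c * g x) = ennreal (norm c) * E g"
    and Fatou: "\<And>g h B. (\<And>k::nat. g k \<in> borel_measurable borel) \<Longrightarrow> h \<in> borel_measurable borel \<Longrightarrow>
        (\<And>x. (\<lambda>k. g k x) \<longlonglongrightarrow> h x) \<Longrightarrow> (\<And>k. E (g k) \<le> B) \<Longrightarrow> E h \<le> B"
    and fin: "\<And>n. E (\<lambda>x. x ^ n) < \<infinity>"
    and growth: "\<And>R::real. 0 < R \<Longrightarrow> \<exists>C>0. \<forall>n. ennreal (R ^ n) \<le> ennreal C * E (\<lambda>x. x ^ n)"
    and unbounded: "\<And>K::real. \<exists>n. ennreal K * E (\<lambda>x. x ^ n) < E (\<lambda>x. x ^ Suc n)"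
  obtains h where "h holomorphic_on UNIV" "E h < \<infinity>"
    "\<And>e. 0 < e \<Longrightarrow> \<exists>p. E (\<lambda>x. h x - poly p x) < ennreal e"
    "E (\<lambda>x. x * h x) = \<infinity>"
proof -
  have pm [measurable]: "poly p \<in> borel_measurable borel" for p :: "complex poly"
    by (intro borel_measurable_continuous_onI continuous_intros)
  define d where "d n = enn2real (E (\<lambda>x. x ^ n))" for n
  have d: "E (\<lambda>x. x ^ n) = ennreal (d n)" for n using fin[of n] by (simp add: d_def)
  \<comment> \<open>Growth with R = 1 excludes the value 0, so that monomials can be
    normalised.\<close>
  have dpos: "0 < d n" for n
  proof -
    obtain C where "ennreal (1 ^ n) \<le> ennreal C * E (\<lambda>x. x ^ n)" using growth[of 1] by auto
    then have "E (\<lambda>x. x ^ n) \<noteq> 0" by auto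
    then show ?thesis using d[of n] by (cases "d n > 0") (auto simp: ennreal_neg)
  qed
  have E0: "E (\<lambda>x. 0) = 0" using scale[of "\<lambda>x. 1" 0] by simp
  have Esum: "E (\<lambda>x. \<Sum>i\<in>I. c i * x ^ i) < \<infinity>" if "finite I" for I c
    using that
  proof (induction I)
    case (insert i I)
    have "E (\<lambda>x. \<Sum>i\<in>insert i I. c i * x ^ i) = E (\<lambda>x. c i * x ^ i + (\<Sum>i\<in>I. c i * x ^ i))"
      using insert by simp
    also have "\<dots> \<le> E (\<lambda>x. c i * x ^ i) + E (\<lambda>x. \<Sum>i\<in>I. c i * x ^ i)"
      by (rule triangle) measurable
    also have "E (\<lambda>x. c i * x ^ i) = ennreal (norm (c i)) * E (\<lambda>x. x ^ i)" by (rule scale) measurable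
    also have "\<dots> + E (\<lambda>x. \<Sum>i\<in>I. c i * x ^ i) < \<infinity>" using insert.IH fin by (simp add: ennreal_mult_less_top)
    finally show ?case .
  qed (simp add: E0)
  have Epoly: "E (\<lambda>x. x * poly p x) < \<infinity>" for p
  proof -
    have "(\<lambda>x. x * poly p x) = (\<lambda>x. \<Sum>i\<le>degree (pCons 0 p). coeff (pCons 0 p) i * x ^ i)"
      using poly_altdef[of "pCons 0 p"] by auto
    then show ?thesis using Esum[of "{..degree (pCons 0 p)}" "coeff (pCons 0 p)"] by simp
  qed
  define t where "t k p x = (if norm x \<le> real k then x * poly p x else 0)" for k :: nat and p :: "complex poly" and x
  have tm [measurable]: "t k p \<in> borel_measurable borel" for k p
    unfolding t_def by measurable
  \<comment> \<open>One hump: a monomial of norm exactly eps' is added to p, of a degree for which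
    multiplication by x enlarges norms so much that the product outweighs x p and still leaves more
    than j. The Fatou property provides a truncation level k' at which this is already
    visible.\<close>
  have step: "\<exists>p' k' eps'. 0 < eps' \<and> eps' \<le> eps / 2 \<and> 2 * real k * eps' \<le> 1 \<and>
      (\<exists>c n. p' = p + monom c n \<and> norm c * d n = eps') \<and> ennreal (real j) < E (t k' p')"
    if "0 < eps" for p eps and k j :: nat
  proof -
    \<comment> \<open>Halving bounds all humps from this one on by 2 eps' in total. The second
      condition makes this total, multiplied by x with |x| at most the previous truncation level k,
      contribute at most 1.\<close>
    define eps' where "eps' = min (eps / 2) (1 / (2 * (real k + 1)))"
    have eps': "0 < eps'" "eps' \<le> eps / 2" using that by (auto simp: eps'_def)
    have "2 * real k * eps' \<le> 2 * (real k + 1) * (1 / (2 * (real k + 1)))"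
      using eps'(1) by (intro mult_mono) (auto simp: eps'_def)
    then have eps'k: "2 * real k * eps' \<le> 1" by simp
    obtain B where B: "0 \<le> B" "E (\<lambda>x. x * poly p x) = ennreal B"
      using Epoly[of p] by (cases "E (\<lambda>x. x * poly p x)") auto
    obtain n where n: "ennreal ((B + real j + 1) / eps') * ennreal (d n) < ennreal (d (Suc n))"
      using unbounded[of "(B + real j + 1) / eps'"] unfolding d by blast
    define c where "c = eps' / d n"
    have c: "0 < c" "c * d n = eps'" using eps'(1) dpos[of n] by (auto simp: c_def)
    define p' where "p' = p + monom (of_real c) n"
    have "(B + real j + 1) / eps' * d n < d (Suc n)"
      using n eps'(1) B(1) dpos[of n] by (simp add: ennreal_mult[symmetric] ennreal_less_iff del: times_divide_eq_left)
    then have "c * ((B + real j + 1) / eps' * d n) < c * d (Suc n)"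
      using c(1) by (rule mult_strict_left_mono)
    also have "c * ((B + real j + 1) / eps' * d n) = (B + real j + 1) * ((c * d n) / eps')" by simp
    also have "\<dots> = B + real j + 1" using c(2) eps'(1) by simp
    finally have big: "B + real j + 1 < c * d (Suc n)" .
    have "ennreal (c * d (Suc n)) = E (\<lambda>x. of_real c * x ^ Suc n)"
      using scale[of "\<lambda>x. x ^ Suc n" "of_real c"] c(1) dpos[of "Suc n"] by (simp add: d ennreal_mult del: power_Suc)
    also have "\<dots> = E (\<lambda>x. x * poly p' x + (- 1) * (x * poly p x))"
      by (simp add: p'_def poly_monom algebra_simps)
    also have "\<dots> \<le> E (\<lambda>x. x * poly p' x) + E (\<lambda>x. (- 1) * (x * poly p x))"
      by (rule triangle) measurable
    also have "E (\<lambda>x. (- 1) * (x * poly p x)) = ennreal B"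
      using scale[of "\<lambda>x. x * poly p x" "- 1"] B by simp
    finally have le: "ennreal (c * d (Suc n)) \<le> E (\<lambda>x. x * poly p' x) + ennreal B" .
    have "\<exists>k'. ennreal (real j) < E (t k' p')"
    proof (rule ccontr)
      assume "\<nexists>k'. ennreal (real j) < E (t k' p')"
      then have *: "E (t k' p') \<le> ennreal (real j)" for k' by (simp add: not_less)
      have "E (\<lambda>x. x * poly p' x) \<le> ennreal (real j)"
      proof (rule Fatou[of "\<lambda>k. t k p'"])
        fix x :: complex
        obtain N :: nat where "norm x \<le> real N" using real_arch_simple by blast
        then have "\<forall>\<^sub>F k in sequentially. t k p' x = x * poly p' x"
          unfolding eventually_sequentially t_def by (intro exI[of _ N]) auto
        then show "(\<lambda>k. t k p' x) \<longlonglongrightarrow> x * poly p' x" by (rule tendsto_eventually)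
      qed (use * in measurable)
      with le have "ennreal (c * d (Suc n)) \<le> ennreal (real j) + ennreal B" using add_right_mono order.trans by blast
      then have "c * d (Suc n) \<le> real j + B" using B(1) by (simp add: ennreal_plus[symmetric] del: ennreal_plus)
      with big show False by simp
    qed
    then obtain k' where k': "ennreal (real j) < E (t k' p')" by blast
    show ?thesis
      using eps' eps'k k' c
      by (intro exI[of _ p'] exI[of _ k'] exI[of _ eps'] conjI exI[of _ "of_real c"] exI[of _ n]) (auto simp: p'_def)
  qed
  \<comment> \<open>A state consists of the polynomial built so far, its truncation level and the
    norm of its last hump. The start (0, 0, 1) contains no hump; its third entry only sets the
    scale.\<close>
  define Q where "Q j s s' \<longleftrightarrow> snd (snd s') \<le> snd (snd s) / 2 \<and> 2 * real (fst (snd s)) * snd (snd s') \<le> 1 \<and>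
      (\<exists>c n. fst s' = fst s + monom c n \<and> norm c * d n = snd (snd s')) \<and> ennreal (real j) < E (t (fst (snd s')) (fst s'))"
    for j :: nat and s s' :: "complex poly \<times> nat \<times> real"
  have "\<exists>s. \<forall>j. (0 < snd (snd (s j)) \<and> (j = 0 \<longrightarrow> s j = (0, 0, 1))) \<and> Q j (s j) (s (Suc j))"
  proof (rule dependent_nat_choice)
    show "\<exists>s :: complex poly \<times> nat \<times> real. 0 < snd (snd s) \<and> (0 = (0::nat) \<longrightarrow> s = (0, 0, 1))" by auto
    fix s :: "complex poly \<times> nat \<times> real" and j :: nat
    assume "0 < snd (snd s) \<and> (j = 0 \<longrightarrow> s = (0, 0, 1))"
    then obtain p' k' eps' where "0 < eps'" "eps' \<le> snd (snd s) / 2" "2 * real (fst (snd s)) * eps' \<le> 1"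
      "\<exists>c n. p' = fst s + monom c n \<and> norm c * d n = eps'" "ennreal (real j) < E (t k' p')"
      using step[of "snd (snd s)" "fst (snd s)" "fst s" j] by blast
    then show "\<exists>s'. (0 < snd (snd s') \<and> (Suc j = 0 \<longrightarrow> s' = (0, 0, 1))) \<and> Q j s s'"
      by (intro exI[of _ "(p', k', eps')"]) (auto simp: Q_def)
  qed
  then obtain s where s: "\<And>j. 0 < snd (snd (s j))" "s 0 = (0, 0, 1)" "\<And>j. Q j (s j) (s (Suc j))" by blast
  define p where "p j = fst (s j)" for j
  define \<kappa> where "\<kappa> j = fst (snd (s j))" for j
  define eps where "eps j = snd (snd (s j))" for j
  have p0: "p 0 = 0" and eps0: "eps 0 = 1" by (simp_all add: p_def eps_def s(2))
  have epspos: "0 < eps j" for j by (simp add: eps_def s(1))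
  have half: "eps (Suc j) \<le> eps j / 2" and \<kappa>eps: "2 * real (\<kappa> j) * eps (Suc j) \<le> 1"
    and big: "ennreal (real j) < E (t (\<kappa> (Suc j)) (p (Suc j)))" for j
    using s(3)[of j] by (auto simp: Q_def p_def \<kappa>_def eps_def)
  have "\<exists>c n. p (Suc j) = p j + monom c n \<and> norm c * d n = eps (Suc j)" for j
    using s(3)[of j] by (auto simp: Q_def p_def eps_def)
  then obtain c n where cn: "\<And>j. p (Suc j) = p j + monom (c j) (n j)" "\<And>j. norm (c j) * d (n j) = eps (Suc j)" by metis
  have geo: "eps (m + i) \<le> eps m * (1 / 2) ^ i" for m i
  proof (induction i)
    case (Suc i)
    then show ?case using half[of "m + i"] by simp
  qed simp
  have Ediff: "E (\<lambda>x. poly (p (m + i)) x - poly (p m) x) \<le> ennreal (2 * eps (Suc m))" for m i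
  proof -
    have "E (\<lambda>x. poly (p (m + i)) x - poly (p m) x) \<le> ennreal (\<Sum>l<i. eps (Suc m + l))"
    proof (induction i)
      case 0
      show ?case by (simp add: E0)
    next
      case (Suc i)
      have "E (\<lambda>x. poly (p (m + Suc i)) x - poly (p m) x)
          = E (\<lambda>x. (poly (p (m + i)) x - poly (p m) x) + c (m + i) * x ^ n (m + i))"
        by (simp add: cn(1) poly_monom algebra_simps)
      also have "\<dots> \<le> E (\<lambda>x. poly (p (m + i)) x - poly (p m) x) + E (\<lambda>x. c (m + i) * x ^ n (m + i))"
        by (rule triangle) measurable
      also have "E (\<lambda>x. c (m + i) * x ^ n (m + i)) = ennreal (norm (c (m + i)) * d (n (m + i)))"
        using scale[of "\<lambda>x. x ^ n (m + i)" "c (m + i)"] dpos[of "n (m + i)"] by (simp add: d ennreal_mult less_imp_le)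
      also have "\<dots> = ennreal (eps (Suc m + i))" by (simp add: cn(2))
      also have "E (\<lambda>x. poly (p (m + i)) x - poly (p m) x) + ennreal (eps (Suc m + i))
          \<le> ennreal (\<Sum>l<i. eps (Suc m + l)) + ennreal (eps (Suc m + i))" by (rule add_right_mono[OF Suc])
      also have "\<dots> = ennreal (\<Sum>l<Suc i. eps (Suc m + l))"
        using epspos by (simp add: ennreal_plus[symmetric] sum_nonneg less_imp_le del: ennreal_plus)
      finally show ?case .
    qed
    also have "(\<Sum>l<i. eps (Suc m + l)) \<le> (\<Sum>l<i. eps (Suc m) * (1 / 2) ^ l)" by (intro sum_mono geo)
    also have "\<dots> = eps (Suc m) * (\<Sum>l<i. (1 / 2) ^ l)" by (simp add: sum_distrib_left)
    also have "\<dots> \<le> eps (Suc m) * 2" using epspos[of "Suc m"] by (intro mult_left_mono) (auto simp: geometric_sum)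
    finally show ?thesis by (simp add: ennreal_leI mult.commute)
  qed
  define h where "h x = (\<Sum>j. poly (p (Suc j)) x - poly (p j) x)" for x
  \<comment> \<open>The growth hypothesis makes the limit entire: on the disk of radius R a monomial
    of norm eps is at most C eps, whatever its degree, so the normalised humps are summable
    uniformly on compact sets.\<close>
  have unif: "uniform_limit (cball 0 R) (\<lambda>N x. poly (p N) x) h sequentially" if R: "0 < R" for R
  proof -
    obtain C where C: "0 < C" "\<And>n. ennreal (R ^ n) \<le> ennreal C * ennreal (d n)"
      using growth[OF R] unfolding d by blast
    have Cd: "R ^ n \<le> C * d n" for n
      using C(2)[of n] C(1) dpos[of n] by (simp add: ennreal_mult[symmetric])
    have "uniform_limit (cball 0 R) (\<lambda>N x. \<Sum>j<N. poly (p (Suc j)) x - poly (p j) x) h sequentially"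
      unfolding h_def
    proof (rule Weierstrass_m_test)
      show "summable (\<lambda>j. C * (1 / 2) ^ j :: real)" by (intro summable_mult summable_geometric) simp
      fix j and x :: complex assume x: "x \<in> cball 0 R"
      have "norm (poly (p (Suc j)) x - poly (p j) x) = norm (c j) * norm x ^ n j"
        by (simp add: cn(1) poly_monom norm_mult norm_power)
      also have "\<dots> \<le> norm (c j) * (C * d (n j))"
        using x Cd[of "n j"] by (intro mult_left_mono order.trans[OF power_mono Cd]) auto
      also have "\<dots> = C * eps (Suc j)" using cn(2)[of j] by (simp add: mult_ac)
      also have "\<dots> \<le> C * (1 / 2) ^ j"
        using geo[of 0 j] half[of j] epspos[of j] C(1) by (intro mult_left_mono) (auto simp: eps0)
      finally show "norm (poly (p (Suc j)) x - poly (p j) x) \<le> C * (1 / 2) ^ j" .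
    qed
    moreover have "(\<Sum>j<N. poly (p (Suc j)) x - poly (p j) x) = poly (p N) x" for N x
      using sum_lessThan_telescope[of "\<lambda>j. poly (p j) x" N] by (simp add: p0)
    ultimately show ?thesis by simp
  qed
  have lim: "(\<lambda>N. poly (p N) x) \<longlonglongrightarrow> h x" for x
    by (rule tendsto_uniform_limitI[OF unif[of "norm x + 1"]]) (auto intro: add_nonneg_pos)
  have holo: "h holomorphic_on UNIV"
  proof (rule holomorphic_uniform_sequence[of UNIV "\<lambda>N. poly (p N)"])
    fix x :: complex
    have "cball x 1 \<subseteq> cball 0 (norm x + 1)"
    proof
      fix y assume "y \<in> cball x 1"
      then show "y \<in> cball 0 (norm x + 1)"
        using norm_triangle_ineq2[of y x] by (simp add: dist_norm norm_minus_commute)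
    qed
    moreover have "0 < norm x + 1" by (rule add_nonneg_pos) auto
    ultimately have "uniform_limit (cball x 1) (\<lambda>N. poly (p N)) h sequentially"
      using uniform_limit_on_subset[OF unif] by blast
    then show "\<exists>d>0. cball x d \<subseteq> UNIV \<and> uniform_limit (cball x d) (\<lambda>N. poly (p N)) h sequentially"
      by (intro exI[of _ 1]) auto
  qed (auto intro!: holomorphic_intros)
  have hm [measurable]: "h \<in> borel_measurable borel"
    by (intro borel_measurable_continuous_onI holomorphic_on_imp_continuous_on holo)
  have Eh: "E (\<lambda>x. h x - poly (p m) x) \<le> ennreal (2 * eps (Suc m))" for m
  proof (rule Fatou[of "\<lambda>i x. poly (p (m + i)) x - poly (p m) x"])
    fix x
    have "(\<lambda>i. poly (p (i + m)) x) \<longlonglongrightarrow> h x" by (rule LIMSEQ_ignore_initial_segment[OF lim])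
    then show "(\<lambda>i. poly (p (m + i)) x - poly (p m) x) \<longlonglongrightarrow> h x - poly (p m) x"
      by (intro tendsto_intros) (simp add: add.commute)
  qed (use Ediff in measurable)
  show ?thesis
  proof (rule that[OF holo])
    have "E h \<le> ennreal (2 * eps (Suc 0))" using Eh[of 0] by (simp add: p0)
    then show "E h < \<infinity>" using le_less_trans by fastforce
  next
    fix e :: real assume e: "0 < e"
    obtain m where m: "(1 / 2) ^ m < e" using real_arch_pow_inv[OF e, of "1 / 2"] by auto
    have "2 * eps (Suc m) < e" using half[of m] geo[of 0 m] m by (simp add: eps0)
    then have "E (\<lambda>x. h x - poly (p m) x) < ennreal e"
      using le_less_trans[OF Eh[of m] ennreal_lessI[OF e]] by blast
    then show "\<exists>p. E (\<lambda>x. h x - poly p x) < ennreal e" by blast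
  next
    show "E (\<lambda>x. x * h x) = \<infinity>"
    proof (rule ccontr)
      assume "E (\<lambda>x. x * h x) \<noteq> \<infinity>"
      then obtain B where B: "0 \<le> B" "E (\<lambda>x. x * h x) = ennreal B" by (cases "E (\<lambda>x. x * h x)") auto
      obtain j :: nat where j: "B + 1 \<le> real j" using real_arch_simple by blast
      \<comment> \<open>The hump built at stage j shows more than j at truncation level
        \<open>?k\<close>. Replacing \<open>?p\<close> by \<open>h\<close> changes the truncated
        product by at most 1, so x h would have norm at least j - 1.\<close>
      let ?k = "\<kappa> (Suc j)" and ?p = "p (Suc j)"
      have "E (t ?k ?p) = E (\<lambda>x. (if norm x \<le> real ?k then x * h x else 0) + (if norm x \<le> real ?k then x * (poly ?p x - h x) else 0))"
        by (rule arg_cong[of _ _ E]) (auto simp: t_def algebra_simps)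
      also have "\<dots> \<le> E (\<lambda>x. if norm x \<le> real ?k then x * h x else 0) + E (\<lambda>x. if norm x \<le> real ?k then x * (poly ?p x - h x) else 0)"
        by (rule triangle) measurable
      also have "\<dots> \<le> E (\<lambda>x. x * h x) + E (\<lambda>x. of_nat ?k * (h x - poly ?p x))"
        by (intro add_mono mono) (auto simp: norm_mult norm_minus_commute intro: mult_right_mono)
      also have "E (\<lambda>x. of_nat ?k * (h x - poly ?p x)) = ennreal (real ?k) * E (\<lambda>x. h x - poly ?p x)"
        using scale[of "\<lambda>x. h x - poly ?p x" "of_nat ?k"] by simp
      also have "\<dots> \<le> ennreal (real ?k) * ennreal (2 * eps (Suc (Suc j)))" by (intro mult_left_mono Eh) simp
      also have "\<dots> = ennreal (2 * real ?k * eps (Suc (Suc j)))"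
        using epspos[of "Suc (Suc j)"] by (simp add: ennreal_mult[symmetric] mult_ac)
      also have "\<dots> \<le> ennreal 1" by (intro ennreal_leI \<kappa>eps)
      finally have "E (t ?k ?p) \<le> ennreal B + ennreal 1" by (simp add: B(2) add_left_mono)
      also have "\<dots> = ennreal (B + 1)" using B(1) by (simp add: ennreal_plus)
      finally have "ennreal (real j) < ennreal (B + 1)" using big[of j] by (rule less_le_trans[rotated])
      then have "real j < B + 1" by (subst (asm) ennreal_less_iff) auto
      then show False using j by simp
    qed
  qed
qed

context continuous_rotationally_symmetric_norm
begin

lemma H_alpha_circle_polynomial_image:
  assumes "\<And>n. (\<lambda>z. F z ^ n) \<in> H_alpha_circle \<alpha>"
  shows "(\<lambda>z. poly p (F z)) \<in> H_alpha_circle \<alpha>"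
proof -
  have "(\<lambda>z. \<Sum>i\<in>I. coeff p i * F z ^ i) \<in> H_alpha_circle \<alpha>" if "finite I" for I
    using that
  proof (induction I)
    case empty
    then show ?case using poly_in_H_alpha_circle[of 0] by (simp add: poly_0[abs_def])
  next
    case (insert i I)
    have "(\<lambda>z. poly [:coeff p i:] z * F z ^ i) \<in> H_alpha_circle \<alpha>" by (rule H_alpha_circle_poly_mult[OF assms])
    from H_alpha_circle_add[OF this insert.IH] show ?case using insert by simp
  qed
  from this[of "{..degree p}"] show ?thesis by (simp add: poly_altdef)
qed

text \<open>\<open>E g\<close> is the larger of the norm of g o F on the circle and the supremum of
  the means of g o \<phi> inside. Membership of g o \<phi> in the space makes both finite, while the
  hump argument produces h with E h finite and E (x h) infinite.\<close>

lemma mult_H_alpha_disk_imp_Hinf: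
  assumes holo: "\<phi> holomorphic_on ball 0 1"
    and sub: "mult_op \<phi> ` H_alpha_disk \<alpha> \<subseteq> H_alpha_disk \<alpha>"
  shows "\<phi> \<in> Hinf_disk"
proof (rule ccontr)
  assume notinf: "\<phi> \<notin> Hinf_disk"
  have large: "\<exists>w. norm w < 1 \<and> R < norm (\<phi> w)" for R
  proof (rule ccontr)
    assume neg: "\<not> ?thesis"
    have "norm (\<phi> z) \<le> R" if "z \<in> ball 0 1" for z using neg that by force
    then have "Hinf_norm \<phi> \<le> ennreal R"
      unfolding Hinf_norm_def by (intro SUP_least ennreal_leI)
    then have "Hinf_norm \<phi> < \<infinity>" using le_less_trans by fastforce
    with notinf holo show False by (simp add: Hinf_disk_def)
  qed
  have pow: "(\<lambda>z. \<phi> z ^ n) \<in> H_alpha_disk \<alpha>" for n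
  proof (induction n)
    case 0
    then show ?case using H_alpha_disk_const[of 1] by simp
  next
    case (Suc n)
    then have "mult_op \<phi> (\<lambda>z. \<phi> z ^ n) \<in> H_alpha_disk \<alpha>" using sub by blast
    then show ?case by (simp add: mult_op_def)
  qed
  obtain F where F: "has_boundary_function \<phi> F" using pow[of 1] H_alpha_disk_iff by auto
  have Fm: "F \<in> borel_measurable \<mu>" by (rule has_boundary_function_measurable[OF holo F])
  have bF: "has_boundary_function (\<lambda>z. \<phi> z ^ n) (\<lambda>z. F z ^ n)" for n
    by (intro has_boundary_function_continuous[OF F, of "\<lambda>w. w ^ n"] continuous_intros)
  have HF: "(\<lambda>z. F z ^ n) \<in> H_alpha_circle \<alpha>" for n by (rule H_alpha_disk_boundary[OF pow bF])
  define A where "A g = (SUP r \<in> {0..<1::real}. \<integral>\<^sup>+z. ennreal (norm (g (\<phi> (of_real r * z)))) \<partial>\<mu>)"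
    for g :: "complex \<Rightarrow> complex"
  define E where "E g = max (\<N> (\<lambda>z. g (F z))) (A g)" for g :: "complex \<Rightarrow> complex"
  have gF: "(\<lambda>z. g (F z)) \<in> borel_measurable \<mu>" if "g \<in> borel_measurable borel" for g :: "complex \<Rightarrow> complex"
    by (rule measurable_compose[OF Fm that])
  have g\<phi>: "(\<lambda>z. g (\<phi> (of_real r * z))) \<in> borel_measurable \<mu>"
    if "g \<in> borel_measurable borel" "r \<in> {0..<1}" for g :: "complex \<Rightarrow> complex" and r
    using that(2) by (intro measurable_compose[OF _ that(1)] holomorphic_dilation[OF holo]) auto
  have AE_le: "A g \<le> E g" "\<N> (\<lambda>z. g (F z)) \<le> E g" for g by (auto simp: E_def)
  \<comment> \<open>The constant does not depend on n, so a large value of \<phi> at a single point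
    forces exponential growth of the norms of the powers. Both remaining hypotheses of the hump
    argument rest on this.\<close>
  have point: "\<exists>C>0. \<forall>n. ennreal (norm (\<phi> w) ^ n) \<le> ennreal C * E (\<lambda>x. x ^ n)" if w: "norm w < 1" for w
  proof -
    obtain C where C: "0 < C" "\<And>f. f holomorphic_on ball 0 1 \<Longrightarrow>
      ennreal (norm (f w)) \<le> ennreal C * H1_norm f"
      using point_evaluation_bound[OF w] by blast
    have "ennreal (norm (\<phi> w) ^ n) \<le> ennreal C * E (\<lambda>x. x ^ n)" for n
    proof -
      have "(\<lambda>z. \<phi> z ^ n) holomorphic_on ball 0 1" by (intro holomorphic_intros holo)
      from C(2)[OF this] have "ennreal (norm (\<phi> w) ^ n) \<le> ennreal C * A (\<lambda>x. x ^ n)" by (simp add: A_def norm_power)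
      also have "\<dots> \<le> ennreal C * E (\<lambda>x. x ^ n)" by (intro mult_left_mono AE_le) simp
      finally show ?thesis .
    qed
    with C(1) show ?thesis by blast
  qed
  have mono: "E g \<le> E h" if "\<And>x. norm (g x) \<le> norm (h x)" for g h
    unfolding E_def A_def using that
    by (intro max.mono extended_norm_mono AE_I2 SUP_mono' nn_integral_mono ennreal_leI)
  have triangle: "E (\<lambda>x. g x + h x) \<le> E g + E h" if gh: "g \<in> borel_measurable borel" "h \<in> borel_measurable borel" for g h
    unfolding E_def[of "\<lambda>x. g x + h x"]
  proof (rule max.boundedI)
    have "\<N> (\<lambda>z. g (F z) + h (F z)) \<le> \<N> (\<lambda>z. g (F z)) + \<N> (\<lambda>z. h (F z))"
      by (intro extended_norm_triangle gF gh)
    also have "\<dots> \<le> E g + E h" by (intro add_mono AE_le)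
    finally show "\<N> (\<lambda>z. g (F z) + h (F z)) \<le> E g + E h" .
    show "A (\<lambda>x. g x + h x) \<le> E g + E h"
      unfolding A_def[of "\<lambda>x. g x + h x"]
    proof (rule SUP_least)
      fix r :: real assume r: "r \<in> {0..<1}"
      note [measurable] = g\<phi>[OF gh(1) r] g\<phi>[OF gh(2) r]
      have "(\<integral>\<^sup>+z. ennreal (norm (g (\<phi> (of_real r * z)) + h (\<phi> (of_real r * z)))) \<partial>\<mu>)
          \<le> (\<integral>\<^sup>+z. ennreal (norm (g (\<phi> (of_real r * z)))) + ennreal (norm (h (\<phi> (of_real r * z)))) \<partial>\<mu>)"
        by (intro nn_integral_mono) (simp add: norm_triangle_ineq ennreal_leI flip: ennreal_plus)
      also have "\<dots> = (\<integral>\<^sup>+z. ennreal (norm (g (\<phi> (of_real r * z)))) \<partial>\<mu>) +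
          (\<integral>\<^sup>+z. ennreal (norm (h (\<phi> (of_real r * z)))) \<partial>\<mu>)"
        by (rule nn_integral_add) measurable
      also have "\<dots> \<le> A g + A h" unfolding A_def using r by (intro add_mono SUP_upper)
      also have "\<dots> \<le> E g + E h" by (intro add_mono AE_le)
      finally show "(\<integral>\<^sup>+z. ennreal (norm (g (\<phi> (of_real r * z)) + h (\<phi> (of_real r * z)))) \<partial>\<mu>) \<le> E g + E h" .
    qed
  qed
  have scale: "E (\<lambda>x. c * g x) = ennreal (norm c) * E g" if g: "g \<in> borel_measurable borel" for c g
  proof -
    have "A (\<lambda>x. c * g x) = (SUP r \<in> {0..<1::real}. ennreal (norm c) * (\<integral>\<^sup>+z. ennreal (norm (g (\<phi> (of_real r * z)))) \<partial>\<mu>))"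
      unfolding A_def
    proof (rule SUP_cong[OF refl])
      fix r :: real assume r: "r \<in> {0..<1}"
      note [measurable] = g\<phi>[OF g r]
      show "(\<integral>\<^sup>+z. ennreal (norm (c * g (\<phi> (of_real r * z)))) \<partial>\<mu>)
          = ennreal (norm c) * (\<integral>\<^sup>+z. ennreal (norm (g (\<phi> (of_real r * z)))) \<partial>\<mu>)"
        by (subst nn_integral_cmult[symmetric]) (auto simp: norm_mult ennreal_mult)
    qed
    also have "\<dots> = ennreal (norm c) * A g" unfolding A_def by (rule SUP_mult_left_ennreal[symmetric])
    finally show ?thesis
      unfolding E_def extended_norm_scale by (simp add: max_of_mono monoI mult_left_mono)
  qed
  \<comment> \<open>On the boundary this is the Fatou property of the norm, inside it is Fatou's
    lemma on each circle separately.\<close>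
  have Fatou: "E h \<le> B" if g: "\<And>k::nat. g k \<in> borel_measurable borel" and h: "h \<in> borel_measurable borel"
    and lim: "\<And>x. (\<lambda>k. g k x) \<longlonglongrightarrow> h x" and B: "\<And>k. E (g k) \<le> B" for g h B
    unfolding E_def
  proof (rule max.boundedI)
    show "\<N> (\<lambda>z. h (F z)) \<le> B"
      by (rule extended_norm_Fatou[where F = "\<lambda>k z. g k (F z)"])
         (use lim order.trans[OF AE_le(2) B] gF g h in auto)
    show "A h \<le> B"
      unfolding A_def
    proof (rule SUP_least)
      fix r :: real assume r: "r \<in> {0..<1}"
      note [measurable] = g\<phi>[OF g r]
      have "(\<integral>\<^sup>+z. ennreal (norm (h (\<phi> (of_real r * z)))) \<partial>\<mu>)
          = (\<integral>\<^sup>+z. liminf (\<lambda>k. ennreal (norm (g k (\<phi> (of_real r * z))))) \<partial>\<mu>)"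
        by (intro nn_integral_cong lim_imp_Liminf[symmetric] tendsto_ennrealI tendsto_norm lim) simp
      also have "\<dots> \<le> liminf (\<lambda>k. \<integral>\<^sup>+z. ennreal (norm (g k (\<phi> (of_real r * z)))) \<partial>\<mu>)"
        by (rule nn_integral_liminf) measurable
      also have "\<dots> \<le> liminf (\<lambda>k. B)"
      proof (intro Liminf_mono always_eventually allI)
        fix k
        have "(\<integral>\<^sup>+z. ennreal (norm (g k (\<phi> (of_real r * z)))) \<partial>\<mu>) \<le> A (g k)"
          unfolding A_def using r by (rule SUP_upper)
        also have "\<dots> \<le> B" by (rule order.trans[OF AE_le(1) B])
        finally show "(\<integral>\<^sup>+z. ennreal (norm (g k (\<phi> (of_real r * z)))) \<partial>\<mu>) \<le> B" .
      qed
      also have "\<dots> = B" by (simp add: Liminf_const)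
      finally show "(\<integral>\<^sup>+z. ennreal (norm (h (\<phi> (of_real r * z)))) \<partial>\<mu>) \<le> B" .
    qed
  qed
  have fin: "E (\<lambda>x. x ^ n) < \<infinity>" for n
    using H_alpha_circle_finite[OF HF[of n]] pow[of n]
    by (simp add: E_def A_def H_alpha_disk_iff H1_disk_def)
  have growth: "\<exists>C>0. \<forall>n. ennreal (R ^ n) \<le> ennreal C * E (\<lambda>x. x ^ n)" if "0 < R" for R :: real
  proof -
    obtain w where w: "norm w < 1" "R < norm (\<phi> w)" using large by blast
    obtain C where C: "0 < C" "\<And>n. ennreal (norm (\<phi> w) ^ n) \<le> ennreal C * E (\<lambda>x. x ^ n)" using point[OF w(1)] by blast
    have "ennreal (R ^ n) \<le> ennreal C * E (\<lambda>x. x ^ n)" for n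
      using C(2)[of n] w(2) that by (intro order.trans[OF ennreal_leI[OF power_mono] C(2)]) auto
    with C(1) show ?thesis by blast
  qed
  have unbounded: "\<exists>n. ennreal K * E (\<lambda>x. x ^ n) < E (\<lambda>x. x ^ Suc n)" for K :: real
  proof (rule ccontr)
    assume "\<not> ?thesis"
    then have le: "E (\<lambda>x. x ^ Suc n) \<le> ennreal K * E (\<lambda>x. x ^ n)" for n by (simp add: not_less)
    \<comment> \<open>Unless the norms of consecutive powers have unbounded quotients, they grow at
      most like L^n; a point where |\<phi>| exceeds L refutes that. The maximum with 1 keeps L
      positive for every K.\<close>
    define L where "L = max K 1"
    obtain e where e: "0 \<le> e" "E (\<lambda>x. x ^ 0) = ennreal e" using fin[of 0] by (cases "E (\<lambda>x. x ^ 0)") auto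
    have EL: "E (\<lambda>x. x ^ n) \<le> ennreal (L ^ n * e)" for n
    proof (induction n)
      case 0
      then show ?case using e by simp
    next
      case (Suc n)
      have "E (\<lambda>x. x ^ Suc n) \<le> ennreal L * ennreal (L ^ n * e)"
        by (rule order.trans[OF le mult_mono]) (use Suc in \<open>auto simp: L_def intro: ennreal_leI\<close>)
      also have "\<dots> = ennreal (L ^ Suc n * e)"
        using e(1) by (simp add: L_def ennreal_mult[symmetric] mult.assoc)
      finally show ?case .
    qed
    obtain w where w: "norm w < 1" "L < norm (\<phi> w)" using large by blast
    obtain C where C: "0 < C" "\<And>n. ennreal (norm (\<phi> w) ^ n) \<le> ennreal C * E (\<lambda>x. x ^ n)" using point[OF w(1)] by blast
    have L0: "0 < L" by (simp add: L_def)
    have "1 < norm (\<phi> w) / L" using w(2) L0 by simp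
    then obtain n where n: "C * e < (norm (\<phi> w) / L) ^ n" using real_arch_pow by blast
    have "ennreal (norm (\<phi> w) ^ n) \<le> ennreal C * ennreal (L ^ n * e)"
      by (rule order.trans[OF C(2) mult_left_mono[OF EL]]) simp
    then have "norm (\<phi> w) ^ n \<le> C * (L ^ n * e)"
      using C(1) e(1) L0 by (simp add: ennreal_mult[symmetric])
    then have "(norm (\<phi> w) / L) ^ n \<le> C * e" using L0 by (simp add: power_divide divide_le_eq mult_ac)
    with n show False by simp
  qed
  obtain h where h: "h holomorphic_on UNIV" "E h < \<infinity>"
    "\<And>e. 0 < e \<Longrightarrow> \<exists>p. E (\<lambda>x. h x - poly p x) < ennreal e" "E (\<lambda>x. x * h x) = \<infinity>"
  proof (rule gliding_hump[of E])
    show "E g \<le> E h" if "\<And>x. norm (g x) \<le> norm (h x)" for g h using that by (rule mono)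
    show "E h \<le> B" if "\<And>k::nat. g k \<in> borel_measurable borel" "h \<in> borel_measurable borel"
      "\<And>x. (\<lambda>k. g k x) \<longlonglongrightarrow> h x" "\<And>k. E (g k) \<le> B" for g h B
      using that by (rule Fatou)
  qed (use triangle scale fin growth unbounded in blast)+
  have hc: "continuous_on UNIV h" by (rule holomorphic_on_imp_continuous_on[OF h(1)])
  then have hm: "h \<in> borel_measurable borel" by (rule borel_measurable_continuous_onI)
  have HhF: "(\<lambda>z. h (F z)) \<in> H_alpha_circle \<alpha>"
  proof (rule H_alpha_circle_limit[OF gF[OF hm]])
    fix e :: real assume "0 < e"
    then obtain p where "E (\<lambda>x. h x - poly p x) < ennreal e" using h(3) by blast
    then have "\<N> (\<lambda>z. h (F z) - poly p (F z)) < ennreal e" by (rule le_less_trans[OF AE_le(2)])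
    then show "\<exists>G\<in>H_alpha_circle \<alpha>. \<N> (\<lambda>z. h (F z) - G z) < ennreal e"
      by (intro bexI[OF _ H_alpha_circle_polynomial_image[OF HF]])
  qed
  have "A h < \<infinity>" by (rule le_less_trans[OF AE_le(1) h(2)])
  moreover have "(\<lambda>z. h (\<phi> z)) holomorphic_on ball 0 1"
    using holomorphic_on_compose[OF holo holomorphic_on_subset[OF h(1)]] by (simp add: comp_def)
  ultimately have "(\<lambda>z. h (\<phi> z)) \<in> H1_disk" by (simp add: H1_disk_def A_def)
  moreover have bh: "has_boundary_function (\<lambda>z. h (\<phi> z)) (\<lambda>z. h (F z))"
    by (rule has_boundary_function_continuous[OF F hc])
  ultimately have "(\<lambda>z. h (\<phi> z)) \<in> H_alpha_disk \<alpha>" using HhF H_alpha_disk_iff by blast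
  with sub have mh: "mult_op \<phi> (\<lambda>z. h (\<phi> z)) \<in> H_alpha_disk \<alpha>" by blast
  have "has_boundary_function (mult_op \<phi> (\<lambda>z. h (\<phi> z))) (\<lambda>z. F z * h (F z))"
    unfolding mult_op_def by (rule has_boundary_function_mult[OF F bh])
  then have "\<N> (\<lambda>z. F z * h (F z)) < \<infinity>"
    by (intro H_alpha_circle_finite H_alpha_disk_boundary[OF mh])
  moreover have "A (\<lambda>x. x * h x) < \<infinity>"
    using mh by (simp add: H_alpha_disk_iff H1_disk_def A_def mult_op_def)
  ultimately show False using h(4) by (simp add: E_def max_def split: if_splits)
qed

end

theorem theorem9p4:
  fixes \<alpha> :: "(complex \<Rightarrow> complex) \<Rightarrow> real" and \<phi> \<psi> :: "complex \<Rightarrow> complex"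
  assumes "continuous_rotationally_symmetric_norm \<alpha>"
    and "\<phi> holomorphic_on ball 0 1"
    and "\<psi> \<in> borel_measurable circle_measure"
  shows "(mult_op \<psi> ` L_alpha \<alpha> \<subseteq> L_alpha \<alpha> \<longleftrightarrow> \<psi> \<in> Linf_circle) \<and>
         (\<psi> \<in> Linf_circle \<longrightarrow>
            Linf_norm \<psi> = operator_norm (extended_norm \<alpha>) (L_alpha \<alpha>) (mult_op \<psi>)) \<and>
         (mult_op \<phi> ` H_alpha_disk \<alpha> \<subseteq> H_alpha_disk \<alpha> \<longleftrightarrow> \<phi> \<in> Hinf_disk) \<and>
         (\<phi> \<in> Hinf_disk \<longrightarrow>
            Hinf_norm \<phi> = operator_norm (H_alpha_disk_norm \<alpha>) (H_alpha_disk \<alpha>) (mult_op \<phi>))"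
proof -
  interpret continuous_rotationally_symmetric_norm \<alpha> by fact
  have "mult_op \<psi> ` L_alpha \<alpha> \<subseteq> L_alpha \<alpha> \<longleftrightarrow> \<psi> \<in> Linf_circle"
    using mult_L_alpha_imp_Linf[OF assms(3)] Linf_mult_L_alpha by blast
  moreover have "mult_op \<phi> ` H_alpha_disk \<alpha> \<subseteq> H_alpha_disk \<alpha> \<longleftrightarrow> \<phi> \<in> Hinf_disk"
    using mult_H_alpha_disk_imp_Hinf[OF assms(2)] Hinf_mult_H_alpha_disk by blast
  ultimately show ?thesis
    using Linf_norm_eq_operator_norm Hinf_norm_le_operator_norm operator_norm_le_Hinf_norm antisym by blast
qed

end
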